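(* Let $R$ be a field, $m,n\ge1$, and $Q=(q_1,\dots,q_m)\in R^m$ separated. Let $\boldsymbol\lambda=(\lambda^1;\dots;\lambda^m)$ be an $m$-multipartition of $n$. Then the Schur element of the degenerate cyclotomic Hecke algebra $\mathcal H_{m,n}(Q)$ associated to $\boldsymbol\lambda$ is $$s_{\boldsymbol\lambda}(Q)=\prod_{1\le s\le m}\prod_{(i,j)\in[\lambda^s]}\prod_{1\le t\le m}(h^{\lambda^s, \lambda^t}_{i,j}+q_s-q_t)=\prod_{1\le s\le m}\prod_{(i,j)\in[\lambda^s]}\biggl(h^{\lambda^s}_{i,j}\prod_{1\le t\le m,\ t\neq s}(h^{\lambda^s, \lambda^t}_{i,j}+q_s-q_t)\biggr).$$
   Context: For partitions $\lambda,\mu$ and $(i,j)\in[\lambda]=\{(i,j):1\le j\le\lambda_i\}$, $h^{\lambda,\mu}_{i,j}=\lambda_i-i+\bar\mu_j-j+1$ where $\bar\mu_j$ is the number of $i$ with $\mu_i\ge j$; $h^\lambda_{i,j}=h^{\lambda,\lambda}_{i,j}$ is the usual hook length. For a commutative ring $R$ and $Q=(q_1,\dots,q_m)\in R^m$, $\mathcal H_{m,n}(Q)$ is the unital $R$-algebra generated by $s_0,\dots,s_{n-1}$ subject to: $(s_0-q_1)\cdots(s_0-q_m)=0$; $s_0(s_1s_0s_1+s_1)=(s_1s_0s_1+s_1)s_0$; $s_i^2=1$ ($1\le i<n$); $s_is_{i+1}s_i=s_{i+1}s_is_{i+1}$; $s_is_j=s_js_i$ for $|i-j|>1$. Jucys–Murphy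 elements: $x_1=s_0$, $x_{i+1}=s_ix_is_i+s_i$. It is $R$-free with basis $\{x_1^{i_1}\cdots x_n^{i_n}w: 0\le i_k<m,\ w\in\langle s_1,\dots,s_{n-1}\rangle\cong S_n\}$, and $\tau(x_1^{i_1}\cdots x_n^{i_n}w)=1$ if all $i_k=m-1$ and $w=1$, else $0$, defines a non-degenerate trace form. $Q$ is separated if $n!\prod_{i<j}\prod_{|d|<n}(d+q_i-q_j)$ is invertible. An $m$-multipartition of $n$ is $(\lambda^1;\dots;\lambda^m)$ with $\sum|\lambda^s|=n$. When $R$ is a field and $Q$ is separated, the algebra is split semisimple with simple modules $S^{\boldsymbol\lambda}$, where $S^{\boldsymbol\lambda}$ has a basis $\{v_{\mathfrak t}\}$ indexed by standard $\boldsymbol\lambda$-tableaux with $x_kv_{\mathfrak t}=(j-i+q_c)v_{\mathfrak t}$ when $\mathfrak t$ places $k$ at node $(i,j,c)$ (row $i$, column $j$ of component $c$). With $\chi^{\boldsymbol\lambda}$ its character, the Schur elements are the $s_{\boldsymbol\lambda}(Q)\in R$ with $\tau=\sum_{\boldsymbol\lambda}\chi^{\boldsymbol\lambda}/s_{\boldsymbol\lambda}(Q)$. *)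

theory Defs
  imports "Jordan_Normal_Form.Matrix"
begin

text \<open>A partition is a list of positive naturals in nonincreasing order;
  its i-th part (1-based) is p!(i-1).\<close>
definition is_partition :: "nat list \<Rightarrow> bool" where
  "is_partition p \<longleftrightarrow> sorted_wrt (\<ge>) p \<and> (\<forall>x\<in>set p. 0 < x)"

text \<open>m-multipartitions of n, as lists of length m; component c (1-based) is lam!(c-1).\<close>
definition multipartitions :: "nat \<Rightarrow> nat \<Rightarrow> nat list list set" where
  "multipartitions m n = {lam. length lam = m \<and> (\<forall>p\<in>set lam. is_partition p)
                                \<and> sum_list (map sum_list lam) = n}"

definition young :: "nat list \<Rightarrow> (nat \<times> nat) set" where
  "young p = {(i,j). 1 \<le> i \<and> i \<le> length p \<and> 1 \<le> j \<and> j \<le> p!(i-1)}"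

definition conj_part :: "nat list \<Rightarrow> nat \<Rightarrow> nat" where
  "conj_part p j = card {i. 1 \<le> i \<and> i \<le> length p \<and> j \<le> p!(i-1)}"

definition ghook :: "nat list \<Rightarrow> nat list \<Rightarrow> nat \<Rightarrow> nat \<Rightarrow> int" where
  "ghook la mu i j = int (la!(i-1)) - int i + int (conj_part mu j) - int j + 1"

definition hook :: "nat list \<Rightarrow> nat \<Rightarrow> nat \<Rightarrow> int" where
  "hook la i j = ghook la la i j"

definition schur_formula1 :: "(nat \<Rightarrow> 'k::field) \<Rightarrow> nat \<Rightarrow> nat list list \<Rightarrow> 'k" where
  "schur_formula1 Q m lam =
     (\<Prod>s\<in>{1..m}. \<Prod>(i,j)\<in>young (lam!(s-1)). \<Prod>t\<in>{1..m}.
        (of_int (ghook (lam!(s-1)) (lam!(t-1)) i j) + Q s - Q t))"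

definition schur_formula2 :: "(nat \<Rightarrow> 'k::field) \<Rightarrow> nat \<Rightarrow> nat list list \<Rightarrow> 'k" where
  "schur_formula2 Q m lam =
     (\<Prod>s\<in>{1..m}. \<Prod>(i,j)\<in>young (lam!(s-1)).
        (of_int (hook (lam!(s-1)) i j) *
         (\<Prod>t\<in>{1..m} - {s}. (of_int (ghook (lam!(s-1)) (lam!(t-1)) i j) + Q s - Q t))))"

definition mnodes :: "nat list list \<Rightarrow> (nat \<times> nat \<times> nat) set" where
  "mnodes lam = {(i,j,c). 1 \<le> c \<and> c \<le> length lam \<and> (i,j) \<in> young (lam!(c-1))}"

text \<open>Standard tableaux: bijections from the nodes to {1..n}, increasing along rows and
  down columns of each component (and 0 off the diagram, for extensionality).\<close>
definition std_tableaux :: "nat list list \<Rightarrow> nat \<Rightarrow> (nat \<times> nat \<times> nat \<Rightarrow> nat) set" where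
  "std_tableaux lam n = {T. bij_betw T (mnodes lam) {1..n}
      \<and> (\<forall>v. v \<notin> mnodes lam \<longrightarrow> T v = 0)
      \<and> (\<forall>i j c. (i,j,c) \<in> mnodes lam \<longrightarrow> (i,Suc j,c) \<in> mnodes lam \<longrightarrow> T (i,j,c) < T (i,Suc j,c))
      \<and> (\<forall>i j c. (i,j,c) \<in> mnodes lam \<longrightarrow> (Suc i,j,c) \<in> mnodes lam \<longrightarrow> T (i,j,c) < T (Suc i,j,c))}"

definition node_content :: "(nat \<Rightarrow> 'k::field) \<Rightarrow> nat \<times> nat \<times> nat \<Rightarrow> 'k" where
  "node_content Q v = (case v of (i,j,c) \<Rightarrow> of_int (int j - int i) + Q c)"

definition tab_content :: "(nat \<Rightarrow> 'k::field) \<Rightarrow> nat list list \<Rightarrow> (nat \<times> nat \<times> nat \<Rightarrow> nat) \<Rightarrow> nat \<Rightarrow> 'k" where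
  "tab_content Q lam T k = node_content Q (inv_into (mnodes lam) T k)"

definition separated :: "(nat \<Rightarrow> 'k::field) \<Rightarrow> nat \<Rightarrow> nat \<Rightarrow> bool" where
  "separated Q m n \<longleftrightarrow>
     of_nat (fact n) * (\<Prod>i\<in>{1..m}. \<Prod>j\<in>{i<..m}. \<Prod>d\<in>{-(int n - 1)..int n - 1}.
                 (of_int d + Q i - Q j)) \<noteq> (0::'k)"

text \<open>An R-algebra structure on a ring 'a is given by a ring homomorphism of_k from the
  field 'k into the centre of 'a (scalar multiplication c.a = of_k c * a).\<close>
definition is_k_algebra :: "('k::field \<Rightarrow> 'a::ring_1) \<Rightarrow> bool" where
  "is_k_algebra of_k \<longleftrightarrow> (\<forall>a b. of_k (a + b) = of_k a + of_k b) \<and> (\<forall>a b. of_k (a * b) = of_k a * of_k b)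
     \<and> of_k 1 = 1 \<and> (\<forall>c x. of_k c * x = x * of_k c)"

text \<open>Jucys--Murphy elements x_1 = s_0, x_{k+1} = s_k x_k s_k + s_k (x_0 is junk).\<close>
fun jm :: "(nat \<Rightarrow> 'a::ring_1) \<Rightarrow> nat \<Rightarrow> 'a" where
  "jm s 0 = 0"
| "jm s (Suc 0) = s 0"
| "jm s (Suc (Suc k)) = s (Suc k) * jm s (Suc k) * s (Suc k) + s (Suc k)"

definition hecke_relations :: "('k::field \<Rightarrow> 'a::ring_1) \<Rightarrow> (nat \<Rightarrow> 'k) \<Rightarrow> nat \<Rightarrow> nat \<Rightarrow> (nat \<Rightarrow> 'a) \<Rightarrow> bool" where
  "hecke_relations of_k Q m n s \<longleftrightarrow>
     prod_list (map (\<lambda>c. s 0 - of_k (Q c)) [1..<Suc m]) = 0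
   \<and> (2 \<le> n \<longrightarrow> s 0 * (s 1 * s 0 * s 1 + s 1) = (s 1 * s 0 * s 1 + s 1) * s 0)
   \<and> (\<forall>i. 1 \<le> i \<and> i < n \<longrightarrow> s i * s i = 1)
   \<and> (\<forall>i. 1 \<le> i \<and> Suc i < n \<longrightarrow> s i * s (Suc i) * s i = s (Suc i) * s i * s (Suc i))
   \<and> (\<forall>i j. i < n \<and> j < n \<and> (Suc i < j \<or> Suc j < i) \<longrightarrow> s i * s j = s j * s i)"

definition sym_part :: "(nat \<Rightarrow> 'a::ring_1) \<Rightarrow> nat \<Rightarrow> 'a set" where
  "sym_part s n = {prod_list (map s ws) | ws. set ws \<subseteq> {1..<n}}"

definition basis_index :: "(nat \<Rightarrow> 'a::ring_1) \<Rightarrow> nat \<Rightarrow> nat \<Rightarrow> (nat list \<times> 'a) set" where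
  "basis_index s m n = {es. length es = n \<and> (\<forall>e\<in>set es. e < m)} \<times> sym_part s n"

definition basis_elt :: "(nat \<Rightarrow> 'a::ring_1) \<Rightarrow> nat \<Rightarrow> nat list \<times> 'a \<Rightarrow> 'a" where
  "basis_elt s n b = prod_list (map (\<lambda>k. jm s (Suc k) ^ (fst b ! k)) [0..<n]) * snd b"

text \<open>'a (with of_k, s) is the degenerate cyclotomic Hecke algebra H_{m,n}(Q):
  generated by s subject to the relations, with the stated free basis, and
  <s_1..s_{n-1}> of order n! (so 'a is isomorphic to H_{m,n}(Q)).\<close>
definition is_dc_hecke :: "('k::field \<Rightarrow> 'a::ring_1) \<Rightarrow> (nat \<Rightarrow> 'k) \<Rightarrow> nat \<Rightarrow> nat \<Rightarrow> (nat \<Rightarrow> 'a) \<Rightarrow> bool" where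
  "is_dc_hecke of_k Q m n s \<longleftrightarrow>
     is_k_algebra of_k \<and> hecke_relations of_k Q m n s
   \<and> card (sym_part s n) = fact n
   \<and> (\<forall>c. (\<Sum>b\<in>basis_index s m n. of_k (c b) * basis_elt s n b) = 0 \<longrightarrow> (\<forall>b\<in>basis_index s m n. c b = 0))
   \<and> (\<forall>a. \<exists>c. a = (\<Sum>b\<in>basis_index s m n. of_k (c b) * basis_elt s n b))"

definition is_trace_form :: "('k::field \<Rightarrow> 'a::ring_1) \<Rightarrow> nat \<Rightarrow> nat \<Rightarrow> (nat \<Rightarrow> 'a) \<Rightarrow> ('a \<Rightarrow> 'k) \<Rightarrow> bool" where
  "is_trace_form of_k m n s tau \<longleftrightarrow>
     (\<forall>c a b. tau (of_k c * a + b) = c * tau a + tau b)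
   \<and> (\<forall>b\<in>basis_index s m n. tau (basis_elt s n b) = (if fst b = replicate n (m - 1) \<and> snd b = 1 then 1 else 0))"

definition mtrace :: "'k::comm_ring_1 mat \<Rightarrow> 'k" where
  "mtrace A = (\<Sum>i<dim_row A. A $$ (i,i))"

definition is_rep :: "('k::field \<Rightarrow> 'a::ring_1) \<Rightarrow> nat \<Rightarrow> ('a \<Rightarrow> 'k mat) \<Rightarrow> bool" where
  "is_rep of_k d rho \<longleftrightarrow> (\<forall>a. rho a \<in> carrier_mat d d)
     \<and> (\<forall>a b. rho (a + b) = rho a + rho b) \<and> (\<forall>a b. rho (a * b) = rho a * rho b)
     \<and> (\<forall>c a. rho (of_k c * a) = c \<cdot>\<^sub>m rho a) \<and> rho 1 = 1\<^sub>m d"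

text \<open>rho realises S^lam: its dimension is the number of standard lam-tableaux and in some
  basis {v_T} indexed by standard tableaux, x_k v_T = (content of k in T) v_T.\<close>
definition is_specht_rep :: "('k::field \<Rightarrow> 'a::ring_1) \<Rightarrow> (nat \<Rightarrow> 'k) \<Rightarrow> nat \<Rightarrow> (nat \<Rightarrow> 'a)
     \<Rightarrow> nat list list \<Rightarrow> ('a \<Rightarrow> 'k mat) \<Rightarrow> bool" where
  "is_specht_rep of_k Q n s lam rho \<longleftrightarrow>
    (let d = card (std_tableaux lam n) in
     is_rep of_k d rho \<and>
     (\<exists>enum P Pi. bij_betw enum {..<d} (std_tableaux lam n)
        \<and> P \<in> carrier_mat d d \<and> Pi \<in> carrier_mat d d \<and> P * Pi = 1\<^sub>m d \<and> Pi * P = 1\<^sub>m d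
        \<and> (\<forall>k\<in>{1..n}. Pi * rho (jm s k) * P
              = mat d d (\<lambda>(a,b). if a = b then tab_content Q lam (enum a) k else 0))))"

definition schur_elements :: "('a \<Rightarrow> 'k::field) \<Rightarrow> ('i \<Rightarrow> 'a \<Rightarrow> 'k) \<Rightarrow> 'i set \<Rightarrow> 'i \<Rightarrow> 'k" where
  "schur_elements tau chi I = (THE S. (\<forall>i. i \<notin> I \<longrightarrow> S i = 0)
       \<and> (\<forall>h. tau h = (\<Sum>i\<in>I. chi i h / S i)))"

end

theory Submission
  imports Defs "HOL-Computational_Algebra.Polynomial"
begin

text \<open>
  Let \<open>A\<^sub>k\<close> be the subalgebra generated by \<open>s\<^sub>0, \<dots>, s\<^sub>k\<^sub>-\<^sub>1\<close>. It carries the form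
  \<open>\<tau>\<^sub>k(h) = \<tau>(h x\<^sub>k\<^sub>+\<^sub>1\<^sup>m\<^sup>-\<^sup>1 \<dots> x\<^sub>n\<^sup>m\<^sup>-\<^sup>1)\<close>, and \<open>A\<^sub>k\<^sub>+\<^sub>1\<close> is the sum of the \<open>A\<^sub>k x\<^sub>k\<^sub>+\<^sub>1\<^sup>a\<close> with \<open>a < m\<close>
  and \<open>A\<^sub>k s\<^sub>k A\<^sub>k\<close>. On these pieces \<open>\<tau>\<^sub>k\<^sub>+\<^sub>1\<close> is \<open>\<tau>\<^sub>k\<close> if \<open>a = m - 1\<close> and \<open>0\<close> otherwise, and \<open>0\<close>.
  In a basis of simultaneous eigenvectors of the Jucys--Murphy elements, the diagonal entries of
  \<open>h x\<^sub>k\<^sub>+\<^sub>1\<^sup>a\<close> are those of \<open>h\<close> times a power of a content, and on paths with a fixed tail the trace of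
  \<open>h s\<^sub>k h'\<close> is the sum of the diagonal entries of \<open>h' h\<close> divided by a difference of contents.
  So \<open>\<tau> = \<Sum> \<chi> / s\<close> follows by induction on \<open>k\<close>, for any \<open>s\<close> with
  \<open>\<Sum>\<^sub>y c(y)\<^sup>a / s(\<nu> + y) = \<delta>\<^sub>a\<^sub>,\<^sub>m\<^sub>-\<^sub>1 / s(\<nu>)\<close> and \<open>\<Sum>\<^sub>y 1 / (s(\<nu> + y) (c(y) - c(r))) = 0\<close>, where \<open>y\<close> runs over
  the addable nodes of \<open>\<nu>\<close> and \<open>r\<close> is removable. For the hook product, \<open>s(\<nu>) / s(\<nu> + y)\<close> is
  \<open>\<Prod>\<^sub>r (c(y) - c(r)) / \<Prod>\<^sub>y\<^sub>' (c(y) - c(y'))\<close> with \<open>r\<close> removable and \<open>y' \<noteq> y\<close> addable, and both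
  identities are Lagrange interpolation. Contents separate paths, so the characters are
  linearly independent, which makes the Schur elements unique.
\<close>

section \<open>Interpolation and products along the boundary of a partition\<close>

text \<open>The modules are given only by the eigenvalues of the Jucys--Murphy elements; no formula
  for the action of the \<open>s k\<close> is at hand, and none is constructed. The relation
  \<open>x (Suc k) * s k = s k * x k + 1\<close> fixes the diagonal entries of \<open>s k\<close>,
  and commutation with the earlier \<open>x i\<close> kills its entries between different paths with
  a common tail from step \<open>k\<close> on. So restriction to \<open>A\<^sub>k\<close> is read
  off from paths with a fixed tail, without identifying it with a sum of modules of
  \<open>A\<^sub>k\<close>. The induction must therefore carry along that the partial traces depend
  only on the diagram reached, and must split them by the last node \<open>r\<close>, since the
  weight 1/(c(y) - c(r)) sees two successive nodes. That \<open>tau\<close> vanishes on the part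
  with \<open>s k\<close> depends on \<open>s k\<close> lying outside the group generated by the
  earlier \<open>s i\<close>, and this is extracted from the group order \<open>fact n\<close>. The
  range of \<open>d\<close> in \<open>separated\<close> matches a count of cells: two nodes at the
  border of a diagram with fewer than \<open>n\<close> cells have content offsets differing by less
  than \<open>n\<close> in different components, and by at most \<open>n\<close> in the same
  one.\<close>

lemma prod_shift_telescope:
  fixes f :: "nat \<Rightarrow> 'k::comm_ring_1"
  assumes "e \<le> M"
  shows "(\<Prod>i=Suc e..M. f i) * f e = f M * (\<Prod>i=Suc e..M. f (i - 1))"
  using assms
proof (induction rule: dec_induct)
  case (step n)
  have "(\<Prod>i=Suc e..Suc n. f i) * f e = f (Suc n) * ((\<Prod>i=Suc e..n. f i) * f e)"
    using step.hyps by (simp add: prod.nat_ivl_Suc' mult_ac)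
  also have "\<dots> = f (Suc n) * (\<Prod>i=Suc e..Suc n. f (i - 1))"
    unfolding step.IH using step.hyps by (simp add: prod.nat_ivl_Suc' mult_ac)
  finally show ?case .
qed simp

text \<open>A telescoping product along the boundary of the diagram with row lengths
  \<open>r\<close> and column lengths \<open>cl\<close>, from the point (0, \<open>cl 1\<close>) to
  (\<beta>, \<open>e\<close>). Give a point (x, y) the value u - x + y. The horizontal step in
  column \<open>j\<close> and the vertical step in row \<open>i\<close> each contribute the quotient
  of the values at their two ends, so only the values at the two ends of the path survive. The
  identity is cleared of denominators because values may be zero.\<close>

lemma boundary_product:
  fixes r cl :: "nat \<Rightarrow> nat" and u :: "'k::field"
  assumes gal: "\<And>i j. 1 \<le> i \<Longrightarrow> 1 \<le> j \<Longrightarrow> j \<le> r i \<longleftrightarrow> i \<le> cl j"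
  shows "e \<le> cl 1 \<Longrightarrow> cl (Suc \<beta>) \<le> e \<Longrightarrow> \<beta> = 0 \<or> e \<le> cl \<beta> \<Longrightarrow>
    (\<Prod>j=1..\<beta>. u + of_nat (cl j) - of_nat j + 1) * (\<Prod>i=Suc e..cl 1. u - of_nat (r i) + of_nat i)
      * (u - of_nat \<beta> + of_nat e)
    = (u + of_nat (cl 1)) * (\<Prod>j=1..\<beta>. u + of_nat (cl j) - of_nat j)
      * (\<Prod>i=Suc e..cl 1. u - of_nat (r i) + of_nat i - 1)"
proof (induction \<beta> arbitrary: e)
  case 0
  then show ?case by simp
next
  case (Suc \<beta>)
  have anti: "cl j' \<le> cl j" if "1 \<le> j" "j \<le> j'" for j j'
  proof (cases "cl j' = 0")
    case False
    then have "j' \<le> r (cl j')" using gal[of "cl j'" j'] that by auto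
    then show ?thesis using gal[of "cl j'" j] that False by auto
  qed simp
  define M where "M = cl (Suc \<beta>)"
  define A where "A = (\<Prod>j=1..\<beta>. u + of_nat (cl j) - of_nat j + 1)"
  define B where "B = (\<Prod>j=1..\<beta>. u + of_nat (cl j) - of_nat j)"
  define X where "X = (\<lambda>i. u - of_nat (r i) + of_nat i)"
  define Y where "Y = (\<lambda>i. u - of_nat (r i) + of_nat i - 1)"
  have M: "M \<le> cl 1" "e \<le> M" using anti Suc.prems by (auto simp: M_def)
  have IH: "A * prod X {Suc M..cl 1} * (u - of_nat \<beta> + of_nat M)
      = (u + of_nat (cl 1)) * B * prod Y {Suc M..cl 1}"
    unfolding A_def B_def X_def Y_def using Suc.IH[of M] M anti
    by (cases "\<beta> = 0") (auto simp: M_def)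
  \<comment> \<open>From height \<open>M\<close> up to height \<open>e\<close> the boundary is the
    vertical line behind column \<open>Suc \<beta>\<close>; on it the row factors telescope by
    \<open>prod_shift_telescope\<close>.\<close>
  have r: "r i = Suc \<beta>" if "i \<in> {Suc e..M}" for i
  proof -
    have "Suc \<beta> \<le> r i" using gal[of i "Suc \<beta>"] that by (auto simp: M_def)
    moreover have "\<not> Suc (Suc \<beta>) \<le> r i" using gal[of i "Suc (Suc \<beta>)"] that Suc.prems by auto
    ultimately show ?thesis by simp
  qed
  define f where "f = (\<lambda>i. u - of_nat (Suc \<beta>) + of_nat i)"
  have split: "prod g {Suc e..cl 1} = prod g {Suc e..M} * prod g {Suc M..cl 1}" for g :: "nat \<Rightarrow> 'k"
  proof -
    have "{Suc e..cl 1} = {Suc e..M} \<union> {Suc M..cl 1}" using M by auto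
    then show ?thesis by (simp add: prod.union_disjoint)
  qed
  have X': "prod X {Suc e..M} = prod f {Suc e..M}"
    by (rule prod.cong) (auto simp: X_def f_def r)
  have Y': "prod Y {Suc e..M} = (\<Prod>i=Suc e..M. f (i - 1))"
    by (rule prod.cong) (auto simp: Y_def f_def r of_nat_diff)
  have "A * (u + of_nat M - of_nat (Suc \<beta>) + 1) * prod X {Suc e..cl 1} * f e
     = (A * prod X {Suc M..cl 1} * (u - of_nat \<beta> + of_nat M)) * (prod f {Suc e..M} * f e)"
    unfolding split X' by (simp add: add_diff_eq diff_add_eq mult_ac)
  also have "\<dots> = (u + of_nat (cl 1)) * (B * (u + of_nat M - of_nat (Suc \<beta>))) * prod Y {Suc e..cl 1}"
    unfolding IH prod_shift_telescope[OF M(2)] split Y' by (simp add: f_def mult_ac)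
  finally show ?case
    unfolding A_def B_def X_def Y_def f_def M_def by simp
qed

text \<open>\<open>P\<close> agrees with its Lagrange interpolant, since the difference has more
  roots than its degree allows. The left side is the top coefficient of the interpolant, whose basis
  polynomials \<open>B i\<close> are monic of degree \<open>card J - 1\<close>.\<close>

lemma lagrange_coeff_sum:
  fixes y :: "'i \<Rightarrow> 'k::field"
  assumes fin: "finite J" and inj: "inj_on y J" and deg: "degree P < card J"
  shows "(\<Sum>i\<in>J. poly P (y i) / (\<Prod>i'\<in>J - {i}. y i - y i')) = coeff P (card J - 1)"
proof -
  define c where "c i = poly P (y i) / (\<Prod>i'\<in>J - {i}. y i - y i')" for i
  define B where "B i = (\<Prod>i'\<in>J - {i}. [:- y i', 1:])" for i
  define L where "L = (\<Sum>i\<in>J. smult (c i) (B i))"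
  have degB: "degree (B i) = card J - 1" if "i \<in> J" for i
  proof -
    have "degree (B i) = (\<Sum>i'\<in>J - {i}. degree [:- y i', 1:])"
      unfolding B_def by (rule degree_prod_eq_sum_degree) auto
    then show ?thesis using that fin by simp
  qed
  have monB: "coeff (B i) (card J - 1) = 1" if "i \<in> J" for i
  proof -
    have "lead_coeff (B i) = 1" unfolding B_def by (simp add: lead_coeff_prod)
    then show ?thesis using degB[OF that] by simp
  qed
  have "P - L = 0"
  proof (rule ccontr)
    assume nz: "P - L \<noteq> 0"
    have "poly L (y i) = poly P (y i)" if i: "i \<in> J" for i
    proof -
      have "poly L (y i) = (\<Sum>k\<in>J. c k * (\<Prod>i'\<in>J - {k}. y i - y i'))"
        unfolding L_def B_def by (simp add: poly_sum poly_prod)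
      also have "\<dots> = (\<Sum>k\<in>J. if k = i then poly P (y i) else 0)"
      proof (rule sum.cong)
        fix k assume "k \<in> J"
        have ne: "(\<Prod>i'\<in>J - {i}. y i - y i') \<noteq> 0"
          using fin inj i by (auto simp: inj_on_def)
        show "c k * (\<Prod>i'\<in>J - {k}. y i - y i') = (if k = i then poly P (y i) else 0)"
          using ne fin i by (auto simp: c_def intro!: bexI[of _ i])
      qed simp
      also have "\<dots> = poly P (y i)" using fin i by simp
      finally show ?thesis .
    qed
    then have "y ` J \<subseteq> {x. poly (P - L) x = 0}" by auto
    then have "card J \<le> card {x. poly (P - L) x = 0}"
      using card_mono[OF poly_roots_finite[OF nz]] card_image[OF inj] by metis
    also have "\<dots> \<le> degree (P - L)" by (rule card_poly_roots_bound[OF nz])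
    also have "\<dots> < card J"
    proof -
      have "degree L \<le> card J - 1"
        unfolding L_def by (rule degree_sum_le) (auto simp: fin degB intro: order.trans[OF degree_smult_le])
      then show ?thesis using deg degree_diff_le_max[of P L] by linarith
    qed
    finally show False by simp
  qed
  then have "coeff P (card J - 1) = coeff L (card J - 1)" by simp
  also have "\<dots> = (\<Sum>i\<in>J. c i)" unfolding L_def coeff_sum coeff_smult by (intro sum.cong) (simp_all only: monB mult_1_right)
  finally show ?thesis by (simp add: c_def)
qed

section \<open>Diagrams and their hook products\<close>

text \<open>Multipartitions are handled as finite down-closed sets of nodes (row, column, component).\<close>

type_synonym node = "nat \<times> nat \<times> nat"

definition diagram :: "nat \<Rightarrow> node set \<Rightarrow> bool" where
  "diagram m D \<longleftrightarrow> finite D \<and> (\<forall>(i,j,c)\<in>D. 1 \<le> i \<and> 1 \<le> j \<and> 1 \<le> c \<and> c \<le> m)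
     \<and> (\<forall>i j c i' j'. (i,j,c) \<in> D \<longrightarrow> 1 \<le> i' \<longrightarrow> i' \<le> i \<longrightarrow> 1 \<le> j' \<longrightarrow> j' \<le> j \<longrightarrow> (i',j',c) \<in> D)"

definition rlen :: "node set \<Rightarrow> nat \<Rightarrow> nat \<Rightarrow> nat" where
  "rlen D c i = card {j. (i,j,c) \<in> D}"

definition clen :: "node set \<Rightarrow> nat \<Rightarrow> nat \<Rightarrow> nat" where
  "clen D c j = card {i. (i,j,c) \<in> D}"

lemma down_closed_eq_interval:
  fixes S :: "nat set"
  assumes "finite S" "\<And>j. j \<in> S \<Longrightarrow> 1 \<le> j" "\<And>j j'. j \<in> S \<Longrightarrow> 1 \<le> j' \<Longrightarrow> j' \<le> j \<Longrightarrow> j' \<in> S"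
  shows "S = {1..card S}"
proof (cases "S = {}")
  case False
  have "S = {1..Max S}"
  proof
    show "S \<subseteq> {1..Max S}" using assms(2) Max_ge[OF assms(1)] by auto
    show "{1..Max S} \<subseteq> S" using assms(3)[OF Max_in[OF assms(1) False]] by auto
  qed
  then show ?thesis by (metis card_atLeastAtMost diff_Suc_1)
qed simp

lemma diagram_finite: "diagram m D \<Longrightarrow> finite D"
  by (simp add: diagram_def)

lemma diagram_pos:
  assumes "diagram m D" "(i,j,c) \<in> D"
  shows "1 \<le> i \<and> 1 \<le> j \<and> 1 \<le> c \<and> c \<le> m"
  using bspec[OF conjunct1[OF conjunct2[OF assms(1)[unfolded diagram_def]]] assms(2)] by simp

lemma diagram_down:
  assumes "diagram m D" "(i,j,c) \<in> D" "1 \<le> i'" "i' \<le> i" "1 \<le> j'" "j' \<le> j"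
  shows "(i',j',c) \<in> D"
  using conjunct2[OF conjunct2[OF assms(1)[unfolded diagram_def]]] assms(2-) by metis

lemma mem_iff_row:
  assumes "diagram m D"
  shows "(i,j,c) \<in> D \<longleftrightarrow> 1 \<le> j \<and> j \<le> rlen D c i"
proof -
  have "finite ((\<lambda>(i,j,c). j) ` D)" using diagram_finite[OF assms] by simp
  then have "finite {j. (i,j,c) \<in> D}" by (rule rev_finite_subset) force
  then have "{j. (i,j,c) \<in> D} = {1..card {j. (i,j,c) \<in> D}}"
    by (rule down_closed_eq_interval) (use diagram_pos[OF assms] diagram_down[OF assms] in blast)+
  from eqset_imp_iff[OF this, of j] show ?thesis unfolding rlen_def by simp
qed

lemma mem_iff_col:
  assumes "diagram m D"
  shows "(i,j,c) \<in> D \<longleftrightarrow> 1 \<le> i \<and> i \<le> clen D c j"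
proof -
  have "finite ((\<lambda>(i,j,c). i) ` D)" using diagram_finite[OF assms] by simp
  then have "finite {i. (i,j,c) \<in> D}" by (rule rev_finite_subset) force
  then have "{i. (i,j,c) \<in> D} = {1..card {i. (i,j,c) \<in> D}}"
    by (rule down_closed_eq_interval) (use diagram_pos[OF assms] diagram_down[OF assms] in blast)+
  from eqset_imp_iff[OF this, of i] show ?thesis unfolding clen_def by simp
qed

definition addable :: "nat \<Rightarrow> node set \<Rightarrow> node set" where
  "addable m D = {y. y \<notin> D \<and> diagram m (insert y D)}"

definition removable :: "nat \<Rightarrow> node set \<Rightarrow> node set" where
  "removable m D = {r. r \<in> D \<and> diagram m (D - {r})}"

definition hook_factor :: "(nat \<Rightarrow> 'k::field) \<Rightarrow> node set \<Rightarrow> node \<Rightarrow> nat \<Rightarrow> 'k" where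
  "hook_factor Q D v t = (case v of (i,j,s) \<Rightarrow>
     of_nat (rlen D s i) - of_nat i + of_nat (clen D t j) - of_nat j + 1 + Q s - Q t)"

definition diagram_schur :: "(nat \<Rightarrow> 'k::field) \<Rightarrow> nat \<Rightarrow> node set \<Rightarrow> 'k" where
  "diagram_schur Q m D = (\<Prod>v\<in>D. \<Prod>t\<in>{1..m}. hook_factor Q D v t)"

text \<open>The interpolation runs over all rows instead of the addable and removable nodes: the outer content
  of a row that is not addable equals the inner content of the row above, so the extra terms cancel.\<close>

definition outer_rows :: "nat \<Rightarrow> node set \<Rightarrow> (nat \<times> nat) set" where
  "outer_rows m D = (SIGMA t:{1..m}. {1..Suc (clen D t 1)})"

definition inner_rows :: "nat \<Rightarrow> node set \<Rightarrow> (nat \<times> nat) set" where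
  "inner_rows m D = (SIGMA t:{1..m}. {1..clen D t 1})"

text \<open>Content of the first cell beyond the end of the row; \<open>inner_content\<close> is the
  content of its last cell. \<open>outer_rows\<close> includes the first empty row of each
  component, where a new row may start.\<close>

definition outer_content :: "(nat \<Rightarrow> 'k::field) \<Rightarrow> node set \<Rightarrow> nat \<times> nat \<Rightarrow> 'k" where
  "outer_content Q D = (\<lambda>(t,i). of_nat (rlen D t i) - of_nat i + 1 + Q t)"

definition inner_content :: "(nat \<Rightarrow> 'k::field) \<Rightarrow> node set \<Rightarrow> nat \<times> nat \<Rightarrow> 'k" where
  "inner_content Q D = (\<lambda>(t,i). of_nat (rlen D t i) - of_nat i + Q t)"

lemma addable_row_col:
  assumes D: "diagram m D" and y: "(a,b,p) \<in> addable m D"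
  shows "1 \<le> a" "b = Suc (rlen D p a)" "a = Suc (clen D p b)" "1 \<le> p" "p \<le> m" "a \<le> Suc (clen D p 1)"
proof -
  have D': "diagram m (insert (a,b,p) D)" and n: "(a,b,p) \<notin> D" using y by (auto simp: addable_def)
  have pos: "1 \<le> a" "1 \<le> b" "1 \<le> p" "p \<le> m" using diagram_pos[OF D', of a b p] by auto
  then show "1 \<le> a" "1 \<le> p" "p \<le> m" by auto
  have "b > rlen D p a" using n mem_iff_row[OF D, of a b p] pos by auto
  moreover have "b \<le> Suc (rlen D p a)"
  proof (rule ccontr)
    assume "\<not> b \<le> Suc (rlen D p a)"
    then have "(a, Suc (rlen D p a), p) \<in> D"
      using diagram_down[OF D', of a b p a "Suc (rlen D p a)"] pos by auto
    then show False using mem_iff_row[OF D] by auto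
  qed
  ultimately show "b = Suc (rlen D p a)" by simp
  have "a > clen D p b" using n mem_iff_col[OF D, of a b p] pos by auto
  moreover have "a \<le> Suc (clen D p b)"
  proof (rule ccontr)
    assume "\<not> a \<le> Suc (clen D p b)"
    then have "(Suc (clen D p b), b, p) \<in> D"
      using diagram_down[OF D', of a b p "Suc (clen D p b)" b] pos by auto
    then show False using mem_iff_col[OF D] by auto
  qed
  ultimately show "a = Suc (clen D p b)" by simp
  show "a \<le> Suc (clen D p 1)"
  proof (rule ccontr)
    assume "\<not> a \<le> Suc (clen D p 1)"
    then have "(Suc (clen D p 1), 1, p) \<in> D"
      using diagram_down[OF D', of a b p "Suc (clen D p 1)" 1] pos by auto
    then show False using mem_iff_col[OF D] by auto
  qed
qed

lemma row_insert:
  assumes D: "diagram m D" and y: "(a,b,p) \<in> addable m D"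
  shows "rlen (insert (a,b,p) D) s i = (if s = p \<and> i = a then b else rlen D s i)"
proof (cases "s = p \<and> i = a")
  case True
  have "{j. (a,j,p) \<in> D} = {1..rlen D p a}" using mem_iff_row[OF D] by auto
  then have "{j. (i,j,s) \<in> insert (a,b,p) D} = insert b {1..rlen D p a}" using True by auto
  also have "\<dots> = {1..b}" using addable_row_col(2)[OF D y] by auto
  finally show ?thesis using True by (simp add: rlen_def)
next
  case False
  then have "{j. (i,j,s) \<in> insert (a,b,p) D} = {j. (i,j,s) \<in> D}" by auto
  then show ?thesis unfolding rlen_def if_not_P[OF False] by simp
qed

lemma col_insert:
  assumes D: "diagram m D" and y: "(a,b,p) \<in> addable m D"
  shows "clen (insert (a,b,p) D) s j = (if s = p \<and> j = b then a else clen D s j)"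
proof (cases "s = p \<and> j = b")
  case True
  have "{i. (i,b,p) \<in> D} = {1..clen D p b}" using mem_iff_col[OF D] by auto
  then have "{i. (i,j,s) \<in> insert (a,b,p) D} = insert a {1..clen D p b}" using True by auto
  also have "\<dots> = {1..a}" using addable_row_col(3)[OF D y] by auto
  finally show ?thesis using True by (simp add: clen_def)
next
  case False
  then have "{i. (i,j,s) \<in> insert (a,b,p) D} = {i. (i,j,s) \<in> D}" by auto
  then show ?thesis unfolding clen_def if_not_P[OF False] by simp
qed


text \<open>The common part of the two products appears as a factor \<open>c\<close> and is not
  divided out, because hook factors are not yet known to be nonzero where this is applied.\<close>

lemma prod_partition3:
  fixes f g :: "'b \<Rightarrow> 'k::comm_monoid_mult"
  assumes "finite F" "A \<subseteq> F" "B \<subseteq> F" "A \<inter> B = {}" "\<And>x. x \<in> F - A - B \<Longrightarrow> f x = g x"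
  shows "\<exists>c. prod f F = c * prod f A * prod f B \<and> prod g F = c * prod g A * prod g B"
proof -
  have F: "F = (F - A - B) \<union> (A \<union> B)" using assms by auto
  have fin: "finite A" "finite B" using assms finite_subset by auto
  have "prod h F = prod h (F - A - B) * prod h A * prod h B" for h :: "'b \<Rightarrow> 'k"
    by (subst F, subst prod.union_disjoint)
      (use assms fin in \<open>auto simp: prod.union_disjoint mult_ac\<close>)
  moreover have "prod f (F - A - B) = prod g (F - A - B)" using assms(5) by (rule prod.cong[OF refl])
  ultimately show ?thesis by metis
qed

lemma row_col_galois:
  assumes "diagram m D" "1 \<le> i" "1 \<le> j"
  shows "j \<le> rlen D t i \<longleftrightarrow> i \<le> clen D t j"
  using mem_iff_row[OF assms(1), of i j t] mem_iff_col[OF assms(1), of i j t] assms by simp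

lemma clen_antimono:
  assumes "diagram m D" "1 \<le> j" "j \<le> j'"
  shows "clen D t j' \<le> clen D t j"
proof (cases "clen D t j' = 0")
  case False
  then have "(clen D t j', j', t) \<in> D" using mem_iff_col[OF assms(1)] by auto
  then have "(clen D t j', j, t) \<in> D" using diagram_down[OF assms(1)] assms False by auto
  then show ?thesis using mem_iff_col[OF assms(1)] by auto
qed simp

text \<open>Adding the node \<open>y = (a,b,p)\<close> changes exactly the factors in row \<open>a\<close> of component \<open>p\<close>
  (for all \<open>t\<close>) and the factors in column \<open>b\<close> of all components with \<open>t = p\<close>.\<close>

lemma diagram_schur_insert:
  fixes Q :: "nat \<Rightarrow> 'k::field"
  assumes D: "diagram m D" and y: "(a,b,p) \<in> addable m D"
  defines "z \<equiv> node_content Q (a,b,p)"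
  shows "diagram_schur Q m (insert (a,b,p) D) * (\<Prod>x\<in>inner_rows m D. z - inner_content Q D x)
    = diagram_schur Q m D * (\<Prod>x\<in>outer_rows m D - {(p,a)}. z - outer_content Q D x)"
proof -
  define D' where "D' = insert (a,b,p) D"
  note rc = addable_row_col[OF D y]
  have b1: "1 \<le> b" using rc(2) by simp
  \<comment> \<open>\<open>u t\<close> is \<open>z - Q t\<close>, so that the differences of
    \<open>z\<close> and the contents in component \<open>t\<close> become u - x + y at boundary
    points, as in \<open>boundary_product\<close>.\<close>
  define u where "u t = of_nat b - of_nat a + Q p - Q t" for t
  define N where "N t = clen D t 1" for t
  \<comment> \<open>The pairs (cell, component) of the old diagram whose factor changes:
    \<open>R\<close> by a longer row, \<open>C\<close> by a longer column. The factors of the new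
    cell itself are split off separately.\<close>
  define R where "R = (\<lambda>(t,j). ((a,j,p),t)) ` ({1..m} \<times> {1..b-1})"
  define C where "C = (\<lambda>(s,i). ((i,b,s),p)) ` (SIGMA s:{1..m}. {1..clen D s b})"
  define f where "f = (\<lambda>(v,t). hook_factor Q D v t)"
  define f' where "f' = (\<lambda>(v,t). hook_factor Q D' v t)"
  have nin: "(a,b,p) \<notin> D" using y by (simp add: addable_def)
  have fin: "finite D" using diagram_finite[OF D] .
  have RS: "R \<subseteq> D \<times> {1..m}" using rc(2,4,5) mem_iff_row[OF D] by (auto simp: R_def)
  have CS: "C \<subseteq> D \<times> {1..m}" using rc(4,5) mem_iff_col[OF D] by (auto simp: C_def)
  have "\<exists>c. prod f' (D \<times> {1..m}) = c * prod f' R * prod f' C \<and> prod f (D \<times> {1..m}) = c * prod f R * prod f C"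
  proof (rule prod_partition3)
    show "R \<inter> C = {}" using b1 by (auto simp: R_def C_def)
    fix x assume x: "x \<in> D \<times> {1..m} - R - C"
    obtain i j s t where xx: "x = ((i,j,s),t)" by (metis surj_pair)
    have "\<not> (s = p \<and> i = a)"
    proof
      assume "s = p \<and> i = a"
      then have "x \<in> R" using x xx rc(2) mem_iff_row[OF D, of a j p] by (auto simp: R_def image_iff)
      then show False using x by auto
    qed
    moreover have "\<not> (t = p \<and> j = b)"
    proof
      assume "t = p \<and> j = b"
      then have "x \<in> C" using x xx mem_iff_col[OF D, of i b s] diagram_pos[OF D, of i b s]
        by (auto simp: C_def image_iff)
      then show False using x by auto
    qed
    ultimately show "f' x = f x"
      unfolding f_def f'_def xx hook_factor_def D'_def
      by (simp add: row_insert[OF D y] col_insert[OF D y] if_not_P del: de_Morgan_conj)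
  qed (use fin RS CS in auto)
  then obtain c where c: "prod f' (D \<times> {1..m}) = c * prod f' R * prod f' C"
      "prod f (D \<times> {1..m}) = c * prod f R * prod f C" by blast
  have S: "diagram_schur Q m D = c * prod f R * prod f C"
    unfolding c(2)[symmetric] unfolding diagram_schur_def f_def by (rule prod.cartesian_product)
  have S': "diagram_schur Q m D' = (\<Prod>t\<in>{1..m}. f' ((a,b,p),t)) * (c * prod f' R * prod f' C)"
  proof -
    have "diagram_schur Q m D' = (\<Prod>t\<in>{1..m}. f' ((a,b,p),t)) * (\<Prod>v\<in>D. \<Prod>t\<in>{1..m}. f' (v,t))"
      unfolding diagram_schur_def f'_def using nin fin by (simp add: D'_def)
    also have "(\<Prod>v\<in>D. \<Prod>t\<in>{1..m}. f' (v,t)) = prod f' (D \<times> {1..m})"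
      by (simp add: prod.cartesian_product)
    finally show ?thesis unfolding c(1) .
  qed
  have R: "prod g R = (\<Prod>t\<in>{1..m}. \<Prod>j\<in>{1..b-1}. g ((a,j,p),t))" for g :: "node \<times> nat \<Rightarrow> 'k"
    unfolding R_def by (subst prod.reindex) (auto simp: inj_on_def prod.cartesian_product case_prod_unfold)
  have C: "prod g C = (\<Prod>t\<in>{1..m}. \<Prod>i\<in>{1..clen D t b}. g ((i,b,t),p))" for g :: "node \<times> nat \<Rightarrow> 'k"
    unfolding C_def by (subst prod.reindex) (auto simp: inj_on_def prod.Sigma case_prod_unfold)
  have inner: "(\<Prod>x\<in>inner_rows m D. z - inner_content Q D x)
      = (\<Prod>t\<in>{1..m}. \<Prod>i\<in>{1..N t}. u t - of_nat (rlen D t i) + of_nat i)"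
    unfolding inner_rows_def N_def by (subst prod.Sigma)
      (auto intro!: prod.cong simp: inner_content_def z_def node_content_def u_def algebra_simps)
  have oeq: "outer_rows m D - {(p,a)} = (SIGMA t:{1..m}. {1..Suc (N t)} - (if t = p then {a} else {}))"
    by (auto simp: outer_rows_def N_def split: if_splits)
  have zo: "z - outer_content Q D (t,i) = u t - of_nat (rlen D t i) + of_nat i - 1" for t i
    by (simp add: outer_content_def z_def node_content_def u_def algebra_simps)
  have outer: "(\<Prod>x\<in>outer_rows m D - {(p,a)}. z - outer_content Q D x)
      = (\<Prod>t\<in>{1..m}. \<Prod>i\<in>{1..Suc (N t)} - (if t = p then {a} else {}). u t - of_nat (rlen D t i) + of_nat i - 1)"
    unfolding oeq zo[symmetric] by (subst prod.Sigma) (simp_all add: split_def)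
  have fR: "f ((a,j,p),t) = u t + of_nat (clen D t j) - of_nat j" for j t
    using rc(2) by (simp add: f_def hook_factor_def u_def)
  have fR': "f' ((a,j,p),t) = u t + of_nat (clen D t j) - of_nat j + 1" if "j \<noteq> b" for j t
    using that by (simp add: f'_def hook_factor_def u_def D'_def row_insert[OF D y] col_insert[OF D y])
  \<comment> \<open>Column \<open>b\<close> of component \<open>p\<close> has length
    \<open>a - 1\<close>, so this hook is, up to sign, the difference of \<open>z\<close> and the
    inner content of row \<open>i\<close>. Inserting the node shifts it to the outer content; the
    signs agree on both sides and cancel.\<close>
  have fC: "f ((i,b,t),p) = - (u t - of_nat (rlen D t i) + of_nat i)" if "i \<le> clen D t b" for i t
    using rc(3) by (simp add: f_def hook_factor_def u_def)
  have fC': "f' ((i,b,t),p) = - (u t - of_nat (rlen D t i) + of_nat i - 1)" if "i \<le> clen D t b" for i t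
  proof -
    have "\<not> (t = p \<and> i = a)" using that rc(3) by auto
    then show ?thesis
      by (simp add: f'_def hook_factor_def u_def D'_def row_insert[OF D y] col_insert[OF D y] if_not_P
           del: de_Morgan_conj)
  qed
  \<comment> \<open>The identity holds for each \<open>t\<close> separately: row \<open>a\<close>
    supplies the horizontal boundary steps of component \<open>t\<close>, column \<open>b\<close>
    and the contents supply the vertical ones.\<close>
  have key: "f' ((a,b,p),t) * (\<Prod>j\<in>{1..b-1}. f' ((a,j,p),t)) * (\<Prod>i\<in>{1..clen D t b}. f' ((i,b,t),p))
       * (\<Prod>i\<in>{1..N t}. u t - of_nat (rlen D t i) + of_nat i)
     = (\<Prod>j\<in>{1..b-1}. f ((a,j,p),t)) * (\<Prod>i\<in>{1..clen D t b}. f ((i,b,t),p))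
       * (\<Prod>i\<in>{1..Suc (N t)} - (if t = p then {a} else {}). u t - of_nat (rlen D t i) + of_nat i - 1)"
    if t: "t \<in> {1..m}" for t
  proof -
    define X where "X i = u t - of_nat (rlen D t i) + of_nat i" for i
    define Y where "Y i = X i - 1" for i
    define K where "K = clen D t b"
    define sg where "sg = (-1::'k) ^ K"
    define A where "A = (\<Prod>j=1..b-1. u t + of_nat (clen D t j) - of_nat j + 1)"
    define B where "B = (\<Prod>j=1..b-1. u t + of_nat (clen D t j) - of_nat j)"
    have b: "b = Suc (b - 1)" using b1 by simp
    have KN: "K \<le> N t" unfolding K_def N_def using clen_antimono[OF D _ b1] by simp
    have A: "(\<Prod>j\<in>{1..b-1}. f' ((a,j,p),t)) = A"
      unfolding A_def by (rule prod.cong) (use b in \<open>auto simp: fR'\<close>)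
    have B: "(\<Prod>j\<in>{1..b-1}. f ((a,j,p),t)) = B"
      unfolding B_def fR ..
    have Xe: "(\<Prod>i\<in>{1..clen D t b}. f ((i,b,t),p)) = sg * prod X {1..K}"
    proof -
      have "(\<Prod>i\<in>{1..clen D t b}. f ((i,b,t),p)) = (\<Prod>i\<in>{1..K}. (-1) * X i)"
        unfolding K_def by (rule prod.cong) (auto simp: fC X_def)
      then show ?thesis unfolding prod.distrib by (simp add: sg_def)
    qed
    have Ye: "(\<Prod>i\<in>{1..clen D t b}. f' ((i,b,t),p)) = sg * prod Y {1..K}"
    proof -
      have "(\<Prod>i\<in>{1..clen D t b}. f' ((i,b,t),p)) = (\<Prod>i\<in>{1..K}. (-1) * Y i)"
        unfolding K_def by (rule prod.cong) (auto simp: fC' X_def Y_def)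
      then show ?thesis unfolding prod.distrib by (simp add: sg_def)
    qed
    have split: "prod g {1..M} = prod g {1..e} * prod g {Suc e..M}" if "e \<le> M"
      for g :: "nat \<Rightarrow> 'k" and e M
    proof -
      have "{1..M} = {1..e} \<union> {Suc e..M}" using that by auto
      then show ?thesis by (simp add: prod.union_disjoint)
    qed
    have bp: "A * prod X {Suc e..N t} * (u t - of_nat (b - 1) + of_nat e)
       = (u t + of_nat (N t)) * B * prod Y {Suc e..N t}"
      if "e \<le> N t" "K \<le> e" "b - 1 = 0 \<or> e \<le> clen D t (b - 1)" for e
      using boundary_product[of "rlen D t" "clen D t" e "b - 1" "u t"] row_col_galois[OF D] that b
      unfolding A_def B_def X_def Y_def N_def K_def by simp
    \<comment> \<open>Row \<open>Suc (N t)\<close> is empty, so its outer factor is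
      \<open>u t + of_nat (N t)\<close>, the value at the starting point in
      \<open>boundary_product\<close>.\<close>
    have rN: "rlen D t (Suc (N t)) = 0"
      using mem_iff_row[OF D, of "Suc (N t)" 1 t] mem_iff_col[OF D, of "Suc (N t)" 1 t] by (auto simp: N_def)
    have goal: "f' ((a,b,p),t) * A * (sg * prod Y {1..K}) * prod X {1..N t}
        = B * (sg * prod X {1..K}) * prod Y ({1..Suc (N t)} - (if t = p then {a} else {}))"
    proof (cases "t = p")
      case False
      \<comment> \<open>Here the boundary path of component \<open>t\<close> ends at
        (\<open>b - 1\<close>, \<open>K\<close>), and the value there is exactly the factor of the
        new cell.\<close>
      have e: "K \<le> clen D t (b - 1)" if "b - 1 \<noteq> 0"
        unfolding K_def using clen_antimono[OF D] that by simp
      have Y1: "prod Y {1..Suc (N t)} = (u t + of_nat (N t)) * (prod Y {1..K} * prod Y {Suc K..N t})"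
        unfolding split[OF KN, symmetric] by (simp add: Y_def X_def rN mult.commute)
      have "of_nat b = (1 + of_nat (b - 1) :: 'k)" by (subst b) simp
      then have fy: "f' ((a,b,p),t) = u t - of_nat (b - 1) + of_nat K"
        using False by (simp add: f'_def hook_factor_def u_def D'_def row_insert[OF D y] col_insert[OF D y] K_def)
      have "f' ((a,b,p),t) * A * (sg * prod Y {1..K}) * prod X {1..N t}
          = (sg * prod Y {1..K} * prod X {1..K}) * (A * prod X {Suc K..N t} * (u t - of_nat (b - 1) + of_nat K))"
        unfolding fy split[OF KN] by (simp add: mult_ac)
      also have "\<dots> = (sg * prod Y {1..K} * prod X {1..K}) * ((u t + of_nat (N t)) * B * prod Y {Suc K..N t})"
        using bp[of K] KN e by auto
      also have "\<dots> = B * (sg * prod X {1..K}) * prod Y {1..Suc (N t)}"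
        unfolding Y1 by (simp add: mult_ac)
      finally show ?thesis using False by simp
    next
      case True
      \<comment> \<open>The new cell is a corner with hook length 1. The path is stopped at
        (\<open>b - 1\<close>, \<open>a\<close>), where the value is also 1, and row
        \<open>a\<close> drops out on both sides: it is excluded from the outer rows, and its inner
        factor is 1.\<close>
      have fy: "f' ((a,b,p),t) = 1"
        using True by (simp add: f'_def hook_factor_def u_def D'_def row_insert[OF D y] col_insert[OF D y])
      have aK: "a = Suc K" using rc(3) True by (simp add: K_def)
      show ?thesis
      proof (cases "a \<le> N t")
        case False
        \<comment> \<open>The node opens a new row, so \<open>b = 1\<close> and the boundary path is
          trivial.\<close>
        then have a: "a = Suc (N t)" "K = N t" using aK KN by auto
        then have "b = 1" using rN rc(2) True by simp
        then have "A = 1" "B = 1" by (auto simp: A_def B_def)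
        moreover have "{1..Suc (N t)} - {a} = {1..N t}" using a by auto
        ultimately show ?thesis using True fy a by simp
      next
        case aN: True
        have ra: "rlen D t a = b - 1" using rc(2) True by simp
        have e: "b - 1 = 0 \<or> a \<le> clen D t (b - 1)"
          using row_col_galois[OF D, of a "b - 1" t] rc(1) ra by (cases "b - 1 = 0") auto
        have "{1..Suc (N t)} - {a} = ({1..K} \<union> {Suc a..N t}) \<union> {Suc (N t)}" using aK aN by auto
        then have Y1: "prod Y ({1..Suc (N t)} - {a}) = (u t + of_nat (N t)) * (prod Y {1..K} * prod Y {Suc a..N t})"
          using aK aN by (simp add: prod.union_disjoint Y_def X_def rN mult.commute)
        have "of_nat b = (1 + of_nat (b - 1) :: 'k)" by (subst b) simp
        then have one: "u t - of_nat (b - 1) + of_nat a = 1" and Xa: "X a = 1"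
          using True ra by (auto simp: u_def X_def)
        have X1: "prod X {1..N t} = prod X {1..K} * prod X {Suc a..N t}"
          unfolding split[OF KN] using aK aN Xa prod.atLeast_Suc_atMost[of a "N t" X] by simp
        have "f' ((a,b,p),t) * A * (sg * prod Y {1..K}) * prod X {1..N t}
          = (sg * prod Y {1..K} * prod X {1..K}) * (A * prod X {Suc a..N t} * (u t - of_nat (b - 1) + of_nat a))"
          unfolding fy X1 one by (simp add: mult_ac)
        also have "\<dots> = (sg * prod Y {1..K} * prod X {1..K}) * ((u t + of_nat (N t)) * B * prod Y {Suc a..N t})"
          using bp[of a] aN e aK by auto
        also have "\<dots> = B * (sg * prod X {1..K}) * prod Y ({1..Suc (N t)} - {a})"
          unfolding Y1 by (simp add: mult_ac)
        finally show ?thesis using True by simp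
      qed
    qed
    then show ?thesis unfolding A B Xe Ye unfolding X_def Y_def .
  qed
  have "diagram_schur Q m D' * (\<Prod>x\<in>inner_rows m D. z - inner_content Q D x)
    = c * (\<Prod>t\<in>{1..m}. f' ((a,b,p),t) * (\<Prod>j\<in>{1..b-1}. f' ((a,j,p),t)) * (\<Prod>i\<in>{1..clen D t b}. f' ((i,b,t),p))
       * (\<Prod>i\<in>{1..N t}. u t - of_nat (rlen D t i) + of_nat i))"
    unfolding S' inner R C prod.distrib by (simp only: mult_ac)
  also have "\<dots> = c * (\<Prod>t\<in>{1..m}. (\<Prod>j\<in>{1..b-1}. f ((a,j,p),t)) * (\<Prod>i\<in>{1..clen D t b}. f ((i,b,t),p))
       * (\<Prod>i\<in>{1..Suc (N t)} - (if t = p then {a} else {}). u t - of_nat (rlen D t i) + of_nat i - 1))"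
    using key by (intro arg_cong[where f = "(*) c"] prod.cong) auto
  also have "\<dots> = diagram_schur Q m D * (\<Prod>x\<in>outer_rows m D - {(p,a)}. z - outer_content Q D x)"
    unfolding S outer R C prod.distrib by (simp only: mult_ac)
  finally show ?thesis unfolding D'_def .
qed

section \<open>Addable and removable nodes, and the diagrams of a given size\<close>

lemma rlen_antimono:
  assumes "diagram m D" "1 \<le> i" "i \<le> i'"
  shows "rlen D t i' \<le> rlen D t i"
proof (cases "rlen D t i' = 0")
  case False
  then have "(i', rlen D t i', t) \<in> D" using mem_iff_row[OF assms(1)] by auto
  then have "(i, rlen D t i', t) \<in> D" using diagram_down[OF assms(1)] assms False by auto
  then show ?thesis using mem_iff_row[OF assms(1)] by auto
qed simp

lemma outer_content_eq: "outer_content Q D (t,i) = node_content Q (i, Suc (rlen D t i), t)"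
  by (simp add: outer_content_def node_content_def)

lemma addable_imp_outer:
  assumes "diagram m D" "(a,b,p) \<in> addable m D"
  shows "(p,a) \<in> outer_rows m D" "node_content Q (a,b,p) = outer_content Q D (p,a)"
  using addable_row_col(1,4-6)[OF assms] addable_row_col(2)[OF assms]
  by (auto simp: outer_rows_def outer_content_eq)

lemma outer_addable_or_inner:
  assumes D: "diagram m D" and x: "(t,i) \<in> outer_rows m D"
  shows "(i, Suc (rlen D t i), t) \<in> addable m D
    \<or> (2 \<le> i \<and> rlen D t (i - 1) = rlen D t i \<and> (t, i - 1) \<in> inner_rows m D)"
proof (cases "2 \<le> i \<and> rlen D t (i - 1) = rlen D t i")
  case True
  then show ?thesis using x by (auto simp: outer_rows_def inner_rows_def)
next
  case False
  define b where "b = Suc (rlen D t i)"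
  have ti: "1 \<le> t" "t \<le> m" "1 \<le> i" using x by (auto simp: outer_rows_def)
  have prev: "b \<le> rlen D t (i - 1)" if "2 \<le> i"
  proof -
    have "rlen D t i \<le> rlen D t (i - 1)" using rlen_antimono[OF D, of "i - 1" i t] that by simp
    then show ?thesis using False that unfolding b_def by linarith
  qed
  have nin: "(i,b,t) \<notin> D" using mem_iff_row[OF D] by (auto simp: b_def)
  have "diagram m (insert (i,b,t) D)"
    unfolding diagram_def
  proof (intro conjI)
    show "finite (insert (i,b,t) D)" using diagram_finite[OF D] by simp
    show "\<forall>(i', j, c)\<in>insert (i,b,t) D. 1 \<le> i' \<and> 1 \<le> j \<and> 1 \<le> c \<and> c \<le> m"
      using diagram_pos[OF D] ti by (auto simp: b_def)
    show "\<forall>i1 j c i' j'. (i1, j, c) \<in> insert (i,b,t) D \<longrightarrow> 1 \<le> i' \<longrightarrow> i' \<le> i1 \<longrightarrow> 1 \<le> j' \<longrightarrow> j' \<le> j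
        \<longrightarrow> (i', j', c) \<in> insert (i,b,t) D"
    proof (intro allI impI)
      fix i1 j c i' j'
      assume h: "(i1, j, c) \<in> insert (i,b,t) D" "1 \<le> i'" "i' \<le> i1" "1 \<le> j'" "j' \<le> j"
      show "(i', j', c) \<in> insert (i,b,t) D"
      proof (cases "(i1,j,c) \<in> D")
        case True
        then show ?thesis using diagram_down[OF D True] h by auto
      next
        case False
        then have e: "i1 = i" "j = b" "c = t" using h by auto
        show ?thesis
        proof (cases "i' = i")
          case True
          then show ?thesis using h e mem_iff_row[OF D, of i j' t] by (auto simp: b_def)
        next
          case False
          then have "2 \<le> i" "i' \<le> i - 1" using h e by auto
          then have "b \<le> rlen D t i'" using prev rlen_antimono[OF D, of i' "i - 1" t] h by auto
          then show ?thesis using h e mem_iff_row[OF D, of i' j' t] by auto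
        qed
      qed
    qed
  qed
  then show ?thesis using nin by (simp add: addable_def b_def)
qed

lemma removable_row:
  assumes D: "diagram m D" and r: "(i,j,c) \<in> removable m D"
  shows "j = rlen D c i" "(c,i) \<in> inner_rows m D" "rlen D c (Suc i) < rlen D c i"
proof -
  have rD: "(i,j,c) \<in> D" and D': "diagram m (D - {(i,j,c)})" using r by (auto simp: removable_def)
  have pos: "1 \<le> i" "1 \<le> j" "1 \<le> c" "c \<le> m" using diagram_pos[OF D rD] by auto
  have le: "j \<le> rlen D c i" using rD mem_iff_row[OF D] by auto
  show j: "j = rlen D c i"
  proof (rule ccontr)
    assume "j \<noteq> rlen D c i"
    then have "(i, Suc j, c) \<in> D - {(i,j,c)}" using le mem_iff_row[OF D, of i "Suc j" c] by auto
    then show False using diagram_down[OF D', of i "Suc j" c i j] pos by auto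
  qed
  have "(i,1,c) \<in> D" using diagram_down[OF D rD] pos by auto
  then show "(c,i) \<in> inner_rows m D" using pos mem_iff_col[OF D, of i 1 c] by (auto simp: inner_rows_def)
  show "rlen D c (Suc i) < rlen D c i"
  proof (rule ccontr)
    assume "\<not> ?thesis"
    then have "(Suc i, j, c) \<in> D - {(i,j,c)}" using j pos mem_iff_row[OF D, of "Suc i" j c] by auto
    then show False using diagram_down[OF D', of "Suc i" j c i j] pos by auto
  qed
qed

lemma removable_content:
  assumes "diagram m D" "(i,j,c) \<in> removable m D"
  shows "node_content Q (i,j,c) = inner_content Q D (c,i)"
  using removable_row(1)[OF assms] by (simp add: node_content_def inner_content_def)

lemma removable_exists:
  assumes D: "diagram m D" and "D \<noteq> {}"
  shows "\<exists>r. r \<in> removable m D"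
proof -
  \<comment> \<open>A cell with maximal i + j has no cell to its lower right and can be
    removed.\<close>
  define w :: "node \<Rightarrow> nat" where "w = (\<lambda>(i,j,c). i + j)"
  obtain r where r: "r \<in> D" "w r = Max (w ` D)"
  proof -
    have "Max (w ` D) \<in> w ` D" using diagram_finite[OF D] assms(2) by (intro Max_in) auto
    then show thesis using that by (metis imageE)
  qed
  have max: "w v \<le> w r" if "v \<in> D" for v
    using that diagram_finite[OF D] unfolding r(2) by simp
  have "diagram m (D - {r})"
    unfolding diagram_def
  proof (intro conjI)
    show "finite (D - {r})" using diagram_finite[OF D] by simp
    show "\<forall>(i', j, c)\<in>D - {r}. 1 \<le> i' \<and> 1 \<le> j \<and> 1 \<le> c \<and> c \<le> m"
      using diagram_pos[OF D] by auto
    show "\<forall>i j c i' j'. (i, j, c) \<in> D - {r} \<longrightarrow> 1 \<le> i' \<longrightarrow> i' \<le> i \<longrightarrow> 1 \<le> j' \<longrightarrow> j' \<le> j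
        \<longrightarrow> (i', j', c) \<in> D - {r}"
    proof (intro allI impI)
      fix i j c i' j'
      assume h: "(i, j, c) \<in> D - {r}" "1 \<le> i'" "i' \<le> i" "1 \<le> j'" "j' \<le> j"
      have "(i',j',c) \<in> D" using diagram_down[OF D] h by blast
      moreover have "(i',j',c) \<noteq> r"
      proof
        assume "(i',j',c) = r"
        then have "i + j \<le> i' + j'" using max[of "(i,j,c)"] h by (auto simp: w_def)
        then have "(i,j,c) = r" using h \<open>(i',j',c) = r\<close> by auto
        then show False using h by simp
      qed
      ultimately show "(i', j', c) \<in> D - {r}" by simp
    qed
  qed
  then have "r \<in> removable m D" using r(1) unfolding removable_def by simp
  then show ?thesis ..
qed

lemma removable_addable:
  "r \<in> removable m D \<Longrightarrow> diagram m D \<Longrightarrow> r \<in> addable m (D - {r})"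
  by (auto simp: removable_def addable_def insert_absorb)

text \<open>\<open>j - 1\<close> cells in a first row and \<open>i' - 1\<close> cells in a first
  column overlap at most in a corner, and only if the components agree. Applied twice, this bounds
  differences of contents by the number of cells.\<close>

lemma arm_leg_bound:
  fixes D :: "node set"
  assumes "finite D" "1 \<le> j" "1 \<le> i'"
    and "\<And>x. 1 \<le> x \<Longrightarrow> x < j \<Longrightarrow> (1,x,c) \<in> D" "\<And>x. 1 \<le> x \<Longrightarrow> x < i' \<Longrightarrow> (x,1,c') \<in> D"
  shows "j + i' \<le> card D + 2 + (if c = c' then 1 else 0)"
proof -
  define A :: "node set" where "A = (\<lambda>x. (1,x,c)) ` {1..<j}"
  define B :: "node set" where "B = (\<lambda>x. (x,1,c')) ` {1..<i'}"
  have "card A = j - 1" "card B = i' - 1"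
    unfolding A_def B_def by (subst card_image; auto simp: inj_on_def)+
  moreover have "card (A \<union> B) + card (A \<inter> B) = card A + card B"
    unfolding A_def B_def by (rule card_Un_Int[symmetric]) auto
  moreover have "card (A \<inter> B) \<le> (if c = c' then 1 else 0)"
  proof -
    have "A \<inter> B \<subseteq> (if c = c' then {(1,1,c)} else {})" by (auto simp: A_def B_def)
    then have "card (A \<inter> B) \<le> card (if c = c' then {(1::nat,1::nat,c)} else {})" by (rule card_mono[rotated]) auto
    then show ?thesis by (auto split: if_splits)
  qed
  moreover have "card (A \<union> B) \<le> card D"
    by (rule card_mono) (use assms in \<open>auto simp: A_def B_def\<close>)
  ultimately show ?thesis using assms by linarith
qed

definition diagrams :: "nat \<Rightarrow> nat \<Rightarrow> node set set" where
  "diagrams m k = {D. diagram m D \<and> card D = k}"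

lemma finite_diagrams: "finite (diagrams m k)"
proof -
  have "D \<subseteq> {1..k} \<times> {1..k} \<times> {1..m}" if "D \<in> diagrams m k" for D
  proof
    fix v assume v: "v \<in> D"
    have D: "diagram m D" and k: "card D = k" using that by (auto simp: diagrams_def)
    obtain i j c where vv: "v = (i,j,c)" by (cases v)
    note pos = diagram_pos[OF D v[unfolded vv]]
    have "(\<lambda>x. (x,1,c)) ` {1..i} \<subseteq> D" "(\<lambda>x. (1,x,c)) ` {1..j} \<subseteq> D"
      using diagram_down[OF D v[unfolded vv]] pos by auto
    then have "card ((\<lambda>x. (x,1::nat,c)) ` {1..i}) \<le> k" "card ((\<lambda>x. (1::nat,x,c)) ` {1..j}) \<le> k"
      using card_mono[OF diagram_finite[OF D]] k by auto
    then have "i \<le> k" "j \<le> k" by (auto simp: card_image inj_on_def)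
    then show "v \<in> {1..k} \<times> {1..k} \<times> {1..m}" using pos vv by auto
  qed
  then have "diagrams m k \<subseteq> Pow ({1..k} \<times> {1..k} \<times> {1..m})" by auto
  then show ?thesis by (rule finite_subset) auto
qed

lemma finite_removable: "diagram m D \<Longrightarrow> finite (removable m D)"
  by (rule finite_subset[of _ D]) (auto simp: removable_def diagram_finite)

lemma finite_addable:
  assumes "diagram m D"
  shows "finite (addable m D)"
proof -
  have "addable m D \<subseteq> (\<lambda>(t,i). (i, Suc (rlen D t i), t)) ` outer_rows m D"
    using addable_imp_outer(1)[OF assms] addable_row_col(2)[OF assms] by (force simp: image_iff)
  then show ?thesis by (rule finite_subset) (auto simp: outer_rows_def)
qed

text \<open>Both sides run over the edges between two levels of the branching graph, listed once by
  their upper and once by their lower end.\<close>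

lemma sum_removable_eq_sum_addable:
  fixes f :: "node set \<Rightarrow> node \<Rightarrow> 'k::comm_monoid_add"
  shows "(\<Sum>\<mu>\<in>diagrams m (Suc k). \<Sum>y\<in>removable m \<mu>. f (\<mu> - {y}) y)
    = (\<Sum>\<nu>\<in>diagrams m k. \<Sum>y\<in>addable m \<nu>. f \<nu> y)"
proof -
  have "(\<Sum>\<mu>\<in>diagrams m (Suc k). \<Sum>y\<in>removable m \<mu>. f (\<mu> - {y}) y)
      = (\<Sum>(\<mu>,y)\<in>(SIGMA \<mu>:diagrams m (Suc k). removable m \<mu>). f (\<mu> - {y}) y)"
    by (rule sum.Sigma[OF finite_diagrams]) (auto simp: finite_removable diagrams_def)
  also have "\<dots> = (\<Sum>(\<nu>,y)\<in>(SIGMA \<nu>:diagrams m k. addable m \<nu>). f \<nu> y)"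
    by (rule sum.reindex_bij_witness[of _ "\<lambda>(\<nu>,y). (insert y \<nu>, y)" "\<lambda>(\<mu>,y). (\<mu> - {y}, y)"])
      (auto simp: diagrams_def removable_def addable_def insert_absorb diagram_finite)
  also have "\<dots> = (\<Sum>\<nu>\<in>diagrams m k. \<Sum>y\<in>addable m \<nu>. f \<nu> y)"
    by (rule sum.Sigma[OF finite_diagrams, symmetric]) (auto simp: finite_addable diagrams_def)
  finally show ?thesis .
qed

section \<open>Sums over addable nodes for separated parameters\<close>

locale separated_params =
  fixes Q :: "nat \<Rightarrow> 'k::field" and m n :: nat
  assumes m_pos: "1 \<le> m" and sep: "separated Q m n"
begin

text \<open>Such a \<open>d\<close> divides \<open>fact n\<close>, which \<open>separated\<close>
  makes nonzero in the field.\<close>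

lemma of_int_neq_0:
  assumes "d \<noteq> 0" "\<bar>d\<bar> \<le> int n"
  shows "(of_int d :: 'k) \<noteq> 0"
proof
  assume "(of_int d :: 'k) = 0"
  moreover have "nat \<bar>d\<bar> dvd fact n" using assms by (intro dvd_fact) auto
  then have "int (nat \<bar>d\<bar>) dvd int (fact n)" by (simp only: int_dvd_int_iff)
  then have "d dvd int (fact n)" by simp
  ultimately have "(of_int (int (fact n)) :: 'k) = 0" by (metis dvd_def mult_zero_left of_int_mult)
  then have "(of_nat (fact n) :: 'k) = 0" by (metis of_int_of_nat_eq)
  then show False using sep unfolding separated_def by (simp only: mult_zero_left simp_thms)
qed

lemma separated_diff:
  assumes "i \<in> {1..m}" "j \<in> {1..m}" "i \<noteq> j" "\<bar>d\<bar> < int n"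
  shows "of_int d + Q i - Q j \<noteq> 0"
proof -
  have *: "of_int d + Q i - Q j \<noteq> 0" if "i \<in> {1..m}" "j \<in> {i<..m}" "\<bar>d\<bar> < int n" for i j d
    using sep that unfolding separated_def by (force simp: prod_zero_iff)
  show ?thesis
  proof (cases "i < j")
    case True
    then show ?thesis using * assms by auto
  next
    case False
    then have "of_int (- d) + Q j - Q i \<noteq> 0" using *[of j i "- d"] assms by auto
    then show ?thesis by (simp add: algebra_simps)
  qed
qed

text \<open>The part of being at the border or inside that the count in \<open>arm_leg_bound\<close>
  uses. It covers cells of \<open>D\<close>, addable nodes, and also row ends that are not
  addable.\<close>

definition near :: "node set \<Rightarrow> node \<Rightarrow> bool" where
  "near D v \<longleftrightarrow> (case v of (i,j,c) \<Rightarrow> 1 \<le> i \<and> 1 \<le> j \<and> c \<in> {1..m}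
     \<and> (\<forall>x. 1 \<le> x \<and> x < j \<longrightarrow> (1,x,c) \<in> D) \<and> (\<forall>x. 1 \<le> x \<and> x < i \<longrightarrow> (x,1,c) \<in> D))"

text \<open>Between different components the offset \<open>d\<close> is at most
  \<open>card D\<close>, below \<open>n\<close>, as the product in \<open>separated\<close>
  requires. Within one component the bound is larger by one because of the shared corner, but
  \<open>n\<close> is still covered by the factorial.\<close>

lemma content_eq_imp_diagonal:
  assumes D: "diagram m D" "card D < n" and v: "near D (i,j,c)" "near D (i',j',c')"
    and eq: "node_content Q (i,j,c) = node_content Q (i',j',c')"
  shows "c = c'" "int j - int i = int j' - int i'"
proof -
  define d where "d = (int j - int i) - (int j' - int i')"
  have d: "of_int d + Q c - Q c' = 0" using eq by (simp add: d_def node_content_def algebra_simps)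
  have "j + i' \<le> card D + 2 + (if c = c' then 1 else 0)"
    by (rule arm_leg_bound) (use v diagram_finite[OF D(1)] in \<open>auto simp: near_def\<close>)
  moreover have "j' + i \<le> card D + 2 + (if c' = c then 1 else 0)"
    by (rule arm_leg_bound) (use v diagram_finite[OF D(1)] in \<open>auto simp: near_def\<close>)
  moreover have pos: "1 \<le> i" "1 \<le> j" "1 \<le> i'" "1 \<le> j'" "c \<in> {1..m}" "c' \<in> {1..m}"
    using v by (auto simp: near_def)
  ultimately have b: "\<bar>d\<bar> \<le> int (card D) + (if c = c' then 1 else 0)"
    unfolding d_def by (auto split: if_splits)
  show c: "c = c'"
  proof (rule ccontr)
    assume "c \<noteq> c'"
    then show False using separated_diff[of c c' d] pos b D(2) d by auto
  qed
  have "d = 0" using of_int_neq_0[of d] d b D(2) c by auto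
  then show "int j - int i = int j' - int i'" by (simp add: d_def)
qed

lemma near_outer:
  assumes D: "diagram m D" and x: "(t,i) \<in> outer_rows m D"
  shows "near D (i, Suc (rlen D t i), t)"
proof -
  have ti: "t \<in> {1..m}" "1 \<le> i" "i \<le> Suc (clen D t 1)" using x by (auto simp: outer_rows_def)
  have "(1,x,t) \<in> D" if "1 \<le> x" "x < Suc (rlen D t i)" for x
    using diagram_down[OF D, of i x t 1 x] mem_iff_row[OF D, of i x t] that ti by auto
  moreover have "(x,1,t) \<in> D" if "1 \<le> x" "x < i" for x
    using mem_iff_col[OF D, of x 1 t] that ti by auto
  ultimately show ?thesis using ti unfolding near_def by auto
qed

text \<open>Two row ends on one diagonal of a component would make the row lengths increase with the
  row index.\<close>

lemma inj_outer_content: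
  assumes D: "diagram m D" "card D < n"
  shows "inj_on (outer_content Q D) (outer_rows m D)"
proof (rule inj_onI, clarify)
  fix t i t' i'
  assume x: "(t,i) \<in> outer_rows m D" "(t',i') \<in> outer_rows m D"
    and eq: "outer_content Q D (t,i) = outer_content Q D (t',i')"
  note * = content_eq_imp_diagonal[OF D near_outer[OF D(1) x(1)] near_outer[OF D(1) x(2)]
      eq[unfolded outer_content_eq]]
  have "1 \<le> i" "1 \<le> i'" using x by (auto simp: outer_rows_def)
  then have "i = i'"
    using * rlen_antimono[OF D(1), of i i' t] rlen_antimono[OF D(1), of i' i t] by (cases "i \<le> i'") auto
  then show "t = t' \<and> i = i'" using * by simp
qed

lemma addable_content_inj:
  assumes D: "diagram m D" "card D < n" and y: "y \<in> addable m D" "y' \<in> addable m D"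
    and eq: "node_content Q y = node_content Q y'"
  shows "y = y'"
proof -
  obtain a b p a' b' p' where yy: "y = (a,b,p)" "y' = (a',b',p')" by (metis surj_pair)
  have "(p,a) = (p',a')"
    using inj_onD[OF inj_outer_content[OF D], of "(p,a)" "(p',a')"] y eq
      addable_imp_outer(1)[OF D(1), of a b p] addable_imp_outer(1)[OF D(1), of a' b' p']
      addable_imp_outer(2)[OF D(1), of a b p Q] addable_imp_outer(2)[OF D(1), of a' b' p' Q]
    unfolding yy by simp
  then show ?thesis
    using addable_row_col(2)[OF D(1), of a b p] addable_row_col(2)[OF D(1), of a' b' p'] y unfolding yy by simp
qed

text \<open>\<open>D\<close> may have all \<open>n\<close> cells; taking \<open>r\<close> away
  brings the count below \<open>n\<close>, and both nodes stay \<open>near\<close> the rest. Of two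
  cells on one diagonal the upper left one cannot be removed while the other is present.\<close>

lemma removable_content_inj:
  assumes D: "diagram m D" "card D \<le> n" and r: "r \<in> removable m D" "r' \<in> removable m D"
    and eq: "node_content Q r = node_content Q r'"
  shows "r = r'"
proof (rule ccontr)
  assume ne: "r \<noteq> r'"
  obtain i j c i' j' c' where rr: "r = (i,j,c)" "r' = (i',j',c')" by (metis surj_pair)
  have rD: "r \<in> D" "r' \<in> D" and E: "diagram m (D - {r})" "diagram m (D - {r'})"
    using r by (auto simp: removable_def)
  have card: "card (D - {r}) < n" using rD D diagram_finite[OF D(1)]
    by (meson card_Diff1_less less_le_trans)
  have "near (D - {r}) (i',j',c')"
  proof -
    have "(i',j',c') \<in> D - {r}" using rD(2) ne unfolding rr(2) by blast
    from diagram_pos[OF E(1) this] diagram_down[OF E(1) this] show ?thesis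
      unfolding near_def by simp
  qed
  moreover have "near (D - {r}) (i,j,c)"
    using diagram_pos[OF D(1), of i j c] diagram_down[OF D(1), of i j c] rD rr
    unfolding near_def by auto
  ultimately have *: "c = c'" "int j - int i = int j' - int i'"
    using content_eq_imp_diagonal[OF E(1) card] eq rr by metis+
  have pos: "1 \<le> i" "1 \<le> j" "1 \<le> i'" "1 \<le> j'"
    using diagram_pos[OF D(1), of i j c] diagram_pos[OF D(1), of i' j' c'] rD rr by auto
  show False
  proof (cases "i \<le> i'")
    case True
    then have "r \<in> D - {r}" using diagram_down[OF E(1), of i' j' c' i j] rD ne rr pos * by auto
    then show False by simp
  next
    case False
    then have "r' \<in> D - {r'}" using diagram_down[OF E(2), of i j c i' j'] rD ne rr pos * by auto
    then show False by simp
  qed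
qed

text \<open>Distinct outer contents make the right side of \<open>diagram_schur_insert\<close>
  nonzero, hence every factor on its left side.\<close>

lemma diagram_schur_insert_nonzero:
  assumes D: "diagram m D" "card D < n" and y: "(a,b,p) \<in> addable m D" and nz: "diagram_schur Q m D \<noteq> 0"
  shows "diagram_schur Q m (insert (a,b,p) D) \<noteq> 0"
    and "(\<Prod>x\<in>outer_rows m D - {(p,a)}. node_content Q (a,b,p) - outer_content Q D x) \<noteq> 0"
proof -
  have fin: "finite (outer_rows m D)" by (simp add: outer_rows_def)
  show *: "(\<Prod>x\<in>outer_rows m D - {(p,a)}. node_content Q (a,b,p) - outer_content Q D x) \<noteq> 0"
    using inj_outer_content[OF D] addable_imp_outer(1)[OF D(1) y] addable_imp_outer(2)[OF D(1) y, of Q] fin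
    by (auto simp: inj_on_def)
  show "diagram_schur Q m (insert (a,b,p) D) \<noteq> 0"
    using diagram_schur_insert[OF D(1) y, of Q] * nz by (metis mult_eq_0_iff)
qed

lemma diagram_schur_nonzero:
  assumes "diagram m D" "card D \<le> n"
  shows "diagram_schur Q m D \<noteq> 0"
  using assms
proof (induction "card D" arbitrary: D)
  case 0
  then have "D = {}" using diagram_finite by auto
  then show ?case by (simp add: diagram_schur_def)
next
  case (Suc k)
  then obtain r where r: "r \<in> removable m D" using removable_exists[of m D] by fastforce
  obtain a b p where rr: "r = (a,b,p)" by (metis surj_pair)
  have c: "k = card (D - {r})" using Suc.hyps(2) r Suc.prems diagram_finite by (auto simp: removable_def)
  moreover have "diagram m (D - {r})" using r by (simp add: removable_def)
  moreover have "insert r (D - {r}) = D" using r by (auto simp: removable_def)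
  ultimately show ?case
    using diagram_schur_insert_nonzero(1)[of "D - {r}" a b p] Suc.hyps(1)[of "D - {r}"] Suc.hyps(2) Suc.prems
      removable_addable[OF r] rr by simp
qed

text \<open>The common core of the two summation identities. By \<open>diagram_schur_insert\<close>,
  each summand is the Lagrange term of \<open>P\<close> at the outer content of the row of
  \<open>y\<close>, divided by the hook product of \<open>D\<close>. The outer rows that are not
  addable may be included because \<open>P\<close> vanishes at their contents.\<close>

lemma sum_addable_eq_coeff:
  assumes D: "diagram m D" "card D < n"
    and deg: "degree P < card (outer_rows m D)"
    and zero: "\<And>t i. (t,i) \<in> outer_rows m D \<Longrightarrow> 2 \<le> i \<Longrightarrow> rlen D t (i - 1) = rlen D t i \<Longrightarrow>
      (t, i - 1) \<in> inner_rows m D \<Longrightarrow> poly P (outer_content Q D (t,i)) = 0"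
    and g: "\<And>y. y \<in> addable m D \<Longrightarrow>
      poly P (node_content Q y) = g y * (\<Prod>x\<in>inner_rows m D. node_content Q y - inner_content Q D x)"
  shows "(\<Sum>y\<in>addable m D. g y / diagram_schur Q m (insert y D))
    = coeff P (card (outer_rows m D) - 1) / diagram_schur Q m D"
proof -
  define S where "S = diagram_schur Q m D"
  have S: "S \<noteq> 0" unfolding S_def using diagram_schur_nonzero D by simp
  have fin: "finite (outer_rows m D)" by (simp add: outer_rows_def)
  define F where "F x = poly P (outer_content Q D x)
      / (\<Prod>x'\<in>outer_rows m D - {x}. outer_content Q D x - outer_content Q D x')" for x
  define \<phi> :: "node \<Rightarrow> nat \<times> nat" where "\<phi> = (\<lambda>(a,b,p). (p,a))"
  have inj: "inj_on \<phi> (addable m D)"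
  proof (rule inj_onI)
    fix v w assume v: "v \<in> addable m D" and w: "w \<in> addable m D" and e: "\<phi> v = \<phi> w"
    obtain a b p b' where vw: "v = (a,b,p)" "w = (a,b',p)" using e unfolding \<phi>_def by (cases v; cases w) auto
    show "v = w" using addable_row_col(2)[OF D(1) v[unfolded vw]] addable_row_col(2)[OF D(1) w[unfolded vw]] vw
      by simp
  qed
  have sub: "\<phi> ` addable m D \<subseteq> outer_rows m D"
    using addable_imp_outer(1)[OF D(1)] by (auto simp: \<phi>_def)
  have summand: "g y / diagram_schur Q m (insert y D) = F (\<phi> y) / S" if y: "y \<in> addable m D" for y
  proof -
    obtain a b p where yy: "y = (a,b,p)" by (metis surj_pair)
    define z where "z = node_content Q y"
    define X where "X = (\<Prod>x\<in>inner_rows m D. z - inner_content Q D x)"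
    define Y where "Y = (\<Prod>x\<in>outer_rows m D - {(p,a)}. z - outer_content Q D x)"
    define S' where "S' = diagram_schur Q m (insert y D)"
    have e: "S' * X = S * Y" unfolding S'_def X_def S_def Y_def z_def yy
      using diagram_schur_insert[OF D(1) y[unfolded yy], of Q] .
    have nz: "S' \<noteq> 0" "Y \<noteq> 0" unfolding S'_def Y_def z_def yy
      using diagram_schur_insert_nonzero[OF D y[unfolded yy]] S S_def by auto
    have z: "z = outer_content Q D (p,a)" unfolding z_def yy
      using addable_imp_outer(2)[OF D(1) y[unfolded yy]] .
    have "F (\<phi> y) = g y * X / Y"
      using g[OF y] unfolding F_def \<phi>_def yy prod.case z[symmetric] X_def Y_def
      by (simp add: z_def yy)
    then have "F (\<phi> y) / S = g y * X / (S * Y)" by (simp add: mult.commute)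
    also have "\<dots> = g y / S'" unfolding e[symmetric] using nz e S by (auto simp: field_simps)
    finally show ?thesis by (simp add: S'_def)
  qed
  have "(\<Sum>y\<in>addable m D. g y / diagram_schur Q m (insert y D)) = (\<Sum>x\<in>\<phi> ` addable m D. F x / S)"
    unfolding sum.reindex[OF inj] by (rule sum.cong) (auto simp: summand)
  also have "\<dots> = (\<Sum>x\<in>outer_rows m D. F x / S)"
  proof (rule sum.mono_neutral_left[OF fin sub], safe)
    fix t i assume x: "(t,i) \<in> outer_rows m D" and n: "(t,i) \<notin> \<phi> ` addable m D"
    have "(i, Suc (rlen D t i), t) \<notin> addable m D"
      using n imageI[of "(i, Suc (rlen D t i), t)" "addable m D" \<phi>] by (auto simp: \<phi>_def)
    then show "F (t,i) / S = 0"
      using zero[OF x] outer_addable_or_inner[OF D(1) x] by (auto simp: F_def)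
  qed
  also have "\<dots> = coeff P (card (outer_rows m D) - 1) / S"
    unfolding sum_divide_distrib[symmetric] F_def
    by (simp add: lagrange_coeff_sum[OF fin inj_outer_content[OF D] deg])
  finally show ?thesis by (simp add: S_def)
qed

lemma card_outer_rows: "card (outer_rows m D) = card (inner_rows m D) + m"
proof -
  have "card (outer_rows m D) = (\<Sum>t\<in>{1..m}. clen D t 1 + 1)" by (simp add: outer_rows_def)
  then show ?thesis unfolding sum.distrib by (simp add: inner_rows_def)
qed

lemma monic_linear_product:
  fixes f :: "'i \<Rightarrow> 'k"
  shows "degree (\<Prod>x\<in>A. [:- f x, 1:]) = card A" "lead_coeff (\<Prod>x\<in>A. [:- f x, 1:]) = 1"
proof -
  have "degree (\<Prod>x\<in>A. [:- f x, 1:]) = (\<Sum>x\<in>A. degree [:- f x, 1:])"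
    by (rule degree_prod_eq_sum_degree) auto
  then show "degree (\<Prod>x\<in>A. [:- f x, 1:]) = card A" by simp
  show "lead_coeff (\<Prod>x\<in>A. [:- f x, 1:]) = 1" by (simp add: lead_coeff_prod)
qed

lemma outer_eq_inner:
  assumes "2 \<le> i" "rlen D t (i - 1) = rlen D t i"
  shows "outer_content Q D (t,i) = inner_content Q D (t, i - 1)"
  using assms by (simp add: outer_content_def inner_content_def of_nat_diff)

text \<open>Interpolation of z^a times the product over the inner contents. There are
  \<open>m\<close> more outer than inner rows, so the coefficient read off is the leading one
  exactly for \<open>a = m - 1\<close> and lies above the degree for smaller
  \<open>a\<close>.\<close>

lemma sum_addable_content_power:
  assumes D: "diagram m D" "card D < n" and a: "a < m"
  shows "(\<Sum>y\<in>addable m D. node_content Q y ^ a / diagram_schur Q m (insert y D))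
    = (if a = m - 1 then 1 else 0) / diagram_schur Q m D"
proof -
  define I where "I = (\<Prod>x\<in>inner_rows m D. [:- inner_content Q D x, 1:])"
  define P where "P = monom 1 a * I"
  have I: "degree I = card (inner_rows m D)" "lead_coeff I = 1" unfolding I_def by (rule monic_linear_product)+
  have I0: "I \<noteq> 0" using I(2) by auto
  have deg: "degree P = card (inner_rows m D) + a" "lead_coeff P = 1"
  proof -
    show "lead_coeff P = 1"
      unfolding P_def lead_coeff_mult I(2) by (simp add: degree_monom_eq)
  qed (use I I0 in \<open>simp add: P_def degree_mult_eq degree_monom_eq monom_eq_0_iff\<close>)
  have fin: "finite (inner_rows m D)" by (simp add: inner_rows_def)
  have pP: "poly P z = z ^ a * (\<Prod>x\<in>inner_rows m D. z - inner_content Q D x)" for z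
    by (simp add: P_def I_def poly_monom poly_prod)
  have "(\<Sum>y\<in>addable m D. node_content Q y ^ a / diagram_schur Q m (insert y D))
      = coeff P (card (outer_rows m D) - 1) / diagram_schur Q m D"
  proof (rule sum_addable_eq_coeff[OF D])
    show "degree P < card (outer_rows m D)" using deg a by (simp add: card_outer_rows)
    fix t i assume "2 \<le> i" "rlen D t (i - 1) = rlen D t i" "(t, i - 1) \<in> inner_rows m D"
    then show "poly P (outer_content Q D (t,i)) = 0"
      unfolding pP using fin outer_eq_inner[of i D t] by auto
  qed (rule pP)
  also have "coeff P (card (outer_rows m D) - 1) = (if a = m - 1 then 1 else 0)"
  proof (cases "a = m - 1")
    case True
    then have "card (outer_rows m D) - 1 = degree P" using deg m_pos by (simp add: card_outer_rows)
    then show ?thesis using deg True by simp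
  next
    case False
    then have "card (outer_rows m D) - 1 > degree P" using deg m_pos a by (simp add: card_outer_rows)
    then show ?thesis using False by (simp add: coeff_eq_0)
  qed
  finally show ?thesis .
qed

text \<open>Interpolation of the product over the inner contents with the factor of \<open>r\<close>
  left out; its degree is too small to reach the coefficient read off.\<close>

lemma sum_addable_content_inverse:
  assumes D: "diagram m D" "card D < n" and r: "r \<in> removable m D"
  shows "(\<Sum>y\<in>addable m D. 1 / (node_content Q y - node_content Q r) / diagram_schur Q m (insert y D)) = 0"
proof -
  obtain i j c where rr: "r = (i,j,c)" by (metis surj_pair)
  note R = removable_row[OF D(1) r[unfolded rr]]
  have cr: "node_content Q r = inner_content Q D (c,i)" using removable_content[OF D(1)] r rr by auto
  define P where "P = (\<Prod>x\<in>inner_rows m D - {(c,i)}. [:- inner_content Q D x, 1:])"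
  have fin: "finite (inner_rows m D)" by (simp add: inner_rows_def)
  have deg: "degree P = card (inner_rows m D) - 1" unfolding P_def monic_linear_product using R(2) fin by simp
  have pos: "card (inner_rows m D) > 0" using R(2) fin card_gt_0_iff by blast
  have pP: "poly P z = (\<Prod>x\<in>inner_rows m D - {(c,i)}. z - inner_content Q D x)" for z
    by (simp add: P_def poly_prod)
  have nz: "(\<Prod>x\<in>inner_rows m D. node_content Q y - inner_content Q D x) \<noteq> 0" if y: "y \<in> addable m D" for y
  proof -
    obtain a b p where yy: "y = (a,b,p)" by (metis surj_pair)
    show ?thesis
      using diagram_schur_insert[OF D(1) y[unfolded yy], of Q]
        diagram_schur_insert_nonzero[OF D y[unfolded yy]] diagram_schur_nonzero[OF D(1)] D(2)
      unfolding yy by (metis less_imp_le mult_eq_0_iff)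
  qed
  have "(\<Sum>y\<in>addable m D. 1 / (node_content Q y - node_content Q r) / diagram_schur Q m (insert y D))
      = coeff P (card (outer_rows m D) - 1) / diagram_schur Q m D"
  proof (rule sum_addable_eq_coeff[OF D])
    show "degree P < card (outer_rows m D)" using deg m_pos by (simp add: card_outer_rows)
    fix t k assume k: "2 \<le> k" "rlen D t (k - 1) = rlen D t k" "(t, k - 1) \<in> inner_rows m D"
    \<comment> \<open>The factor left out is not one of those that cancel a row that is not addable:
      the row below a removable node is strictly shorter.\<close>
    have "(t, k - 1) \<noteq> (c,i)" using R(3) k by auto
    then show "poly P (outer_content Q D (t,k)) = 0"
      unfolding pP using fin outer_eq_inner[of k D t] k by auto
  next
    fix y assume y: "y \<in> addable m D"
    have "(\<Prod>x\<in>inner_rows m D. node_content Q y - inner_content Q D x)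
        = (node_content Q y - node_content Q r) * poly P (node_content Q y)"
      unfolding pP cr using prod.remove[OF fin R(2)] .
    then show "poly P (node_content Q y) = 1 / (node_content Q y - node_content Q r) *
         (\<Prod>x\<in>inner_rows m D. node_content Q y - inner_content Q D x)"
      using nz[OF y] by auto
  qed
  also have "coeff P (card (outer_rows m D) - 1) = 0"
    using deg pos m_pos by (intro coeff_eq_0) (simp add: card_outer_rows)
  finally show ?thesis by simp
qed

end

section \<open>Standard tableaux as paths\<close>

text \<open>A standard tableau is encoded by the list of its nodes in the order of their entries.\<close>

definition paths :: "nat \<Rightarrow> node set \<Rightarrow> node list set" where
  "paths m D = {p. distinct p \<and> set p = D \<and> (\<forall>k. diagram m (set (take k p)))}"

lemma path_length: "p \<in> paths m D \<Longrightarrow> length p = card D"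
  by (auto simp: paths_def distinct_card)

lemma path_take_diagram: "p \<in> paths m D \<Longrightarrow> diagram m (set (take k p))"
  by (auto simp: paths_def)

lemma path_diagram: "p \<in> paths m D \<Longrightarrow> diagram m D"
  using path_take_diagram[of p m D "length p"] by (auto simp: paths_def)

lemma finite_paths: "finite (paths m D)"
proof (cases "paths m D = {}")
  case False
  then have "finite D" using path_diagram diagram_finite by blast
  have "paths m D \<subseteq> {p. set p \<subseteq> D \<and> length p = card D}"
    using path_length by (auto simp: paths_def)
  then show ?thesis using finite_lists_length_eq[OF \<open>finite D\<close>] finite_subset by blast
qed simp

lemma path_take: "p \<in> paths m D \<Longrightarrow> take k p \<in> paths m (set (take k p))"
  by (auto simp: paths_def)

lemma path_card_take: "p \<in> paths m D \<Longrightarrow> k \<le> card D \<Longrightarrow> card (set (take k p)) = k"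
  using path_length[of "take k p" m "set (take k p)"] path_length[of p m D] path_take[of p m D k] by simp

lemma path_set_drop: "p \<in> paths m D \<Longrightarrow> set (take k p) = D - set (drop k p)"
  using set_take_disj_set_drop_if_distinct[of p k k] set_append[of "take k p" "drop k p"]
  by (auto simp: paths_def simp del: set_append)

lemma path_take_Suc:
  assumes "p \<in> paths m D" "k < card D"
  shows "set (take (Suc k) p) = insert (p ! k) (set (take k p))" "p ! k \<notin> set (take k p)"
proof -
  have k: "k < length p" using assms path_length by metis
  show "set (take (Suc k) p) = insert (p ! k) (set (take k p))"
    using k by (simp add: take_Suc_conv_app_nth)
  have "distinct (take (Suc k) p)" using assms by (simp add: paths_def)
  then show "p ! k \<notin> set (take k p)" using k by (simp add: take_Suc_conv_app_nth)
qed

lemma path_nth_removable: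
  assumes "p \<in> paths m D" "k < card D"
  shows "p ! k \<in> removable m (set (take (Suc k) p))"
  unfolding removable_def path_take_Suc(1)[OF assms]
  using path_take_Suc(2)[OF assms] path_take_diagram[OF assms(1), of k] by simp

lemma path_nth_addable:
  assumes "p \<in> paths m D" "k < card D"
  shows "p ! k \<in> addable m (set (take k p))"
  unfolding addable_def
  using path_take_Suc[OF assms] path_take_diagram[OF assms(1), of "Suc k"] by simp

lemma path_glue:
  assumes p: "p \<in> paths m D" and q: "q \<in> paths m (set (take k p))"
  shows "q @ drop k p \<in> paths m D"
proof -
  have sq: "set q = set (take k p)" using q by (simp add: paths_def)
  have "diagram m (set (take j (q @ drop k p)))" for j
  proof (cases "j \<le> length q")
    case True
    then show ?thesis using path_take_diagram[OF q, of j] by simp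
  next
    case False
    then have "set (take j (q @ drop k p)) = set (take k p) \<union> set (take (j - length q) (drop k p))"
      by (simp add: sq)
    also have "\<dots> = set (take (k + (j - length q)) p)" by (simp only: take_add set_append)
    finally show ?thesis using path_take_diagram[OF p] by simp
  qed
  moreover have "distinct (q @ drop k p)"
    using p q sq set_take_disj_set_drop_if_distinct[of p k k] by (auto simp: paths_def)
  moreover have "set (q @ drop k p) = D"
    using p sq set_append[of "take k p" "drop k p"] by (simp add: paths_def del: set_append) simp
  ultimately show ?thesis by (simp add: paths_def)
qed

lemma path_snoc:
  assumes q: "q \<in> paths m D" and y: "y \<in> addable m D"
  shows "q @ [y] \<in> paths m (insert y D)"
proof -
  have "diagram m (set (take k (q @ [y])))" for k
  proof (cases "k \<le> length q")
    case True
    then show ?thesis using path_take_diagram[OF q, of k] by simp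
  next
    case False
    then have "set (take k (q @ [y])) = insert y D" using q by (simp add: paths_def)
    then show ?thesis using y by (simp add: addable_def)
  qed
  then show ?thesis using q y by (auto simp: paths_def addable_def)
qed

lemma paths_nonempty:
  assumes "diagram m D"
  shows "\<exists>p. p \<in> paths m D"
  using assms
proof (induction "card D" arbitrary: D)
  case 0
  then have "D = {}" using diagram_finite by auto
  then have "[] \<in> paths m D" using 0 by (auto simp: paths_def)
  then show ?case ..
next
  case (Suc k)
  then obtain r where r: "r \<in> removable m D" using removable_exists[of m D] by fastforce
  have "k = card (D - {r})" "diagram m (D - {r})"
    using Suc.hyps(2) r Suc.prems diagram_finite by (auto simp: removable_def)
  then obtain q where "q \<in> paths m (D - {r})" using Suc.hyps(1) by blast
  then have "q @ [r] \<in> paths m (insert r (D - {r}))" using path_snoc removable_addable[OF r Suc.prems] by blast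
  moreover have "insert r (D - {r}) = D" using r by (auto simp: removable_def)
  ultimately show ?case by metis
qed

text \<open>Fixing the node at index \<open>k\<close> in addition to the tail after it amounts to
  fixing a longer tail. The path \<open>p1\<close> realises it: any path to the diagram without
  \<open>y\<close>, then \<open>y\<close>, then the old tail.\<close>

lemma path_fiber:
  assumes p0: "p0 \<in> paths m D" and k: "k < card D" and y: "y \<in> removable m (set (take (Suc k) p0))"
  obtains p1 where "p1 \<in> paths m D" "set (take k p1) = set (take (Suc k) p0) - {y}" "p1 ! k = y"
    "{p \<in> paths m D. drop (Suc k) p = drop (Suc k) p0 \<and> p ! k = y} = {p \<in> paths m D. drop k p = drop k p1}"
proof -
  define \<mu> where "\<mu> = set (take (Suc k) p0)"
  have \<mu>: "diagram m \<mu>" "card \<mu> = Suc k" unfolding \<mu>_def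
    using path_take_diagram[OF p0] path_card_take[OF p0] k by auto
  have y\<mu>: "y \<in> \<mu>" "diagram m (\<mu> - {y})" using y by (auto simp: removable_def \<mu>_def)
  obtain q where q: "q \<in> paths m (\<mu> - {y})" using paths_nonempty[OF y\<mu>(2)] by blast
  have lq: "length q = k" using path_length[OF q] \<mu> y\<mu>(1) diagram_finite[OF \<mu>(1)] by simp
  have sq: "set q = \<mu> - {y}" using q by (simp add: paths_def)
  have "q @ [y] \<in> paths m \<mu>"
    using path_snoc[OF q removable_addable[OF y[folded \<mu>_def] \<mu>(1)]] y\<mu>(1) by (simp add: insert_absorb)
  then have p1: "(q @ [y]) @ drop (Suc k) p0 \<in> paths m D" using path_glue[OF p0] unfolding \<mu>_def by blast
  define p1 where "p1 = (q @ [y]) @ drop (Suc k) p0"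
  have dp1: "drop k p1 = y # drop (Suc k) p0" using lq by (simp add: p1_def)
  have "drop k p = p ! k # drop (Suc k) p" if "p \<in> paths m D" for p
    using path_length[OF that] k by (simp add: Cons_nth_drop_Suc)
  then have "{p \<in> paths m D. drop (Suc k) p = drop (Suc k) p0 \<and> p ! k = y} = {p \<in> paths m D. drop k p = drop k p1}"
    unfolding dp1 by auto
  moreover have "set (take k p1) = set (take (Suc k) p0) - {y}" using lq sq by (simp add: p1_def \<mu>_def)
  moreover have "p1 ! k = y" using lq by (simp add: p1_def nth_append)
  ultimately show thesis using that p1 unfolding p1_def by blast
qed

text \<open>Paths with a common tail have reached the same diagram after \<open>k\<close> steps, so
  their \<open>k\<close>-th nodes, at index \<open>k - 1\<close>, are all removable from it.\<close>

lemma sum_paths_by_last: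
  fixes f :: "node list \<Rightarrow> 'b::comm_monoid_add"
  assumes p1: "p1 \<in> paths m D" and k: "1 \<le> k" "k \<le> card D"
  shows "(\<Sum>p | p \<in> paths m D \<and> drop k p = drop k p1. f p)
    = (\<Sum>r\<in>removable m (set (take k p1)). \<Sum>p | p \<in> paths m D \<and> drop k p = drop k p1 \<and> p ! (k - 1) = r. f p)"
proof -
  let ?E = "{p. p \<in> paths m D \<and> drop k p = drop k p1}"
  have "p ! (k - 1) \<in> removable m (set (take k p1))" if "p \<in> ?E" for p
    using path_nth_removable[of p m D "k - 1"] that k path_set_drop[of p m D k] path_set_drop[OF p1, of k] by auto
  then have "(\<Sum>r\<in>removable m (set (take k p1)). sum f {p \<in> ?E. p ! (k - 1) = r}) = sum f ?E"
    using finite_paths[of m D] finite_removable[OF path_take_diagram[OF p1]]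
    by (intro sum.group) auto
  then show ?thesis by (simp add: conj_assoc)
qed

context separated_params
begin

text \<open>Read forwards: the addable nodes of a diagram with fewer than \<open>n\<close> cells
  have distinct contents. The two paths may end in different diagrams.\<close>

lemma path_take_unique:
  assumes D: "card D \<le> n" and p: "p \<in> paths m D" "q \<in> paths m D'" and k: "k \<le> card D" "k \<le> card D'"
    and eq: "\<And>i. i < k \<Longrightarrow> node_content Q (p ! i) = node_content Q (q ! i)"
  shows "take k p = take k q"
  using k eq
proof (induction k)
  case (Suc k)
  then have IH: "take k p = take k q" by simp
  have "card (set (take k p)) < n" using path_card_take[OF p(1)] Suc.prems D by simp
  then have "p ! k = q ! k"
    using addable_content_inj[OF path_take_diagram[OF p(1)]] path_nth_addable[OF p(1)] path_nth_addable[OF p(2)]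
      IH Suc.prems by (metis Suc_le_lessD lessI)
  then show ?case using IH path_length[OF p(1)] path_length[OF p(2)] Suc.prems
    by (simp add: take_Suc_conv_app_nth)
qed simp

text \<open>Read backwards from the common end \<open>D\<close>: the removable nodes of a diagram
  have distinct contents.\<close>

lemma path_drop_unique:
  assumes D: "card D \<le> n" and p: "p \<in> paths m D" "q \<in> paths m D" and k: "k \<le> card D"
    and eq: "\<And>i. k \<le> i \<Longrightarrow> i < card D \<Longrightarrow> node_content Q (p ! i) = node_content Q (q ! i)"
  shows "drop k p = drop k q"
  using k eq
proof (induction rule: inc_induct)
  case base
  then show ?case using path_length[OF p(1)] path_length[OF p(2)] by simp
next
  case (step k)
  then have IH: "drop (Suc k) p = drop (Suc k) q" by simp
  have s: "set (take (Suc k) p) = set (take (Suc k) q)"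
    using path_set_drop[OF p(1)] path_set_drop[OF p(2)] IH by metis
  have "card (set (take (Suc k) p)) \<le> n" using path_card_take[OF p(1), of "Suc k"] step.hyps D by simp
  then have "p ! k = q ! k"
    using removable_content_inj[OF path_take_diagram[OF p(1)]] path_nth_removable[OF p(1)] path_nth_removable[OF p(2)]
      s step by (metis le_refl)
  then show ?case using IH path_length[OF p(1)] path_length[OF p(2)] step.hyps
    by (metis Cons_nth_drop_Suc)
qed

end

section \<open>Multipartitions as diagrams\<close>

lemma young_Sigma: "young p = (SIGMA i:{1..length p}. {1..p ! (i - 1)})"
  by (auto simp: young_def)

lemma card_young: "card (young p) = sum_list p"
proof -
  have "card (young p) = (\<Sum>i=1..length p. p ! (i - 1))" by (simp add: young_Sigma)
  also have "\<dots> = (\<Sum>i<length p. p ! i)"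
    by (rule sum.reindex_bij_witness[of _ Suc "\<lambda>i. i - 1"]) auto
  finally show ?thesis by (simp add: sum_list_sum_nth atLeast0LessThan)
qed

lemma mnodes_image: "mnodes \<mu> = (\<lambda>(c,i,j). (i,j,c)) ` (SIGMA c:{1..length \<mu>}. young (\<mu> ! (c - 1)))"
  by (force simp: mnodes_def image_iff)

lemma inj_mnodes_image: "inj_on (\<lambda>(c,i,j). (i,j,c)) A"
  by (auto simp: inj_on_def)

lemma finite_young: "finite (young p)"
  by (simp add: young_Sigma)

lemma card_mnodes: "card (mnodes \<mu>) = sum_list (map sum_list \<mu>)"
proof -
  have "card (mnodes \<mu>) = (\<Sum>c=1..length \<mu>. sum_list (\<mu> ! (c - 1)))"
    unfolding mnodes_image card_image[OF inj_mnodes_image] by (simp add: finite_young card_young)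
  also have "\<dots> = (\<Sum>c<length \<mu>. sum_list (\<mu> ! c))"
    by (rule sum.reindex_bij_witness[of _ Suc "\<lambda>i. i - 1"]) auto
  finally show ?thesis by (simp add: sum_list_sum_nth atLeast0LessThan)
qed

lemma mem_mnodes:
  "(i,j,c) \<in> mnodes \<mu> \<longleftrightarrow> c \<in> {1..length \<mu>} \<and> i \<in> {1..length (\<mu> ! (c - 1))} \<and> j \<in> {1..\<mu> ! (c - 1) ! (i - 1)}"
  by (auto simp: mnodes_def young_def)

lemma partition_antimono:
  assumes "is_partition p" "i' \<le> i" "i < length p"
  shows "p ! i \<le> p ! i'"
  using assms sorted_wrt_nth_less[of "(\<ge>)" p i' i] by (cases "i' = i") (auto simp: is_partition_def)

lemma multipartition_component:
  assumes "\<mu> \<in> multipartitions m n" "c \<in> {1..length \<mu>}"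
  shows "is_partition (\<mu> ! (c - 1))"
  using assms by (auto simp: multipartitions_def)

lemma diagram_mnodes:
  assumes \<mu>: "\<mu> \<in> multipartitions m n"
  shows "diagram m (mnodes \<mu>)"
  unfolding diagram_def
proof (intro conjI)
  have l: "length \<mu> = m" using \<mu> by (simp add: multipartitions_def)
  show "finite (mnodes \<mu>)" by (simp add: mnodes_image finite_young)
  show "\<forall>(i, j, c)\<in>mnodes \<mu>. 1 \<le> i \<and> 1 \<le> j \<and> 1 \<le> c \<and> c \<le> m"
    using l by (auto simp: mem_mnodes)
  show "\<forall>i j c i' j'. (i, j, c) \<in> mnodes \<mu> \<longrightarrow> 1 \<le> i' \<longrightarrow> i' \<le> i \<longrightarrow> 1 \<le> j' \<longrightarrow> j' \<le> j \<longrightarrow> (i', j', c) \<in> mnodes \<mu>"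
  proof (intro allI impI)
    fix i j c i' j' assume h: "(i, j, c) \<in> mnodes \<mu>" "1 \<le> i'" "i' \<le> i" "1 \<le> j'" "j' \<le> j"
    have "\<mu> ! (c - 1) ! (i - 1) \<le> \<mu> ! (c - 1) ! (i' - 1)"
      using h by (intro partition_antimono multipartition_component[OF \<mu>]) (auto simp: mem_mnodes)
    then show "(i', j', c) \<in> mnodes \<mu>" using h by (auto simp: mem_mnodes)
  qed
qed

lemma rlen_mnodes:
  assumes "c \<in> {1..length \<mu>}" "i \<in> {1..length (\<mu> ! (c - 1))}"
  shows "rlen (mnodes \<mu>) c i = \<mu> ! (c - 1) ! (i - 1)"
proof -
  have "{j. (i,j,c) \<in> mnodes \<mu>} = {1..\<mu> ! (c - 1) ! (i - 1)}" using assms by (auto simp: mem_mnodes)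
  then show ?thesis by (simp add: rlen_def)
qed

lemma clen_mnodes:
  assumes "c \<in> {1..length \<mu>}" "1 \<le> j"
  shows "clen (mnodes \<mu>) c j = conj_part (\<mu> ! (c - 1)) j"
  unfolding clen_def conj_part_def using assms by (intro arg_cong[where f = card]) (auto simp: mem_mnodes)

lemma conj_part_1:
  assumes "is_partition p"
  shows "conj_part p 1 = length p"
proof -
  have "{i. 1 \<le> i \<and> i \<le> length p \<and> 1 \<le> p ! (i - 1)} = {1..length p}"
    using assms by (auto simp: is_partition_def Suc_le_eq)
  then show ?thesis by (simp add: conj_part_def)
qed

definition diagram_parts :: "nat \<Rightarrow> node set \<Rightarrow> nat list list" where
  "diagram_parts m D = map (\<lambda>c. map (rlen D c) [1..<Suc (clen D c 1)]) [1..<Suc m]"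

lemma diagram_parts_mnodes:
  assumes \<mu>: "\<mu> \<in> multipartitions m n"
  shows "diagram_parts m (mnodes \<mu>) = \<mu>"
proof (rule nth_equalityI)
  have l: "length \<mu> = m" using \<mu> by (simp add: multipartitions_def)
  then show "length (diagram_parts m (mnodes \<mu>)) = length \<mu>" by (simp add: diagram_parts_def)
  fix c assume "c < length (diagram_parts m (mnodes \<mu>))"
  then have c: "Suc c \<in> {1..length \<mu>}" "c < m" using l by (auto simp: diagram_parts_def simp del: upt_Suc)
  have len: "clen (mnodes \<mu>) (Suc c) 1 = length (\<mu> ! c)"
    using clen_mnodes[OF c(1), of 1] conj_part_1[OF multipartition_component[OF \<mu> c(1)]] by simp
  have "diagram_parts m (mnodes \<mu>) ! c = map (rlen (mnodes \<mu>) (Suc c)) [1..<Suc (clen (mnodes \<mu>) (Suc c) 1)]"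
    using c(2) by (simp add: diagram_parts_def del: upt_Suc)
  also have "\<dots> = \<mu> ! c"
    unfolding len by (rule nth_equalityI) (use rlen_mnodes[OF c(1)] in \<open>auto simp del: upt_Suc\<close>)
  finally show "diagram_parts m (mnodes \<mu>) ! c = \<mu> ! c" .
qed

lemma mnodes_diagram_parts:
  assumes D: "diagram m D"
  shows "mnodes (diagram_parts m D) = D"
proof -
  have "(i,j,c) \<in> mnodes (diagram_parts m D) \<longleftrightarrow> (i,j,c) \<in> D" for i j c
  proof (cases "c \<in> {1..m}")
    case True
    have "diagram_parts m D ! (c - 1) = map (rlen D c) [1..<Suc (clen D c 1)]" "length (diagram_parts m D) = m"
      using True by (auto simp: diagram_parts_def simp del: upt_Suc)
    then have "(i,j,c) \<in> mnodes (diagram_parts m D) \<longleftrightarrow> i \<in> {1..clen D c 1} \<and> j \<in> {1..rlen D c i}"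
      using True by (auto simp: mem_mnodes simp del: upt_Suc)
    also have "\<dots> \<longleftrightarrow> (i,j,c) \<in> D"
      using mem_iff_row[OF D, of i j c] mem_iff_col[OF D, of i 1 c] diagram_down[OF D, of i j c i 1]
        diagram_pos[OF D, of i j c] by auto
    finally show ?thesis .
  next
    case False
    then show ?thesis using diagram_pos[OF D, of i j c] by (auto simp: mem_mnodes diagram_parts_def)
  qed
  then show ?thesis by auto
qed

lemma diagram_parts_multipartition:
  assumes D: "D \<in> diagrams m n"
  shows "diagram_parts m D \<in> multipartitions m n"
proof -
  have D': "diagram m D" and card: "card D = n" using D by (auto simp: diagrams_def)
  have "is_partition (map (rlen D c) [1..<Suc (clen D c 1)])" for c
    unfolding is_partition_def
  proof
    show "sorted_wrt (\<ge>) (map (rlen D c) [1..<Suc (clen D c 1)])"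
      unfolding sorted_wrt_iff_nth_less using rlen_antimono[OF D'] by (auto simp del: upt_Suc)
    show "\<forall>x\<in>set (map (rlen D c) [1..<Suc (clen D c 1)]). 0 < x"
      using row_col_galois[OF D', of _ 1 c] by (auto simp: Suc_le_eq simp del: upt_Suc)
  qed
  then show ?thesis
    using card_mnodes[of "diagram_parts m D"] mnodes_diagram_parts[OF D'] card
    by (auto simp: multipartitions_def diagram_parts_def simp del: upt_Suc)
qed

lemma bij_mnodes: "bij_betw mnodes (multipartitions m n) (diagrams m n)"
proof (rule bij_betw_byWitness[where f' = "diagram_parts m"])
  show "\<forall>\<mu>\<in>multipartitions m n. diagram_parts m (mnodes \<mu>) = \<mu>" using diagram_parts_mnodes by blast
  show "\<forall>D\<in>diagrams m n. mnodes (diagram_parts m D) = D" using mnodes_diagram_parts by (auto simp: diagrams_def)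
  show "mnodes ` multipartitions m n \<subseteq> diagrams m n"
    using diagram_mnodes card_mnodes by (auto simp: diagrams_def multipartitions_def)
  show "diagram_parts m ` diagrams m n \<subseteq> multipartitions m n" using diagram_parts_multipartition by blast
qed

lemma schur_formula1_eq:
  fixes Q :: "nat \<Rightarrow> 'k::field"
  assumes \<mu>: "\<mu> \<in> multipartitions m n"
  shows "schur_formula1 Q m \<mu> = diagram_schur Q m (mnodes \<mu>)"
proof -
  have l: "length \<mu> = m" using \<mu> by (simp add: multipartitions_def)
  have "diagram_schur Q m (mnodes \<mu>)
      = (\<Prod>x\<in>(SIGMA c:{1..m}. young (\<mu> ! (c - 1))). case x of (c,i,j) \<Rightarrow> \<Prod>t\<in>{1..m}. hook_factor Q (mnodes \<mu>) (i,j,c) t)"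
    unfolding diagram_schur_def
    by (subst (1) mnodes_image, subst prod.reindex[OF inj_mnodes_image]) (simp add: l split_def)
  also have "\<dots> = (\<Prod>c\<in>{1..m}. \<Prod>(i,j)\<in>young (\<mu> ! (c - 1)). \<Prod>t\<in>{1..m}. hook_factor Q (mnodes \<mu>) (i,j,c) t)"
    by (subst prod.Sigma) (auto simp: finite_young split_def)
  also have "\<dots> = schur_formula1 Q m \<mu>"
    unfolding schur_formula1_def
  proof (intro prod.cong refl, clarify)
    fix c i j assume c: "c \<in> {1..m}" and v: "(i,j) \<in> young (\<mu> ! (c - 1))"
    show "(\<Prod>t\<in>{1..m}. hook_factor Q (mnodes \<mu>) (i,j,c) t)
        = (\<Prod>t\<in>{1..m}. of_int (ghook (\<mu> ! (c - 1)) (\<mu> ! (t - 1)) i j) + Q c - Q t)"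
    proof (rule prod.cong[OF refl])
      fix t assume t: "t \<in> {1..m}"
      have "rlen (mnodes \<mu>) c i = \<mu> ! (c - 1) ! (i - 1)" "clen (mnodes \<mu>) t j = conj_part (\<mu> ! (t - 1)) j"
        using rlen_mnodes[of c \<mu> i] clen_mnodes[of t \<mu> j] c t v l by (auto simp: young_def)
      then show "hook_factor Q (mnodes \<mu>) (i,j,c) t = of_int (ghook (\<mu> ! (c - 1)) (\<mu> ! (t - 1)) i j) + Q c - Q t"
        by (simp add: hook_factor_def ghook_def)
    qed
  qed
  finally show ?thesis by simp
qed

section \<open>The bijection between standard tableaux and paths\<close>

definition tableau_path :: "nat list list \<Rightarrow> nat \<Rightarrow> (node \<Rightarrow> nat) \<Rightarrow> node list" where
  "tableau_path \<mu> n T = map (inv_into (mnodes \<mu>) T) [1..<Suc n]"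

lemma std_tableau_mono:
  assumes D: "diagram m (mnodes \<mu>)" and T: "T \<in> std_tableaux \<mu> n"
    and v: "(i,j,c) \<in> mnodes \<mu>" "1 \<le> i'" "i' \<le> i" "1 \<le> j'" "j' \<le> j"
  shows "T (i',j',c) \<le> T (i,j,c)"
proof -
  have row: "T (i,j',c) \<le> T (i,j,c)"
    using v(5,1,4)
  proof (induction rule: dec_induct)
    case (step k)
    have k: "(i,k,c) \<in> mnodes \<mu>" using diagram_down[OF D step.prems(1)] diagram_pos[OF D step.prems(1)] step by auto
    then have "T (i,k,c) < T (i,Suc k,c)" using T step.prems(1) by (auto simp: std_tableaux_def)
    then show ?case using step k by auto
  qed simp
  have ij': "(i,j',c) \<in> mnodes \<mu>" using diagram_down[OF D v(1)] diagram_pos[OF D v(1)] v by auto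
  have "T (i',j',c) \<le> T (i,j',c)"
    using v(3) ij' v(2)
  proof (induction rule: dec_induct)
    case (step k)
    have k: "(k,j',c) \<in> mnodes \<mu>" using diagram_down[OF D step.prems(1)] diagram_pos[OF D step.prems(1)] step by auto
    then have "T (k,j',c) < T (Suc k,j',c)" using T step.prems(1) by (auto simp: std_tableaux_def)
    then show ?case using step k by auto
  qed simp
  then show ?thesis using row by simp
qed

text \<open>The cells with entries up to \<open>k\<close> form a diagram because entries grow to the
  right and downwards. Conversely, the position of a cell in a path serves as its entry.\<close>

lemma bij_tableau_path:
  assumes \<mu>: "\<mu> \<in> multipartitions m n"
  shows "bij_betw (tableau_path \<mu> n) (std_tableaux \<mu> n) (paths m (mnodes \<mu>))"
proof -
  define D where "D = mnodes \<mu>"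
  have D: "diagram m D" "card D = n"
    using diagram_mnodes[OF \<mu>] card_mnodes[of \<mu>] \<mu> by (auto simp: D_def multipartitions_def)
  have bij: "bij_betw T D {1..n}" if "T \<in> std_tableaux \<mu> n" for T
    using that by (simp add: std_tableaux_def D_def)
  have inv: "bij_betw (inv_into D T) {1..n} D" if "T \<in> std_tableaux \<mu> n" for T
    by (rule bij_betw_inv_into[OF bij[OF that]])
  have into: "tableau_path \<mu> n T \<in> paths m D" if T: "T \<in> std_tableaux \<mu> n" for T
  proof -
    have "diagram m (set (take k (tableau_path \<mu> n T)))" for k
    proof -
      have "set (take k (tableau_path \<mu> n T)) = inv_into D T ` {1..min k n}"
      proof -
        have "take k [1..<Suc n] = [1..<Suc (min k n)]"
          by (cases "k \<le> n") (auto simp: take_upt min_def simp del: upt_Suc)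
        then show ?thesis unfolding tableau_path_def D_def[symmetric] take_map
          by (simp add: atLeastLessThanSuc_atLeastAtMost del: upt_Suc)
      qed
      also have "\<dots> = {v \<in> D. T v \<le> k}"
      proof
        show "inv_into D T ` {1..min k n} \<subseteq> {v \<in> D. T v \<le> k}"
          using bij_betw_inv_into_right[OF bij[OF T]] bij_betw_apply[OF inv[OF T]] by auto
        show "{v \<in> D. T v \<le> k} \<subseteq> inv_into D T ` {1..min k n}"
        proof
          fix v assume v: "v \<in> {v \<in> D. T v \<le> k}"
          then have "T v \<in> {1..min k n}" "inv_into D T (T v) = v"
            using bij_betw_apply[OF bij[OF T], of v] bij_betw_inv_into_left[OF bij[OF T], of v] by auto
          then show "v \<in> inv_into D T ` {1..min k n}" by (metis imageI)
        qed
      qed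
      finally have s: "set (take k (tableau_path \<mu> n T)) = {v \<in> D. T v \<le> k}" .
      show ?thesis unfolding s diagram_def
      proof (intro conjI)
        show "finite {v \<in> D. T v \<le> k}" using diagram_finite[OF D(1)] by simp
        show "\<forall>(i, j, c)\<in>{v \<in> D. T v \<le> k}. 1 \<le> i \<and> 1 \<le> j \<and> 1 \<le> c \<and> c \<le> m"
          using diagram_pos[OF D(1)] by auto
        show "\<forall>i j c i' j'. (i, j, c) \<in> {v \<in> D. T v \<le> k} \<longrightarrow> 1 \<le> i' \<longrightarrow> i' \<le> i \<longrightarrow> 1 \<le> j' \<longrightarrow> j' \<le> j
            \<longrightarrow> (i', j', c) \<in> {v \<in> D. T v \<le> k}"
        proof (intro allI impI)
          fix i j c i' j'
          assume h: "(i, j, c) \<in> {v \<in> D. T v \<le> k}" "1 \<le> i'" "i' \<le> i" "1 \<le> j'" "j' \<le> j"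
          then have v: "(i,j,c) \<in> D" "T (i,j,c) \<le> k" by auto
          have "T (i',j',c) \<le> T (i,j,c)"
            using std_tableau_mono[OF D(1)[unfolded D_def] T v(1)[unfolded D_def] h(2-5)] .
          then show "(i', j', c) \<in> {v \<in> D. T v \<le> k}"
            using v diagram_down[OF D(1) v(1) h(2-5)] by simp
        qed
      qed
    qed
    moreover have "distinct (tableau_path \<mu> n T)" "set (tableau_path \<mu> n T) = D"
      using inv[OF T] unfolding tableau_path_def D_def[symmetric] bij_betw_def
      by (auto simp: distinct_map atLeastLessThanSuc_atLeastAtMost simp del: upt_Suc)
    ultimately show ?thesis by (simp add: paths_def)
  qed
  have inj: "inj_on (tableau_path \<mu> n) (std_tableaux \<mu> n)"
  proof (rule inj_onI)
    fix T T' assume T: "T \<in> std_tableaux \<mu> n" "T' \<in> std_tableaux \<mu> n" and eq: "tableau_path \<mu> n T = tableau_path \<mu> n T'"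
    have e: "inv_into D T k = inv_into D T' k" if "k \<in> {1..n}" for k
      using eq that unfolding tableau_path_def D_def[symmetric] by (auto simp del: upt_Suc)
    show "T = T'"
    proof
      fix v show "T v = T' v"
      proof (cases "v \<in> D")
        case True
        then have "T v \<in> {1..n}" using bij_betw_apply[OF bij[OF T(1)]] by simp
        moreover from this have "v = inv_into D T' (T v)"
          using e[of "T v"] bij_betw_inv_into_left[OF bij[OF T(1)] True] by simp
        ultimately show ?thesis using bij_betw_inv_into_right[OF bij[OF T(2)], of "T v"] by simp
      next
        case False
        then show ?thesis using T unfolding std_tableaux_def D_def by (cases v) simp
      qed
    qed
  qed
  have "p \<in> tableau_path \<mu> n ` std_tableaux \<mu> n" if p: "p \<in> paths m D" for p
  proof -
    have lp: "length p = n" using path_length[OF p] D by simp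
    have bp: "bij_betw ((!) p) {..<n} D"
      using p lp unfolding paths_def by (auto intro: bij_betw_nth)
    define ix where "ix = inv_into {..<n} ((!) p)"
    define T where "T v = (if v \<in> D then Suc (ix v) else 0)" for v
    have ix: "ix v < n" "p ! ix v = v" if "v \<in> D" for v
      using that bij_betw_apply[OF bij_betw_inv_into[OF bp]] bij_betw_inv_into_right[OF bp] by (auto simp: ix_def)
    have ix_nth: "ix (p ! k) = k" if "k < n" for k
      using that bij_betw_inv_into_left[OF bp] by (auto simp: ix_def)
    have bT: "bij_betw T D {1..n}"
    proof -
      have "bij_betw (Suc \<circ> ix) D {1..n}"
        by (rule bij_betw_trans[of _ _ "{..<n}"])
          (use bij_betw_inv_into[OF bp] in \<open>auto simp: ix_def bij_betw_def image_Suc_lessThan\<close>)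
      then show ?thesis by (rule iffD1[OF bij_betw_cong, rotated]) (simp add: T_def)
    qed
    \<comment> \<open>The initial segment of the path that ends with \<open>w\<close> is a diagram,
      so it already contains \<open>v\<close>.\<close>
    have lt: "T v < T w" if vw: "v \<in> D" "w \<in> D" "v \<noteq> w"
      and sub: "\<And>E. diagram m E \<Longrightarrow> w \<in> E \<Longrightarrow> v \<in> E" for v w
    proof -
      have "w \<in> set (take (Suc (ix w)) p)" using ix[OF vw(2)] lp by (auto simp: in_set_conv_nth intro!: exI[of _ "ix w"])
      then have "v \<in> set (take (Suc (ix w)) p)" using sub path_take_diagram[OF p] by blast
      then obtain k where "k < Suc (ix w)" "k < n" "p ! k = v" using lp by (auto simp: in_set_conv_nth)
      then have "ix v \<le> ix w" using ix_nth by auto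
      moreover have "ix v \<noteq> ix w" using ix(2)[OF vw(1)] ix(2)[OF vw(2)] vw(3) by metis
      ultimately show ?thesis using vw by (simp add: T_def)
    qed
    have "T \<in> std_tableaux \<mu> n"
      unfolding std_tableaux_def D_def[symmetric]
    proof (safe)
      fix i j c assume h: "(i,j,c) \<in> D" "(i,Suc j,c) \<in> D"
      then show "T (i,j,c) < T (i,Suc j,c)"
        using diagram_pos[OF D(1) h(1)] by (intro lt) (auto intro: diagram_down)
    next
      fix i j c assume h: "(i,j,c) \<in> D" "(Suc i,j,c) \<in> D"
      then show "T (i,j,c) < T (Suc i,j,c)"
        using diagram_pos[OF D(1) h(1)] by (intro lt) (auto intro: diagram_down)
    qed (use bT in \<open>auto simp: T_def\<close>)
    moreover have "tableau_path \<mu> n T = p"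
    proof (rule nth_equalityI)
      show "length (tableau_path \<mu> n T) = length p" using lp by (simp add: tableau_path_def del: upt_Suc)
      fix k assume "k < length (tableau_path \<mu> n T)"
      then have k: "k < n" by (simp add: tableau_path_def del: upt_Suc)
      have pk: "p ! k \<in> D" using bij_betw_apply[OF bp] k by auto
      have "T (p ! k) = Suc k" using pk ix_nth[OF k] by (simp add: T_def)
      then have "inv_into D T (Suc k) = p ! k" using bij_betw_inv_into_left[OF bT pk] by simp
      then show "tableau_path \<mu> n T ! k = p ! k"
        using k by (simp add: tableau_path_def D_def del: upt_Suc)
    qed
    ultimately show ?thesis by blast
  qed
  then have "tableau_path \<mu> n ` std_tableaux \<mu> n = paths m D" using into by blast
  then show ?thesis using inj by (simp add: bij_betw_def D_def)
qed

lemma tab_content_path: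
  assumes "k \<in> {1..n}"
  shows "tab_content Q \<mu> T k = node_content Q (tableau_path \<mu> n T ! (k - 1))"
  using assms by (cases k) (auto simp: tab_content_def tableau_path_def simp del: upt_Suc)

section \<open>The chain of subalgebras\<close>

inductive_set gen_alg :: "('k::field \<Rightarrow> 'a::ring_1) \<Rightarrow> (nat \<Rightarrow> 'a) \<Rightarrow> nat \<Rightarrow> 'a set"
  for of_k s k where
  scalar: "of_k c \<in> gen_alg of_k s k"
| gen: "i < k \<Longrightarrow> s i \<in> gen_alg of_k s k"
| add: "a \<in> gen_alg of_k s k \<Longrightarrow> b \<in> gen_alg of_k s k \<Longrightarrow> a + b \<in> gen_alg of_k s k"
| mult: "a \<in> gen_alg of_k s k \<Longrightarrow> b \<in> gen_alg of_k s k \<Longrightarrow> a * b \<in> gen_alg of_k s k"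

text \<open>\<open>bimod of_k s k b f\<close> is the additive span of \<open>A\<^sub>k x\<^sub>k\<^sub>+\<^sub>1\<^sup>a\<close> for \<open>a < b\<close> and, if \<open>f\<close> holds,
  of \<open>A\<^sub>k s\<^sub>k A\<^sub>k\<close>, where \<open>A\<^sub>k\<close> is the subalgebra generated by \<open>s\<^sub>0, \<dots>, s\<^sub>k\<^sub>-\<^sub>1\<close>.\<close>

inductive_set bimod :: "('k::field \<Rightarrow> 'a::ring_1) \<Rightarrow> (nat \<Rightarrow> 'a) \<Rightarrow> nat \<Rightarrow> nat \<Rightarrow> bool \<Rightarrow> 'a set"
  for of_k s k b f where
  zero: "0 \<in> bimod of_k s k b f"
| power: "z \<in> bimod of_k s k b f \<Longrightarrow> h \<in> gen_alg of_k s k \<Longrightarrow> a < b \<Longrightarrow>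
    z + h * jm s (Suc k) ^ a \<in> bimod of_k s k b f"
| cross: "z \<in> bimod of_k s k b f \<Longrightarrow> f \<Longrightarrow> h \<in> gen_alg of_k s k \<Longrightarrow> h' \<in> gen_alg of_k s k \<Longrightarrow>
    z + h * s k * h' \<in> bimod of_k s k b f"

definition jm_monomial :: "(nat \<Rightarrow> 'a::ring_1) \<Rightarrow> nat list \<Rightarrow> 'a" where
  "jm_monomial s es = prod_list (map (\<lambda>i. jm s (Suc i) ^ (es ! i)) [0..<length es])"

text \<open>A linear span built up by one summand at a time, so that linear statements reduce to a
  single monomial by induction; \<open>bimod\<close> has the same shape.\<close>

inductive_set basis_span :: "('k::field \<Rightarrow> 'a::ring_1) \<Rightarrow> (nat \<Rightarrow> 'a) \<Rightarrow> nat \<Rightarrow> nat \<Rightarrow> 'a set"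
  for of_k s m k where
  zero: "0 \<in> basis_span of_k s m k"
| step: "z \<in> basis_span of_k s m k \<Longrightarrow> length es = k \<Longrightarrow> \<forall>e\<in>set es. e < m \<Longrightarrow> w \<in> sym_part s k \<Longrightarrow>
    z + of_k c * (jm_monomial s es * w) \<in> basis_span of_k s m k"

lemma jm_monomial_snoc: "jm_monomial s (es @ [a]) = jm_monomial s es * jm s (Suc (length es)) ^ a"
proof -
  have "map (\<lambda>i. jm s (Suc i) ^ ((es @ [a]) ! i)) [0..<length es] = map (\<lambda>i. jm s (Suc i) ^ (es ! i)) [0..<length es]"
    by (auto simp: nth_append)
  then show ?thesis by (simp add: jm_monomial_def del: map_eq_conv)
qed

lemma sym_part_one: "1 \<in> sym_part s k"
  unfolding sym_part_def by (rule CollectI, rule exI[of _ "[]"]) simp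

lemma sym_part_mult:
  assumes "a \<in> sym_part s k" "b \<in> sym_part s k"
  shows "a * b \<in> sym_part s k"
proof -
  obtain u v where "a = prod_list (map s u)" "set u \<subseteq> {1..<k}" "b = prod_list (map s v)" "set v \<subseteq> {1..<k}"
    using assms unfolding sym_part_def by blast
  then show ?thesis unfolding sym_part_def by (intro CollectI exI[of _ "u @ v"]) simp
qed

lemma sym_part_gen: "1 \<le> i \<Longrightarrow> i < k \<Longrightarrow> s i \<in> sym_part s k"
  unfolding sym_part_def by (rule CollectI, rule exI[of _ "[i]"]) simp

lemma sym_part_mono: "j \<le> k \<Longrightarrow> sym_part s j \<subseteq> sym_part s k"
  unfolding sym_part_def by fastforce

lemma sym_part_subset_right:
  assumes "1 \<in> S" "\<And>g i. g \<in> S \<Longrightarrow> 1 \<le> i \<Longrightarrow> i < k \<Longrightarrow> g * s i \<in> S"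
  shows "sym_part s k \<subseteq> S"
proof
  fix w assume "w \<in> sym_part s k"
  then obtain u where u: "w = prod_list (map s u)" "set u \<subseteq> {1..<k}" unfolding sym_part_def by blast
  have "set u \<subseteq> {1..<k} \<Longrightarrow> prod_list (map s u) \<in> S"
    by (induction u rule: rev_induct) (use assms in auto)
  then show "w \<in> S" using u by simp
qed

locale hecke =
  fixes of_k :: "'k::field \<Rightarrow> 'a::ring_1" and Q :: "nat \<Rightarrow> 'k" and m n :: nat and s :: "nat \<Rightarrow> 'a"
  assumes m_pos: "1 \<le> m" and n_pos: "1 \<le> n"
    and k_algebra: "is_k_algebra of_k" and relations: "hecke_relations of_k Q m n s"
    and card_sym_part: "card (sym_part s n) = fact n"
begin

abbreviation "alg \<equiv> gen_alg of_k s"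
abbreviation "bim \<equiv> bimod of_k s"
abbreviation "x \<equiv> jm s"

lemmas of_k_add = k_algebra[unfolded is_k_algebra_def, THEN conjunct1, rule_format]
lemmas of_k_mult = k_algebra[unfolded is_k_algebra_def, THEN conjunct2, THEN conjunct1, rule_format]
lemmas of_k_one = k_algebra[unfolded is_k_algebra_def, THEN conjunct2, THEN conjunct2, THEN conjunct1]
lemmas of_k_central = k_algebra[unfolded is_k_algebra_def, THEN conjunct2, THEN conjunct2, THEN conjunct2, rule_format]

lemma of_k_zero: "of_k 0 = 0"
  using of_k_add[of 0 0] by simp

lemma of_k_minus_one: "of_k (-1) = -1"
  using of_k_add[of 1 "-1"] by (simp add: of_k_one of_k_zero eq_neg_iff_add_eq_0 add.commute)

lemmas s_cyclotomic = relations[unfolded hecke_relations_def, THEN conjunct1]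
lemmas s_0_1 = relations[unfolded hecke_relations_def, THEN conjunct2, THEN conjunct1, rule_format]
lemmas s_sq_all = relations[unfolded hecke_relations_def, THEN conjunct2, THEN conjunct2, THEN conjunct1]
lemmas s_braid_all = relations[unfolded hecke_relations_def, THEN conjunct2, THEN conjunct2, THEN conjunct2, THEN conjunct1]
lemmas s_comm_all = relations[unfolded hecke_relations_def, THEN conjunct2, THEN conjunct2, THEN conjunct2, THEN conjunct2]

lemma s_sq: "1 \<le> i \<Longrightarrow> i < n \<Longrightarrow> s i * s i = 1"
  by (rule s_sq_all[rule_format]) (rule conjI)

lemma s_braid: "1 \<le> i \<Longrightarrow> Suc i < n \<Longrightarrow> s i * s (Suc i) * s i = s (Suc i) * s i * s (Suc i)"
  by (rule s_braid_all[rule_format]) (rule conjI)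

lemma s_comm: "i < n \<Longrightarrow> j < n \<Longrightarrow> Suc i < j \<or> Suc j < i \<Longrightarrow> s i * s j = s j * s i"
  by (rule s_comm_all[rule_format]) (intro conjI)

lemma s_sq_left: "1 \<le> i \<Longrightarrow> i < n \<Longrightarrow> s i * (s i * z) = z"
  by (simp add: mult.assoc[symmetric] s_sq)

lemma alg_mono: "j \<le> k \<Longrightarrow> alg j \<subseteq> alg k"
proof
  fix z assume "z \<in> alg j" "j \<le> k"
  then show "z \<in> alg k" by induction (auto intro: gen_alg.intros)
qed

lemma alg_one: "1 \<in> alg k"
  using gen_alg.scalar[of of_k 1] by (simp add: of_k_one)

lemma alg_zero: "0 \<in> alg k"
  using gen_alg.scalar[of of_k 0] by (simp add: of_k_zero)

lemma alg_uminus: "z \<in> alg k \<Longrightarrow> - z \<in> alg k"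
  using gen_alg.mult[OF gen_alg.scalar[of of_k "-1"], of z s k] by (simp add: of_k_minus_one)

lemma alg_power: "z \<in> alg k \<Longrightarrow> z ^ a \<in> alg k"
  by (induction a) (auto intro: gen_alg.mult alg_one)

lemma alg_commute:
  assumes z: "z \<in> alg k" and c: "\<And>i. i < k \<Longrightarrow> y * s i = s i * y"
  shows "y * z = z * y"
  using z
proof induction
  case (scalar c)
  show ?case by (rule of_k_central[symmetric])
next
  case (gen i)
  show ?case by (rule c[OF gen])
next
  case (add a b)
  show ?case by (simp only: distrib_left distrib_right add.IH)
next
  case (mult a b)
  have "y * (a * b) = (y * a) * b" by (simp only: mult.assoc)
  also have "\<dots> = a * (y * b)" by (simp only: mult.IH mult.assoc)
  also have "\<dots> = (a * b) * y" by (simp only: mult.IH mult.assoc)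
  finally show ?case .
qed

lemma jm_Suc: "1 \<le> k \<Longrightarrow> x (Suc k) = s k * x k * s k + s k"
  by (cases k) simp_all

lemma jm_in_alg: "1 \<le> k \<Longrightarrow> x k \<in> alg k"
proof (induction k)
  case (Suc k)
  have sk: "s k \<in> alg (Suc k)" by (rule gen_alg.gen) simp
  show ?case
  proof (cases "k = 0")
    case True
    then show ?thesis using sk by simp
  next
    case False
    then have "x k \<in> alg (Suc k)" using Suc.IH alg_mono[of k "Suc k"] by auto
    then show ?thesis using False jm_Suc[of k] sk by (auto intro: gen_alg.add gen_alg.mult)
  qed
qed simp

lemma jm_s: "1 \<le> k \<Longrightarrow> k < n \<Longrightarrow> x (Suc k) * s k = s k * x k + 1"
  by (simp add: jm_Suc distrib_right mult.assoc s_sq)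

lemma s_jm: "1 \<le> k \<Longrightarrow> k < n \<Longrightarrow> s k * x (Suc k) = x k * s k + 1"
  by (simp add: jm_Suc distrib_left mult.assoc s_sq s_sq_left)

lemma s_commute_alg:
  assumes "z \<in> alg k" "k < i" "i < n"
  shows "s i * z = z * s i"
  by (rule alg_commute[OF assms(1)]) (use assms in \<open>auto intro!: s_comm\<close>)

text \<open>The case \<open>k = Suc i\<close> is the defining relation between \<open>s 0\<close>
  and \<open>s 1\<close> if \<open>i = 0\<close>, and follows from the braid relation otherwise.
  Each further step conjugates by a generator that commutes with \<open>s i\<close>.\<close>

lemma s_jm_commute_lower:
  assumes "Suc i \<le> k" "k < n"
  shows "s i * x (Suc k) = x (Suc k) * s i"
  using assms
proof (induction rule: dec_induct)
  case base
  show ?case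
  proof (cases i)
    case 0
    then show ?thesis using s_0_1 base by simp
  next
    case (Suc i')
    define a b y where "a = s i" and "b = s (Suc i)" and "y = x i"
    have i: "1 \<le> i" "i < n" "Suc i < n" using Suc base by auto
    have aa: "a * a = 1" "b * b = 1" using s_sq i by (auto simp: a_def b_def)
    have br: "a * (b * a) = b * (a * b)" using s_braid[of i] i by (simp add: a_def b_def mult.assoc)
    have bcy: "b * y = y * b" unfolding b_def y_def using s_commute_alg[OF jm_in_alg] i by simp
    have aal: "a * (a * z) = z" "b * (b * z) = z" for z
      using aa by (auto simp: mult.assoc[symmetric])
    have brl: "a * (b * (a * z)) = b * (a * (b * z))" for z
      using arg_cong[OF br, of "\<lambda>t. t * z"] by (simp add: mult.assoc)
    have byl: "b * (y * z) = y * (b * z)" for z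
      using bcy by (simp add: mult.assoc[symmetric])
    have X: "x (Suc (Suc i)) = b * (a * (y * (a * b))) + b * (a * b) + b"
      using i by (simp add: jm_Suc a_def b_def y_def distrib_left distrib_right mult.assoc)
    have "a * x (Suc (Suc i)) = b * (a * (y * (b * (a * b)))) + b * a + a * b"
      unfolding X distrib_left brl byl aal aa by (simp add: mult.assoc)
    moreover have "x (Suc (Suc i)) * a = b * (a * (y * (b * (a * b)))) + b * a + a * b"
      unfolding X distrib_right mult.assoc br[symmetric] aal by (simp add: add_ac br aal aa)
    ultimately show ?thesis unfolding a_def by simp
  qed
next
  case (step k)
  define t y where "t = s (Suc k)" and "y = x (Suc k)"
  have t: "s i * t = t * s i" unfolding t_def using step by (intro s_comm) auto
  have y: "s i * y = y * s i" unfolding y_def using step by simp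
  have "s i * (t * y * t) = t * (s i * y) * t" by (simp add: mult.assoc[symmetric] t)
  also have "\<dots> = t * y * (s i * t)" by (simp add: y mult.assoc)
  also have "\<dots> = t * y * t * s i" by (simp add: t mult.assoc)
  finally have "s i * (t * y * t + t) = (t * y * t + t) * s i" by (simp add: t distrib_left distrib_right)
  then show ?case using jm_Suc[of "Suc k"] by (simp add: t_def y_def)
qed

lemma jm_commute_alg:
  assumes "z \<in> alg k" "k \<le> j" "j < n"
  shows "x (Suc j) * z = z * x (Suc j)"
  by (rule alg_commute[OF assms(1)]) (use assms s_jm_commute_lower in auto)

lemma jm_power_commute_alg:
  assumes "z \<in> alg k" "k \<le> j" "j < n"
  shows "x (Suc j) ^ a * z = z * x (Suc j) ^ a"
  by (rule power_commuting_commutes[OF jm_commute_alg[OF assms]])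

section \<open>Decomposition of each subalgebra over the preceding one\<close>

lemma bim_mono:
  assumes "z \<in> bim k b f" "b \<le> b'" "f \<longrightarrow> f'"
  shows "z \<in> bim k b' f'"
  using assms by induction (auto intro: bimod.intros)

lemma bim_add:
  assumes "w \<in> bim k b f" "z \<in> bim k b f"
  shows "z + w \<in> bim k b f"
  using assms by induction (auto intro: bimod.intros simp: add.assoc[symmetric])

lemma bim_power: "h \<in> alg k \<Longrightarrow> a < b \<Longrightarrow> h * x (Suc k) ^ a \<in> bim k b f"
  using bimod.power[OF bimod.zero] by fastforce

lemma bim_cross: "h \<in> alg k \<Longrightarrow> h' \<in> alg k \<Longrightarrow> h * s k * h' \<in> bim k b True"
  using bimod.cross[OF bimod.zero] by fastforce

lemma bim_left:
  assumes "z \<in> bim k b f" "g \<in> alg k"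
  shows "g * z \<in> bim k b f"
  using assms
proof induction
  case (power z h a)
  then have "g * z + (g * h) * x (Suc k) ^ a \<in> bim k b f" by (intro bimod.power gen_alg.mult) auto
  then show ?case by (simp add: distrib_left mult.assoc)
next
  case (cross z h h')
  then have "g * z + (g * h) * s k * h' \<in> bim k b f" by (intro bimod.cross gen_alg.mult) auto
  then show ?case by (simp add: distrib_left mult.assoc)
qed (simp add: bimod.zero)

lemma bim_right:
  assumes "z \<in> bim k b f" "g \<in> alg k" "k < n"
  shows "z * g \<in> bim k b f"
  using assms
proof induction
  case (power z h a)
  then have "z * g + (h * g) * x (Suc k) ^ a \<in> bim k b f" by (intro bimod.power gen_alg.mult) auto
  then show ?case using jm_power_commute_alg[OF \<open>g \<in> alg k\<close> order.refl \<open>k < n\<close>, of a]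
    by (simp add: distrib_right mult.assoc)
next
  case (cross z h h')
  then have "z * g + h * s k * (h' * g) \<in> bim k b f" by (intro bimod.cross gen_alg.mult) auto
  then show ?case by (simp add: distrib_right mult.assoc)
qed (simp add: bimod.zero)

lemma bim_uminus: "z \<in> bim k b f \<Longrightarrow> - z \<in> bim k b f"
  using bim_left[of z k b f "-1"] alg_uminus[OF alg_one] by simp

lemma bim_low_jm:
  assumes "z \<in> bim k b False"
  shows "z * x (Suc k) \<in> bim k (Suc b) False"
  using assms
proof induction
  case (power z h a)
  then have "z * x (Suc k) + h * x (Suc k) ^ Suc a \<in> bim k (Suc b) False" by (intro bimod.power) auto
  then show ?case by (simp only: distrib_right mult.assoc power_Suc2)
qed (auto intro: bimod.zero)

text \<open>Iterates \<open>s k * x k = x (Suc k) * s k - 1\<close>. The corrections no longer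
  contain \<open>s k\<close> and have exponents of \<open>x (Suc k)\<close> below \<open>a\<close>;
  this degree bound is what the trace computation later relies on.\<close>

lemma s_jm_power_low:
  assumes k: "1 \<le> k" "k < n"
  shows "\<exists>l \<in> bim k a False. s k * x k ^ a = x (Suc k) ^ a * s k + l"
proof (induction a)
  case 0
  then show ?case using bimod.zero by force
next
  case (Suc a)
  then obtain l where l: "l \<in> bim k a False" "s k * x k ^ a = x (Suc k) ^ a * s k + l" by blast
  have xs: "s k * x k = x (Suc k) * s k - 1" using jm_s[OF k] by simp
  have "s k * x k ^ Suc a = (x (Suc k) ^ a * s k + l) * x k" using l by (simp only: power_Suc2 mult.assoc[symmetric])
  also have "\<dots> = x (Suc k) ^ a * (s k * x k) + l * x k" by (simp add: distrib_right mult.assoc)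
  also have "\<dots> = x (Suc k) ^ Suc a * s k + (l * x k + (-1) * x (Suc k) ^ a)"
    unfolding xs by (simp add: right_diff_distrib power_Suc2 mult.assoc del: power_Suc)
  finally have e: "s k * x k ^ Suc a = x (Suc k) ^ Suc a * s k + (l * x k + (-1) * x (Suc k) ^ a)" .
  have "l * x k + (-1) * x (Suc k) ^ a \<in> bim k (Suc a) False"
    using bim_mono[OF bim_right[OF l(1) jm_in_alg[OF k(1)] k(2)]] by (intro bimod.power alg_uminus alg_one) auto
  then show ?case using e by blast
qed

lemma s_jm_Suc_power_low:
  assumes k: "1 \<le> k" "k < n"
  shows "\<exists>l \<in> bim k a False. s k * x (Suc k) ^ a = x k ^ a * s k + l"
proof (induction a)
  case 0
  then show ?case using bimod.zero by force
next
  case (Suc a)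
  then obtain l where l: "l \<in> bim k a False" "s k * x (Suc k) ^ a = x k ^ a * s k + l" by blast
  have "s k * x (Suc k) ^ Suc a = (x k ^ a * s k + l) * x (Suc k)" using l by (simp only: power_Suc2 mult.assoc[symmetric])
  also have "\<dots> = x k ^ a * (s k * x (Suc k)) + l * x (Suc k)" by (simp add: distrib_right mult.assoc)
  also have "\<dots> = x k ^ Suc a * s k + (l * x (Suc k) + x k ^ a * x (Suc k) ^ 0)"
    unfolding s_jm[OF k] by (simp add: distrib_left power_Suc2 mult.assoc add_ac del: power_Suc)
  finally have e: "s k * x (Suc k) ^ Suc a = x k ^ Suc a * s k + (l * x (Suc k) + x k ^ a * x (Suc k) ^ 0)" .
  have "l * x (Suc k) + x k ^ a * x (Suc k) ^ 0 \<in> bim k (Suc a) False"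
    using bim_low_jm[OF l(1)] by (intro bimod.power alg_power jm_in_alg k) auto
  then show ?case using e by blast
qed

text \<open>By \<open>s_jm_power_low\<close>, a power of \<open>x (Suc k)\<close> standing before
  \<open>s k\<close> can be traded for a power of \<open>x k\<close> behind it, which is a cross
  term up to lower powers.\<close>

lemma bim_low_s:
  assumes k: "1 \<le> k" "k < n" and "l \<in> bim k b False" "b \<le> m"
  shows "l * s k \<in> bim k m True"
  using assms(3,4)
proof induction
  case (power z h a)
  obtain l where l: "l \<in> bim k a False" "s k * x k ^ a = x (Suc k) ^ a * s k + l"
    using s_jm_power_low[OF k] by blast
  have e: "(z + h * x (Suc k) ^ a) * s k = z * s k + (h * s k * x k ^ a + - (h * l))"
    using l(2) by (simp add: distrib_right mult.assoc distrib_left)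
  have "- (h * l) \<in> bim k m True"
    using bim_mono[OF l(1)] power by (intro bim_uminus bim_left) auto
  then show ?case unfolding e
    using power by (intro bim_add bim_cross alg_power jm_in_alg k) auto
qed (auto intro: bimod.zero)

lemma alg_0_scalar: "z \<in> alg 0 \<Longrightarrow> \<exists>c. z = of_k c"
proof (induction rule: gen_alg.induct)
  case (add a b)
  then obtain c d where "a = of_k c" "b = of_k d" by blast
  then show ?case by (intro exI[of _ "c + d"]) (simp add: of_k_add)
next
  case (mult a b)
  then obtain c d where "a = of_k c" "b = of_k d" by blast
  then show ?case by (intro exI[of _ "c * d"]) (simp add: of_k_mult)
qed auto

text \<open>\<open>s 0\<close> is \<open>x 1\<close>, and the cyclotomic relation reduces its
  \<open>m\<close>-th power. The span is then closed under left multiplication by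
  \<open>alg 1\<close> and contains 1.\<close>

lemma alg_span_base: "alg 1 \<subseteq> bim 0 m False"
proof -
  have ml: "\<exists>l \<in> bim 0 (length cs) False. prod_list (map (\<lambda>c. s 0 - of_k (Q c)) cs) = x 1 ^ length cs + l" for cs
  proof (induction cs rule: rev_induct)
    case Nil
    then show ?case using bimod.zero by force
  next
    case (snoc c cs)
    then obtain l where l: "l \<in> bim 0 (length cs) False"
      "prod_list (map (\<lambda>c. s 0 - of_k (Q c)) cs) = x 1 ^ length cs + l" by blast
    have q: "- of_k (Q c) \<in> alg 0" by (intro alg_uminus gen_alg.scalar)
    have "prod_list (map (\<lambda>c. s 0 - of_k (Q c)) (cs @ [c])) = (x 1 ^ length cs + l) * (s 0 - of_k (Q c))"
      using l(2) by simp
    also have "\<dots> = (x 1 ^ length cs + l) * x 1 - of_k (Q c) * (x 1 ^ length cs + l)"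
      unfolding of_k_central[of "Q c"] by (simp add: right_diff_distrib)
    also have "\<dots> = x 1 ^ Suc (length cs) + ((l * x (Suc 0) + - of_k (Q c) * l) + - of_k (Q c) * x (Suc 0) ^ length cs)"
      by (simp add: algebra_simps power_Suc2 del: power_Suc)
    finally have "prod_list (map (\<lambda>c. s 0 - of_k (Q c)) (cs @ [c]))
        = x 1 ^ Suc (length cs) + ((l * x (Suc 0) + - of_k (Q c) * l) + - of_k (Q c) * x (Suc 0) ^ length cs)" .
    moreover have "(l * x (Suc 0) + - of_k (Q c) * l) + - of_k (Q c) * x (Suc 0) ^ length cs \<in> bim 0 (Suc (length cs)) False"
      using bim_low_jm[OF l(1)] bim_mono[OF bim_left[OF l(1) q], of "Suc (length cs)" False] q
      by (intro bimod.power bim_add) auto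
    ultimately show ?case by (metis length_append_singleton)
  qed
  obtain l where "l \<in> bim 0 m False" "x 1 ^ m + l = 0" using ml[of "[1..<Suc m]"] s_cyclotomic by (auto simp del: upt_Suc)
  then have xm: "x 1 ^ m \<in> bim 0 m False" using bim_uminus by (metis eq_neg_iff_add_eq_0)
  have s0: "s 0 * z \<in> bim 0 m False" if "z \<in> bim 0 m False" for z
    using that
  proof induction
    case (power z h a)
    obtain c where c: "h = of_k c" using alg_0_scalar power by blast
    have "h * x (Suc 0) ^ Suc a \<in> bim 0 m False"
    proof (cases "Suc a < m")
      case True
      then show ?thesis using power by (intro bim_power)
    next
      case False
      then have "Suc a = m" using power by simp
      then show ?thesis using bim_left[OF xm] power by simp
    qed
    moreover have "s 0 * (z + h * x (Suc 0) ^ a) = s 0 * z + h * x (Suc 0) ^ Suc a"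
      unfolding c using of_k_central[of c "s 0"] by (simp add: distrib_left) (metis mult.assoc)
    ultimately show ?case using power bim_add by metis
  qed (auto intro: bimod.zero)
  have "\<forall>z\<in>bim 0 m False. a * z \<in> bim 0 m False" if "a \<in> alg 1" for a
    using that
  proof induction
    case (scalar c)
    then show ?case by (auto intro: bim_left gen_alg.scalar)
  next
    case (add a b)
    then show ?case by (auto simp: distrib_right intro: bim_add)
  next
    case (mult a b)
    then show ?case by (simp add: mult.assoc)
  qed (use s0 in auto)
  moreover have "1 \<in> bim 0 m False" using bim_power[OF alg_one, of 0 m 0 False] m_pos by simp
  ultimately show ?thesis by force
qed

text \<open>The span contains 1, so closure under left multiplication by the generators suffices.
  Only the new generator needs work, and for it the products \<open>s j * h * s j\<close> with
  \<open>h\<close> in the smaller algebra.\<close>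

lemma alg_span: "k < n \<Longrightarrow> alg (Suc k) \<subseteq> bim k m (1 \<le> k)"
proof (induction k)
  case 0
  then show ?case using alg_span_base by simp
next
  case (Suc k)
  define j where "j = Suc k"
  have j: "1 \<le> j" "j < n" using Suc.prems by (auto simp: j_def)
  have low: "s j * x j ^ a * s j \<in> bim j m True" if "a < m" for a
  proof -
    obtain l where l: "l \<in> bim j a False" "s j * x j ^ a = x (Suc j) ^ a * s j + l"
      using s_jm_power_low[OF j] by blast
    have e: "s j * x j ^ a * s j = 1 * x (Suc j) ^ a + l * s j"
      unfolding l(2) using s_sq[OF j] by (simp add: distrib_right mult.assoc)
    show ?thesis unfolding e using that bim_low_s[OF j l(1)] by (intro bim_add bim_power alg_one) auto
  qed
  \<comment> \<open>\<open>h\<close> is decomposed one level lower. Coefficients from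
    \<open>alg k\<close> commute with \<open>s j\<close>, so only \<open>s j * x j ^ a * s j\<close>
    and, by the braid relation, \<open>s j * s k * s j\<close> remain.\<close>
  have shs: "s j * h * s j \<in> bim j m True" if "h \<in> alg j" for h
  proof -
    have "h \<in> bim k m (1 \<le> k)" using Suc that by (auto simp: j_def)
    then show ?thesis
    proof induction
      case (power z g a)
      have gj: "g \<in> alg j" using alg_mono[of k j] power by (auto simp: j_def)
      have "s j * (z + g * x (Suc k) ^ a) * s j = s j * z * s j + g * (s j * x j ^ a * s j)"
        using s_commute_alg[OF \<open>g \<in> alg k\<close>, of j] j
        by (simp add: distrib_left distrib_right j_def) (metis mult.assoc)
      then show ?case using power low[OF \<open>a < m\<close>] gj by (auto intro: bim_add bim_left)
    next
      case (cross z g g')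
      have gj: "g \<in> alg j" "g' \<in> alg j" using alg_mono[of k j] cross by (auto simp: j_def)
      have c: "s j * g = g * s j" "g' * s j = s j * g'"
        using s_commute_alg[OF \<open>g \<in> alg k\<close>, of j] s_commute_alg[OF \<open>g' \<in> alg k\<close>, of j] j by (auto simp: j_def)
      have b: "s j * s k * s j = s k * s j * s k" using s_braid[of k] cross j by (simp add: j_def)
      have "s j * (g * s k * g') * s j = (s j * g) * s k * (g' * s j)" by (simp add: mult.assoc)
      also have "\<dots> = g * (s j * s k * s j) * g'" unfolding c by (simp add: mult.assoc)
      also have "\<dots> = (g * s k) * s j * (s k * g')" unfolding b by (simp add: mult.assoc)
      finally have e: "s j * (z + g * s k * g') * s j = s j * z * s j + (g * s k) * s j * (s k * g')"
        by (simp add: distrib_left distrib_right)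
      have "(g * s k) * s j * (s k * g') \<in> bim j m True"
        using gj by (intro bim_cross gen_alg.mult gen_alg.gen) (auto simp: j_def)
      then show ?case unfolding e using cross by (intro bim_add) auto
    qed (auto intro: bimod.zero)
  qed
  have sz: "s j * z \<in> bim j m True" if "z \<in> bim j m True" for z
    using that
  proof induction
    case (power z h a)
    obtain l where l: "l \<in> bim j a False" "s j * x (Suc j) ^ a = x j ^ a * s j + l"
      using s_jm_Suc_power_low[OF j] by blast
    have "s j * (h * x (Suc j) ^ a) = (s j * x (Suc j) ^ a) * h"
      using jm_power_commute_alg[OF \<open>h \<in> alg j\<close> order.refl j(2), of a] by (simp add: mult.assoc)
    also have "\<dots> = x j ^ a * s j * h + l * h" unfolding l(2) by (simp add: distrib_right)
    finally have e: "s j * (z + h * x (Suc j) ^ a) = s j * z + (x j ^ a * s j * h + l * h)"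
      by (simp add: distrib_left)
    have "l * h \<in> bim j m True"
      using bim_mono[OF l(1), of m True] power j by (intro bim_right) auto
    then show ?case unfolding e using power
      by (intro bim_add bim_cross alg_power jm_in_alg j) auto
  next
    case (cross z h h')
    have "s j * (z + h * s j * h') = s j * z + (s j * h * s j) * h'" by (simp add: distrib_left mult.assoc)
    then show ?case using cross shs[of h] j by (auto intro!: bim_add bim_right)
  qed (auto intro: bimod.zero)
  have "\<forall>z\<in>bim j m True. a * z \<in> bim j m True" if "a \<in> alg (Suc j)" for a
    using that
  proof induction
    case (scalar c)
    then show ?case by (auto intro: bim_left gen_alg.scalar)
  next
    case (gen i)
    show ?case
    proof (cases "i = j")
      case False
      then have "s i \<in> alg j" using gen by (intro gen_alg.gen) auto
      then show ?thesis using bim_left by blast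
    qed (use sz in blast)
  next
    case (add a b)
    then show ?case by (auto simp: distrib_right intro: bim_add)
  next
    case (mult a b)
    then show ?case by (simp add: mult.assoc)
  qed
  moreover have "1 \<in> bim j m True" using bim_power[OF alg_one, of 0 m j True] m_pos by simp
  ultimately show ?case using j by (force simp: j_def)
qed

section \<open>Normal forms with a group element on the right\<close>

lemma sym_part_alg: "w \<in> sym_part s k \<Longrightarrow> w \<in> alg k"
  using sym_part_subset_right[of "alg k" k s] by (auto intro: alg_one gen_alg.mult gen_alg.gen)

lemma jm_monomial_alg: "length es \<le> k \<Longrightarrow> jm_monomial s es \<in> alg k"
proof (induction es rule: rev_induct)
  case Nil
  then show ?case by (simp add: jm_monomial_def alg_one)
next
  case (snoc a es)
  have "x (Suc (length es)) \<in> alg k" using jm_in_alg[of "Suc (length es)"] alg_mono[of "Suc (length es)" k] snoc.prems by auto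
  then show ?case using snoc unfolding jm_monomial_snoc by (auto intro: gen_alg.mult alg_power)
qed

lemma basis_span_add:
  assumes "w \<in> basis_span of_k s m k" "z \<in> basis_span of_k s m k"
  shows "z + w \<in> basis_span of_k s m k"
  using assms by induction (auto intro: basis_span.intros simp: add.assoc[symmetric])

lemma basis_span_power:
  assumes "h \<in> basis_span of_k s m k" "k < n" "a < m"
  shows "h * x (Suc k) ^ a \<in> basis_span of_k s m (Suc k)"
  using assms(1)
proof induction
  case (step z es w c)
  have "w * x (Suc k) ^ a = x (Suc k) ^ a * w"
    using jm_power_commute_alg[OF sym_part_alg[OF step(4)] order.refl assms(2)] by simp
  then have e: "(z + of_k c * (jm_monomial s es * w)) * x (Suc k) ^ a
      = z * x (Suc k) ^ a + of_k c * (jm_monomial s (es @ [a]) * w)"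
    using step by (simp add: distrib_right mult.assoc jm_monomial_snoc)
  show ?case unfolding e using step assms(3) sym_part_mono[of k "Suc k" s]
    by (intro basis_span.step) auto
qed (simp add: basis_span.zero)

text \<open>The normal form of cross terms on which the trace can be evaluated: powers of
  \<open>x (Suc k)\<close> stand before \<open>s k\<close> and only a group element behind it, up to
  powers of \<open>x (Suc k)\<close> below \<open>m - 1\<close>, which the trace form kills.\<close>

inductive_set cross_span :: "nat \<Rightarrow> 'a set" for k where
  low: "l \<in> bim k (m - 1) False \<Longrightarrow> l \<in> cross_span k"
| step: "z \<in> cross_span k \<Longrightarrow> g \<in> alg k \<Longrightarrow> c < m \<Longrightarrow> w \<in> sym_part s k \<Longrightarrow>
    z + g * (x (Suc k) ^ c * s k * w) \<in> cross_span k"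

lemma cross_span_add:
  assumes "w \<in> cross_span k" "z \<in> cross_span k"
  shows "z + w \<in> cross_span k"
proof -
  have low: "l \<in> bim k (m - 1) False \<Longrightarrow> z + l \<in> cross_span k" for l
    using assms(2)
  proof induction
    case (low l')
    then show ?case by (intro cross_span.low bim_add)
  next
    case (step z g c w)
    have "(z + g * (x (Suc k) ^ c * s k * w)) + l = (z + l) + g * (x (Suc k) ^ c * s k * w)"
      by (simp only: add_ac)
    moreover have "z + l \<in> cross_span k" using step by blast
    ultimately show ?case using step(2-4) cross_span.step by metis
  qed
  show ?thesis using assms(1)
  proof induction
    case (step y g c w)
    have "z + (y + g * (x (Suc k) ^ c * s k * w)) = (z + y) + g * (x (Suc k) ^ c * s k * w)"
      by (simp only: add.assoc)
    then show ?case using step cross_span.step by metis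
  qed (rule low)
qed

text \<open>The monomial of \<open>h'\<close> is carried to the left through \<open>s k\<close>: its
  factors before the last commute with \<open>s k\<close>, and the last, a power of
  \<open>x k\<close>, passes by \<open>s_jm_power_low\<close>.\<close>

lemma cross_in_cross_span:
  assumes k: "1 \<le> k" "k < n" and h: "h \<in> alg k" and h': "h' \<in> basis_span of_k s m k"
  shows "h * s k * h' \<in> cross_span k"
  using h'
proof induction
  case zero
  then show ?case by (simp add: cross_span.low bimod.zero)
next
  case (step z es w c)
  obtain fs a where es: "es = fs @ [a]" using step(2) k by (cases es rule: rev_cases) auto
  have fs: "Suc (length fs) = k" "a < m" using step es by auto
  obtain l where l: "l \<in> bim k a False" "s k * x k ^ a = x (Suc k) ^ a * s k + l"
    using s_jm_power_low[OF k] by blast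
  define M where "M = jm_monomial s fs"
  have Mk: "M \<in> alg (k - 1)" unfolding M_def using fs by (intro jm_monomial_alg) auto
  have M: "M \<in> alg k" using Mk alg_mono[of "k - 1" k] by auto
  have sM: "s k * M = M * s k" using s_commute_alg[OF Mk] k by simp
  define g where "g = h * of_k c * M"
  have g: "g \<in> alg k" unfolding g_def using h M by (intro gen_alg.mult gen_alg.scalar)
  have "s k * (of_k c * (jm_monomial s es * w)) = of_k c * (s k * (M * (x k ^ a * w)))"
    unfolding es jm_monomial_snoc M_def[symmetric] fs(1)
    by (simp only: mult.assoc[symmetric] of_k_central[of c "s k"])
  also have "\<dots> = of_k c * (M * ((s k * x k ^ a) * w))"
    by (simp only: mult.assoc[symmetric] sM)
  also have "\<dots> = of_k c * M * (x (Suc k) ^ a * s k * w) + of_k c * M * (l * w)"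
    unfolding l(2) by (simp only: distrib_left distrib_right mult.assoc)
  finally have e: "h * s k * (z + of_k c * (jm_monomial s es * w))
      = (h * s k * z + g * (l * w)) + g * (x (Suc k) ^ a * s k * w)"
    unfolding g_def by (simp only: mult.assoc distrib_left add_ac)
  \<comment> \<open>The exponent \<open>a\<close> is below \<open>m\<close>, so the corrections have
    exponents below \<open>m - 1\<close>; the power on which \<open>tau\<close> is nonzero cannot
    occur.\<close>
  have "g * (l * w) \<in> bim k (m - 1) False"
    using bim_mono[OF l(1), of "m - 1" False] fs sym_part_alg[OF step(4)] g k
    by (intro bim_left bim_right) auto
  then have "h * s k * z + g * (l * w) \<in> cross_span k"
    using cross_span_add[OF cross_span.low step.IH] by simp
  then show ?case unfolding e using g fs(2) step(4) by (intro cross_span.step)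
qed

text \<open>The trace form is prescribed on basis elements of level \<open>n\<close>. To evaluate it
  on an element of \<open>alg k\<close>, a normal form with \<open>k\<close> exponents and a group
  part from \<open>sym_part s k\<close> is required at every level.\<close>

lemma alg_basis_span: "k \<le> n \<Longrightarrow> h \<in> alg k \<Longrightarrow> h \<in> basis_span of_k s m k"
proof (induction k arbitrary: h)
  case 0
  then obtain c where "h = of_k c" using alg_0_scalar by blast
  then show ?case using basis_span.step[OF basis_span.zero, of "[]" 0 m 1 s of_k c]
    by (simp add: sym_part_one jm_monomial_def)
next
  case (Suc k)
  have low: "l \<in> bim k b False \<Longrightarrow> b \<le> m \<Longrightarrow> l \<in> basis_span of_k s m (Suc k)" for l b
  proof (induction rule: bimod.induct)
    case (power z h a)
    then show ?case using Suc by (intro basis_span_add basis_span_power) auto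
  qed (auto intro: basis_span.zero)
  have cs: "z \<in> cross_span k \<Longrightarrow> 1 \<le> k \<Longrightarrow> z \<in> basis_span of_k s m (Suc k)" for z
  proof (induction rule: cross_span.induct)
    case (low l)
    then show ?case using \<open>\<And>l b. l \<in> bim k b False \<Longrightarrow> b \<le> m \<Longrightarrow> l \<in> basis_span of_k s m (Suc k)\<close>[of l "m - 1"] by simp
  next
    case (step z g c w)
    have w: "s k * w \<in> sym_part s (Suc k)"
      using step sym_part_mono[of k "Suc k" s] by (intro sym_part_mult sym_part_gen) auto
    have "g \<in> basis_span of_k s m k" using Suc step by simp
    then have "g * (x (Suc k) ^ c * s k * w) \<in> basis_span of_k s m (Suc k)"
    proof induction
      case (step y es u d)
      have "u * x (Suc k) ^ c = x (Suc k) ^ c * u"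
        using jm_power_commute_alg[OF sym_part_alg[OF step(4)] order.refl, of c] Suc.prems by simp
      then have "u * (x (Suc k) ^ c * s k * w) = x (Suc k) ^ c * (u * (s k * w))"
        by (simp only: mult.assoc[symmetric])
      then have e: "(y + of_k d * (jm_monomial s es * u)) * (x (Suc k) ^ c * s k * w)
          = y * (x (Suc k) ^ c * s k * w) + of_k d * (jm_monomial s (es @ [c]) * (u * (s k * w)))"
        using step by (simp only: distrib_right mult.assoc jm_monomial_snoc)
      have "u * (s k * w) \<in> sym_part s (Suc k)"
        using step(4) sym_part_mono[of k "Suc k" s] by (intro sym_part_mult[OF _ w]) auto
      then show ?case unfolding e using step \<open>c < m\<close> by (intro basis_span.step) auto
    qed (simp add: basis_span.zero)
    then show ?case using step by (intro basis_span_add) auto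
  qed
  have "h \<in> bim k m (1 \<le> k)" using alg_span[of k] Suc.prems by auto
  then show ?case
  proof induction
    case (power z h a)
    then show ?case using Suc by (intro basis_span_add basis_span_power) auto
  next
    case (cross z h h')
    then have "h * s k * h' \<in> cross_span k" using Suc by (intro cross_in_cross_span) auto
    then show ?case using cross cs by (intro basis_span_add) auto
  qed (rule basis_span.zero)
qed

section \<open>The order of the group generated by the \<open>s i\<close>\<close>

lemma sym_part_double_coset:
  assumes "1 \<le> k" "k < n"
  shows "sym_part s (Suc k) \<subseteq> sym_part s k \<union> {g * s k * g' | g g'. g \<in> sym_part s k \<and> g' \<in> sym_part s k}"
  using assms
proof (induction k rule: nat_induct_at_least)
  case base
  have one: "sym_part s 1 = {1}" unfolding sym_part_def by (auto intro: exI[of _ "[]"])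
  show ?case
  proof (rule sym_part_subset_right)
    fix g i assume "1 \<le> i" "i < Suc 1"
      and g: "g \<in> sym_part s 1 \<union> {g * s 1 * g' | g g'. g \<in> sym_part s 1 \<and> g' \<in> sym_part s 1}"
    then have "i = 1" by simp
    then show "g * s i \<in> sym_part s 1 \<union> {g * s 1 * g' | g g'. g \<in> sym_part s 1 \<and> g' \<in> sym_part s 1}"
      using g s_sq[of 1] base unfolding one by auto
  qed (simp add: sym_part_one)
next
  case (Suc k)
  define G where "G = sym_part s (Suc k)"
  define t where "t = s (Suc k)"
  define S where "S = G \<union> {g * t * g' | g g'. g \<in> G \<and> g' \<in> G}"
  have IH: "G \<subseteq> sym_part s k \<union> {g * s k * g' | g g'. g \<in> sym_part s k \<and> g' \<in> sym_part s k}"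
    unfolding G_def using Suc by simp
  have H: "sym_part s k \<subseteq> G" unfolding G_def by (rule sym_part_mono) simp
  have sk: "s k \<in> G" unfolding G_def using Suc by (intro sym_part_gen) auto
  have GG: "a * b \<in> G" if "a \<in> G" "b \<in> G" for a b using that unfolding G_def by (rule sym_part_mult)
  have tH: "t * u = u * t" if "u \<in> sym_part s k" for u
    unfolding t_def using s_commute_alg[OF sym_part_alg[OF that]] Suc by simp
  have tt: "t * t = 1" unfolding t_def using s_sq Suc by simp
  have br: "t * s k * t = s k * t * s k" unfolding t_def using s_braid[of k] Suc by simp
  have cr: "g * t * g' \<in> S" if "g \<in> G" "g' \<in> G" for g g' using that unfolding S_def by blast
  \<comment> \<open>The only critical product: by the hypothesis one level lower, \<open>g'\<close>
    either commutes with \<open>t\<close> or contains \<open>s k\<close> once, and then the braid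
    relation leaves a single \<open>t\<close>.\<close>
  have tgt: "t * g' * t \<in> S" if gG: "g' \<in> G" for g'
  proof -
    consider "g' \<in> sym_part s k" | u v where "g' = u * s k * v" "u \<in> sym_part s k" "v \<in> sym_part s k"
      using IH gG by blast
    then show ?thesis
    proof cases
      case 1
      then have "t * g' * t = g'" using tH tt by (simp add: mult.assoc)
      then show ?thesis using gG by (simp add: S_def)
    next
      case 2
      have "t * g' * t = (t * u) * s k * (v * t)" unfolding 2 by (simp only: mult.assoc)
      also have "\<dots> = u * (t * s k * t) * v" using tH[OF 2(2)] tH[OF 2(3)] by (simp only: mult.assoc)
      also have "\<dots> = (u * s k) * t * (s k * v)" unfolding br by (simp only: mult.assoc)
      finally show ?thesis using cr GG sk 2 H by (metis subsetD)
    qed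
  qed
  have left: "g * y \<in> S" if gG: "g \<in> G" and yS: "y \<in> S" for g y
  proof (cases "y \<in> G")
    case True
    then show ?thesis using GG[OF gG True] by (simp add: S_def)
  next
    case False
    then obtain a b where "y = a * t * b" "a \<in> G" "b \<in> G" using yS unfolding S_def by blast
    then show ?thesis using cr[of "g * a" b] GG[OF gG] by (simp add: mult.assoc)
  qed
  have "sym_part s (Suc (Suc k)) \<subseteq> S"
  proof (rule sym_part_subset_right)
    show "1 \<in> S" unfolding S_def G_def by (simp add: sym_part_one)
    fix y i assume y: "y \<in> S" and i: "1 \<le> i" "i < Suc (Suc k)"
    show "y * s i \<in> S"
    proof (cases "i = Suc k")
      case True
      have "y * t \<in> S"
      proof (cases "y \<in> G")
        case yG: True
        then show ?thesis using cr[OF yG, of 1] by (simp add: G_def sym_part_one)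
      next
        case False
        then obtain g g' where "y = g * t * g'" "g \<in> G" "g' \<in> G" using y unfolding S_def by blast
        then show ?thesis using left[OF _ tgt, of g g'] by (simp add: mult.assoc)
      qed
      then show ?thesis using True by (simp add: t_def)
    next
      case False
      then have si: "s i \<in> G" unfolding G_def using i by (intro sym_part_gen) auto
      show ?thesis
      proof (cases "y \<in> G")
        case True
        then show ?thesis using GG si by (simp add: S_def)
      next
        case False
        then obtain g g' where "y = g * t * g'" "g \<in> G" "g' \<in> G" using y unfolding S_def by blast
        then show ?thesis using cr[of g "g' * s i"] GG[OF _ si] by (simp add: mult.assoc)
      qed
    qed
  qed
  then show ?case unfolding S_def G_def t_def .
qed

text \<open>Coset representatives are the descending words 1, \<open>s k\<close>,
  \<open>s k * s (k - 1)\<close>, and so on, at most \<open>Suc k\<close> of them. The part of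
  \<open>g'\<close> from the smaller group commutes with the new generator and is absorbed on the
  left.\<close>

lemma sym_part_cosets:
  "k < n \<Longrightarrow> \<exists>C. finite C \<and> card C \<le> Suc k \<and> sym_part s (Suc k) \<subseteq> (\<lambda>(u,c). u * c) ` (sym_part s k \<times> C)"
proof (induction k)
  case 0
  have "sym_part s (Suc 0) = {1}" "1 \<in> sym_part s 0"
    unfolding sym_part_def by (auto intro: exI[of _ "[]"])
  then show ?case by (intro exI[of _ "{1}"]) (auto simp: image_iff)
next
  case (Suc k)
  then obtain C where C: "finite C" "card C \<le> Suc k" "sym_part s (Suc k) \<subseteq> (\<lambda>(u,c). u * c) ` (sym_part s k \<times> C)"
    by auto
  define t where "t = s (Suc k)"
  define C' where "C' = insert 1 ((*) t ` C)"
  have "card C' \<le> Suc (card ((*) t ` C))" unfolding C'_def using C(1) by (simp add: card_insert_if)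
  also have "\<dots> \<le> Suc (Suc k)" using card_image_le[OF C(1), of "(*) t"] C(2) by simp
  finally have card: "card C' \<le> Suc (Suc k)" .
  have "sym_part s (Suc (Suc k)) \<subseteq> (\<lambda>(u,c). u * c) ` (sym_part s (Suc k) \<times> C')"
  proof
    fix y assume "y \<in> sym_part s (Suc (Suc k))"
    then consider "y \<in> sym_part s (Suc k)" | g g' where "y = g * t * g'" "g \<in> sym_part s (Suc k)" "g' \<in> sym_part s (Suc k)"
      using sym_part_double_coset[of "Suc k"] Suc.prems unfolding t_def by fastforce
    then show "y \<in> (\<lambda>(u,c). u * c) ` (sym_part s (Suc k) \<times> C')"
    proof cases
      case 1
      then show ?thesis by (intro image_eqI[of _ _ "(y,1)"]) (auto simp: C'_def)
    next
      case 2
      obtain u c where uc: "g' = u * c" "u \<in> sym_part s k" "c \<in> C" using C(3) 2 by auto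
      have tu: "t * u = u * t" unfolding t_def using s_commute_alg[OF sym_part_alg[OF uc(2)]] Suc.prems by simp
      have "y = g * (t * u) * c" unfolding 2 uc by (simp only: mult.assoc)
      also have "\<dots> = (g * u) * (t * c)" unfolding tu by (simp only: mult.assoc)
      finally have "y = (g * u) * (t * c)" .
      moreover have "g * u \<in> sym_part s (Suc k)"
        using 2 uc sym_part_mono[of k "Suc k" s] by (intro sym_part_mult) auto
      ultimately show ?thesis using uc(3) by (intro image_eqI[of _ _ "(g * u, t * c)"]) (auto simp: C'_def)
    qed
  qed
  then show ?case using C(1) card by (intro exI[of _ C']) (auto simp: C'_def)
qed

lemma sym_part_card_step:
  assumes "k < n" "finite (sym_part s k)"
  shows "finite (sym_part s (Suc k))" "card (sym_part s (Suc k)) \<le> Suc k * card (sym_part s k)"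
proof -
  obtain C where C: "finite C" "card C \<le> Suc k" "sym_part s (Suc k) \<subseteq> (\<lambda>(u,c). u * c) ` (sym_part s k \<times> C)"
    using sym_part_cosets[OF assms(1)] by blast
  have fin: "finite ((\<lambda>(u,c). u * c) ` (sym_part s k \<times> C))" using C assms by simp
  show "finite (sym_part s (Suc k))" using finite_subset[OF C(3) fin] .
  have "card (sym_part s (Suc k)) \<le> card ((\<lambda>(u,c). u * c) ` (sym_part s k \<times> C))" by (rule card_mono[OF fin C(3)])
  also have "\<dots> \<le> card (sym_part s k \<times> C)" using C assms by (intro card_image_le) simp
  also have "\<dots> \<le> Suc k * card (sym_part s k)" using C(2) by (simp add: card_cartesian_product mult.commute del: mult_Suc)
  finally show "card (sym_part s (Suc k)) \<le> Suc k * card (sym_part s k)" .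
qed

lemma sym_part_card_le: "k \<le> n \<Longrightarrow> finite (sym_part s k) \<and> card (sym_part s k) \<le> fact k"
proof (induction k)
  case 0
  have "sym_part s 0 = {1}" unfolding sym_part_def by (auto intro: exI[of _ "[]"])
  then show ?case by simp
next
  case (Suc k)
  then have "card (sym_part s (Suc k)) \<le> Suc k * card (sym_part s k)" "finite (sym_part s (Suc k))"
    using sym_part_card_step[of k] by auto
  moreover have "Suc k * card (sym_part s k) \<le> Suc k * fact k" using Suc by (intro mult_le_mono) auto
  ultimately show ?case by simp
qed

text \<open>Otherwise level \<open>Suc k\<close> would add nothing to the group. The factor
  \<open>Suc k\<close> missing from the upper bound for the order would be missing at all later
  levels, against the order \<open>fact n\<close> at level \<open>n\<close>.\<close>

lemma gen_notin_sym_part: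
  assumes k: "1 \<le> k" "k < n"
  shows "s k \<notin> sym_part s k"
proof
  assume sk: "s k \<in> sym_part s k"
  have "sym_part s (Suc k) \<subseteq> sym_part s k"
  proof (rule sym_part_subset_right[OF sym_part_one])
    fix g i assume g: "g \<in> sym_part s k" and i: "1 \<le> i" "i < Suc k"
    have "s i \<in> sym_part s k"
    proof (cases "i = k")
      case False
      then show ?thesis using i by (intro sym_part_gen) auto
    qed (simp add: sk)
    then show "g * s i \<in> sym_part s k" by (rule sym_part_mult[OF g])
  qed
  then have c0: "card (sym_part s (Suc k)) \<le> fact k"
    using sym_part_card_le[of k] k card_mono by (meson le_trans less_imp_le)
  have "Suc k * card (sym_part s j) \<le> fact j" if "Suc k \<le> j" "j \<le> n" for j
    using that
  proof (induction rule: dec_induct)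
    case base
    show ?case using mult_le_mono2[OF c0, of "Suc k"] by simp
  next
    case (step j)
    have "card (sym_part s (Suc j)) \<le> Suc j * card (sym_part s j)"
      using sym_part_card_step(2)[of j] sym_part_card_le[of j] step by auto
    then have "Suc k * card (sym_part s (Suc j)) \<le> Suc k * (Suc j * card (sym_part s j))" by (rule mult_le_mono2)
    also have "\<dots> = Suc j * (Suc k * card (sym_part s j))" by (simp only: mult.left_commute)
    also have "\<dots> \<le> Suc j * fact j" using step by (intro mult_le_mono2) auto
    finally show ?case by simp
  qed
  from this[of n] have "Suc k * fact n \<le> fact n" using k card_sym_part by simp
  then show False using k fact_gt_zero[of n, where ?'a = nat] by (cases k) auto
qed

lemma sym_part_inverse:
  assumes "w \<in> sym_part s k" "k \<le> n"
  shows "\<exists>v \<in> sym_part s k. w * v = 1 \<and> v * w = 1"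
proof -
  have "sym_part s k \<subseteq> {w \<in> sym_part s k. \<exists>v \<in> sym_part s k. w * v = 1 \<and> v * w = 1}"
  proof (rule sym_part_subset_right)
    show "1 \<in> {w \<in> sym_part s k. \<exists>v \<in> sym_part s k. w * v = 1 \<and> v * w = 1}"
      using sym_part_one[of s k] by auto
    fix g i assume g: "g \<in> {w \<in> sym_part s k. \<exists>v \<in> sym_part s k. w * v = 1 \<and> v * w = 1}" and i: "1 \<le> i" "i < k"
    then obtain v where v: "v \<in> sym_part s k" "g * v = 1" "v * g = 1" by blast
    have si: "s i \<in> sym_part s k" using i by (intro sym_part_gen)
    have ss: "s i * s i = 1" using s_sq i assms by simp
    have "(g * s i) * (s i * v) = g * (s i * s i) * v" "(s i * v) * (g * s i) = s i * (v * g) * s i"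
      by (simp_all only: mult.assoc)
    then have "(g * s i) * (s i * v) = 1" "(s i * v) * (g * s i) = 1" unfolding ss v by (simp_all add: v ss)
    then show "g * s i \<in> {w \<in> sym_part s k. \<exists>v \<in> sym_part s k. w * v = 1 \<and> v * w = 1}"
      using g si v sym_part_mult by blast
  qed
  then show ?thesis using assms by auto
qed

lemma cross_neq_one:
  assumes k: "1 \<le> k" "k < n" and u: "u \<in> sym_part s k" "w \<in> sym_part s k"
  shows "u * (s k * w) \<noteq> 1"
proof
  assume e: "u * (s k * w) = 1"
  obtain u' where u': "u' \<in> sym_part s k" "u' * u = 1" using sym_part_inverse[OF u(1)] k by auto
  obtain w' where w': "w' \<in> sym_part s k" "w * w' = 1" using sym_part_inverse[OF u(2)] k by auto
  have "(u' * u) * s k * (w * w') = u' * (u * (s k * w)) * w'" by (simp only: mult.assoc)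
  then have "s k = u' * w'" unfolding e u' w' by simp
  then show False using gen_notin_sym_part[OF k] sym_part_mult[OF u'(1) w'(1)] by simp
qed

end

section \<open>The trace form and the characters\<close>

lemma prod_list_commute:
  fixes z :: "'a::monoid_mult"
  assumes "\<And>y. y \<in> set ys \<Longrightarrow> y * z = z * y"
  shows "prod_list ys * z = z * prod_list ys"
  using assms
proof (induction ys)
  case (Cons y ys)
  have IH: "prod_list ys * z = z * prod_list ys" using Cons by simp
  have y: "y * z = z * y" using Cons.prems by simp
  have "(y * prod_list ys) * z = (y * z) * prod_list ys" by (simp only: IH mult.assoc)
  also have "\<dots> = z * (y * prod_list ys)" by (simp only: y mult.assoc)
  finally show ?case by simp
qed simp

locale hecke_trace = hecke of_k Q m n s
  for of_k :: "'k::field \<Rightarrow> 'a::ring_1" and Q :: "nat \<Rightarrow> 'k" and m n :: nat and s :: "nat \<Rightarrow> 'a" +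
  fixes tau :: "'a \<Rightarrow> 'k"
  assumes trace_form: "is_trace_form of_k m n s tau"
begin

lemma tau_linear: "tau (of_k c * a + b) = c * tau a + tau b"
  using trace_form by (simp add: is_trace_form_def)

lemma tau_add: "tau (a + b) = tau a + tau b"
  using tau_linear[of 1 a b] by (simp add: of_k_one)

lemma tau_zero: "tau 0 = 0"
  using tau_add[of 0 0] by (metis add.right_neutral add_left_cancel)

lemma tau_scale: "tau (of_k c * a) = c * tau a"
  using tau_linear[of c a 0] by (simp add: tau_zero)

definition top :: "nat \<Rightarrow> 'a" where
  "top k = prod_list (map (\<lambda>i. x (Suc i) ^ (m - 1)) [k..<n])"

lemma top_Suc: "k < n \<Longrightarrow> top k = x (Suc k) ^ (m - 1) * top (Suc k)"
  by (simp add: top_def upt_conv_Cons)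

lemma top_n: "top n = 1"
  by (simp add: top_def)

lemma top_commute: "z \<in> alg k \<Longrightarrow> top k * z = z * top k"
  unfolding top_def by (rule prod_list_commute) (auto intro!: jm_power_commute_alg)

lemma jm_monomial_top:
  assumes "length es = k" "k \<le> n"
  shows "jm_monomial s (es @ replicate (n - k) (m - 1)) = jm_monomial s es * top k"
proof -
  have "map (\<lambda>i. x (Suc i) ^ ((es @ replicate (n - k) (m - 1)) ! i)) [0..<n]
      = map (\<lambda>i. x (Suc i) ^ (es ! i)) [0..<k] @ map (\<lambda>i. x (Suc i) ^ (m - 1)) [k..<n]"
    using assms upt_add_eq_append[of 0 k "n - k"] by (auto simp: nth_append)
  then show ?thesis using assms unfolding jm_monomial_def top_def by (simp del: map_eq_conv)
qed

text \<open>Multiplication by \<open>top k\<close> pads the exponents with \<open>m - 1\<close>,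
  which turns a normal form of level \<open>k\<close> into a basis element of level \<open>n\<close>
  without affecting the test for the value 1.\<close>

lemma tau_monomial:
  assumes es: "length es = k" "\<forall>e\<in>set es. e < m" and w: "w \<in> sym_part s k" and k: "k \<le> n"
  shows "tau (jm_monomial s es * w * top k) = (if es = replicate k (m - 1) \<and> w = 1 then 1 else 0)"
proof -
  define fs where "fs = es @ replicate (n - k) (m - 1)"
  have len: "length fs = n" using es k by (simp add: fs_def)
  have "(fs, w) \<in> basis_index s m n"
    using es w k m_pos sym_part_mono[OF k, of s] len by (auto simp: basis_index_def fs_def)
  moreover have "basis_elt s n (fs, w) = jm_monomial s es * w * top k"
  proof -
    have "basis_elt s n (fs, w) = jm_monomial s fs * w" by (simp add: basis_elt_def jm_monomial_def len)
    also have "\<dots> = jm_monomial s es * (top k * w)"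
      unfolding fs_def jm_monomial_top[OF es(1) k] by (simp add: mult.assoc)
    finally show ?thesis unfolding top_commute[OF sym_part_alg[OF w]] by (simp add: mult.assoc)
  qed
  moreover have "fs = replicate n (m - 1) \<longleftrightarrow> es = replicate k (m - 1)"
  proof -
    have "replicate n (m - 1) = replicate k (m - 1) @ replicate (n - k) (m - 1)"
      using k by (simp add: replicate_add[symmetric])
    then show ?thesis unfolding fs_def using es by simp
  qed
  ultimately show ?thesis using trace_form by (auto simp: is_trace_form_def)
qed

lemma tau_power_low:
  assumes h: "h \<in> alg k" and k: "k < n" and a: "a < m - 1"
  shows "tau (h * x (Suc k) ^ a * top (Suc k)) = 0"
  using alg_basis_span[OF less_imp_le[OF k] h]
proof induction
  case zero
  then show ?case by (simp add: tau_zero)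
next
  case (step z es w c)
  have c: "w * x (Suc k) ^ a = x (Suc k) ^ a * w"
    using jm_power_commute_alg[OF sym_part_alg[OF step(4)] order.refl k] by simp
  have "(z + of_k c * (jm_monomial s es * w)) * x (Suc k) ^ a * top (Suc k)
      = z * x (Suc k) ^ a * top (Suc k) + of_k c * (jm_monomial s es * (w * x (Suc k) ^ a) * top (Suc k))"
    by (simp only: distrib_right mult.assoc)
  also have "jm_monomial s es * (w * x (Suc k) ^ a) * top (Suc k) = jm_monomial s (es @ [a]) * w * top (Suc k)"
    unfolding c jm_monomial_snoc step(2) by (simp only: mult.assoc)
  also have "tau (z * x (Suc k) ^ a * top (Suc k) + of_k c * (jm_monomial s (es @ [a]) * w * top (Suc k))) = 0"
  proof -
    have "es @ [a] \<noteq> replicate (Suc k) (m - 1)" using a step(2) by (simp add: replicate_append_same[symmetric])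
    then have "tau (jm_monomial s (es @ [a]) * w * top (Suc k)) = 0"
      using tau_monomial[of "es @ [a]" "Suc k" w] step a k sym_part_mono[of k "Suc k" s] by auto
    then show ?thesis using step.IH by (simp add: tau_add tau_scale)
  qed
  finally show ?case .
qed

lemma tau_low:
  assumes "l \<in> bim k (m - 1) False" "k < n"
  shows "tau (l * top (Suc k)) = 0"
  using assms
proof induction
  case (power z h a)
  then show ?case using tau_power_low[of h k a] by (simp add: distrib_right tau_add)
qed (simp_all add: tau_zero)

text \<open>In \<open>cross_span\<close> a term either has a power of \<open>x (Suc k)\<close> below
  \<open>m - 1\<close>, or expands into basis elements with group part \<open>u * (s k * w)\<close>,
  which is not 1 by \<open>cross_neq_one\<close>.\<close>

lemma tau_cross:
  assumes k: "1 \<le> k" "k < n" and h: "h \<in> alg k" "h' \<in> alg k"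
  shows "tau (h * s k * h' * top (Suc k)) = 0"
proof -
  have "h * s k * h' \<in> cross_span k"
    using cross_in_cross_span[OF k h(1) alg_basis_span[OF _ h(2)]] k by simp
  then show ?thesis
  proof induction
    case (low l)
    then show ?case using tau_low k by simp
  next
    case (step z g c w)
    have "g \<in> basis_span of_k s m k" using alg_basis_span step k by simp
    then have "tau (g * (x (Suc k) ^ c * s k * w) * top (Suc k)) = 0"
    proof induction
      case zero
      then show ?case by (simp add: tau_zero)
    next
      case (step y es u d)
      have cu: "u * x (Suc k) ^ c = x (Suc k) ^ c * u"
        using jm_power_commute_alg[OF sym_part_alg[OF step(4)] order.refl k(2)] by simp
      have "jm_monomial s es * u * (x (Suc k) ^ c * s k * w) = jm_monomial s es * (u * x (Suc k) ^ c) * (s k * w)"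
        by (simp only: mult.assoc)
      also have "\<dots> = jm_monomial s (es @ [c]) * (u * (s k * w))"
        unfolding cu jm_monomial_snoc step(2) by (simp only: mult.assoc)
      finally have e: "(y + of_k d * (jm_monomial s es * u)) * (x (Suc k) ^ c * s k * w) * top (Suc k)
          = y * (x (Suc k) ^ c * s k * w) * top (Suc k) + of_k d * (jm_monomial s (es @ [c]) * (u * (s k * w)) * top (Suc k))"
        by (simp only: distrib_right mult.assoc)
      have "u * (s k * w) \<in> sym_part s (Suc k)"
      proof (intro sym_part_mult)
        show "u \<in> sym_part s (Suc k)" "w \<in> sym_part s (Suc k)"
          using step(4) \<open>w \<in> sym_part s k\<close> sym_part_mono[of k "Suc k" s] by auto
        show "s k \<in> sym_part s (Suc k)" using k by (intro sym_part_gen) auto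
      qed
      then have "tau (jm_monomial s (es @ [c]) * (u * (s k * w)) * top (Suc k)) = 0"
        using tau_monomial[of "es @ [c]" "Suc k" "u * (s k * w)"] step \<open>c < m\<close> k
          cross_neq_one[OF k step(4) \<open>w \<in> sym_part s k\<close>] by auto
      then show ?case unfolding e using step.IH by (simp add: tau_add tau_scale)
    qed
    then show ?case using step by (simp add: distrib_right tau_add)
  qed
qed

end

text \<open>Matrix entries in an eigenbasis indexed by paths, so that steps of the chain of
  subalgebras are positions in a path. Beyond the algebra structure only the entries of the
  Jucys--Murphy elements are prescribed.\<close>

locale hecke_reps = hecke_trace of_k Q m n s tau + sep: separated_params Q m n
  for of_k :: "'k::field \<Rightarrow> 'a::ring_1" and Q :: "nat \<Rightarrow> 'k" and m n :: nat and s :: "nat \<Rightarrow> 'a"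
    and tau :: "'a \<Rightarrow> 'k" +
  fixes R :: "node set \<Rightarrow> 'a \<Rightarrow> node list \<Rightarrow> node list \<Rightarrow> 'k"
  assumes R_add: "D \<in> diagrams m n \<Longrightarrow> p \<in> paths m D \<Longrightarrow> q \<in> paths m D \<Longrightarrow> R D (a + b) p q = R D a p q + R D b p q"
    and R_scale: "D \<in> diagrams m n \<Longrightarrow> p \<in> paths m D \<Longrightarrow> q \<in> paths m D \<Longrightarrow> R D (of_k c * a) p q = c * R D a p q"
    and R_mult: "D \<in> diagrams m n \<Longrightarrow> p \<in> paths m D \<Longrightarrow> q \<in> paths m D \<Longrightarrow>
      R D (a * b) p q = (\<Sum>r\<in>paths m D. R D a p r * R D b r q)"
    and R_one: "D \<in> diagrams m n \<Longrightarrow> p \<in> paths m D \<Longrightarrow> q \<in> paths m D \<Longrightarrow> R D 1 p q = (if p = q then 1 else 0)"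
    and R_jm: "D \<in> diagrams m n \<Longrightarrow> p \<in> paths m D \<Longrightarrow> q \<in> paths m D \<Longrightarrow> k < n \<Longrightarrow>
      R D (x (Suc k)) p q = (if p = q then node_content Q (p ! k) else 0)"
begin

section \<open>Entries of the generators and of the subalgebras within one module\<close>

context
  fixes D assumes D: "D \<in> diagrams m n"
begin

lemma card_D: "card D = n"
  using D by (simp add: diagrams_def)

lemma R_zero: "p \<in> paths m D \<Longrightarrow> q \<in> paths m D \<Longrightarrow> R D 0 p q = 0"
  using R_scale[OF D, of p q 0 0] by simp

lemma R_jm_right:
  assumes "p \<in> paths m D" "q \<in> paths m D" "k < n"
  shows "R D (a * x (Suc k)) p q = R D a p q * node_content Q (q ! k)"
proof -
  have "R D (a * x (Suc k)) p q = (\<Sum>r\<in>paths m D. if r = q then R D a p q * node_content Q (q ! k) else 0)"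
    unfolding R_mult[OF D assms(1,2)] by (rule sum.cong) (use R_jm[OF D] assms in auto)
  then show ?thesis using assms finite_paths by simp
qed

lemma R_jm_left:
  assumes "p \<in> paths m D" "q \<in> paths m D" "k < n"
  shows "R D (x (Suc k) * a) p q = node_content Q (p ! k) * R D a p q"
proof -
  have "R D (x (Suc k) * a) p q = (\<Sum>r\<in>paths m D. if r = p then node_content Q (p ! k) * R D a p q else 0)"
    unfolding R_mult[OF D assms(1,2)] by (rule sum.cong) (use R_jm[OF D] assms in auto)
  then show ?thesis using assms finite_paths by simp
qed

lemma R_jm_power:
  assumes "p \<in> paths m D" "q \<in> paths m D" "k < n"
  shows "R D (a * x (Suc k) ^ e) p q = R D a p q * node_content Q (q ! k) ^ e"
proof (induction e)
  case (Suc e)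
  have "R D (a * x (Suc k) ^ Suc e) p q = R D (a * x (Suc k) ^ e * x (Suc k)) p q"
    by (simp only: power_Suc2 mult.assoc)
  then show ?case using R_jm_right[OF assms] Suc by simp
qed simp

lemma R_commuting:
  assumes "p \<in> paths m D" "q \<in> paths m D" "k < n" "x (Suc k) * h = h * x (Suc k)" "R D h p q \<noteq> 0"
  shows "node_content Q (p ! k) = node_content Q (q ! k)"
  using R_jm_left[OF assms(1-3), of h] R_jm_right[OF assms(1-3), of h] assms(4,5) by simp

text \<open>\<open>h\<close> commutes with all \<open>x (Suc j)\<close> for j from \<open>k\<close>
  on, so a nonzero entry forces equal contents there, and within one shape these determine the tail.
  Hence \<open>alg k\<close> acts by blocks of paths with a common tail.\<close>

lemma R_alg_tail:
  assumes p: "p \<in> paths m D" "q \<in> paths m D" and h: "h \<in> alg k" "k \<le> n" and nz: "R D h p q \<noteq> 0"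
  shows "drop k p = drop k q"
  by (rule sep.path_drop_unique[OF _ p]) (use R_commuting[OF p] jm_commute_alg[OF h(1)] h nz card_D in auto)

text \<open>The diagonal entry of \<open>x (Suc k) * s k = s k * x k + 1\<close>. Nodes
  \<open>k\<close> and \<open>k + 1\<close> of the path sit at indices \<open>k - 1\<close> and
  \<open>k\<close>. The equation also shows that their contents differ.\<close>

lemma R_gen_diag:
  assumes k: "1 \<le> k" "k < n" and p: "p \<in> paths m D"
  shows "R D (s k) p p * (node_content Q (p ! k) - node_content Q (p ! (k - 1))) = 1"
proof -
  obtain j where j: "k = Suc j" using k by (cases k) auto
  have "R D (x (Suc k) * s k) p p = R D (s k * x k) p p + R D 1 p p"
    unfolding jm_s[OF k] by (rule R_add[OF D p p])
  then show ?thesis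
    using R_jm_left[OF p p k(2), of "s k"] R_jm_right[OF p p, of j "s k"] R_one[OF D p p] k j
    by (simp add: algebra_simps)
qed

text \<open>\<open>s k\<close> commutes with the first \<open>k - 1\<close> Jucys--Murphy elements,
  so a nonzero entry forces the first \<open>k - 1\<close> nodes to agree. With equal tails, only
  one cell is left for the \<open>k\<close>-th node.\<close>

lemma R_gen_offdiag:
  assumes k: "1 \<le> k" "k < n" and p: "p \<in> paths m D" "q \<in> paths m D" and tail: "drop k p = drop k q" and ne: "p \<noteq> q"
  shows "R D (s k) p q = 0"
proof (rule ccontr)
  assume nz: "R D (s k) p q \<noteq> 0"
  have "take (k - 1) p = take (k - 1) q"
  proof (rule sep.path_take_unique[OF _ p])
    fix i assume i: "i < k - 1"
    have "x (Suc i) * s k = s k * x (Suc i)" using s_commute_alg[OF jm_in_alg, of "Suc i" k] i k by auto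
    then show "node_content Q (p ! i) = node_content Q (q ! i)" using R_commuting[OF p] nz i k by auto
  qed (use card_D k in auto)
  moreover have "p ! (k - 1) = q ! (k - 1)"
  proof -
    have "set (take k p) = set (take k q)" using path_set_drop[OF p(1)] path_set_drop[OF p(2)] tail by metis
    then have "insert (p ! (k - 1)) (set (take (k - 1) p)) = insert (q ! (k - 1)) (set (take (k - 1) p))"
      using path_take_Suc(1)[OF p(1), of "k - 1"] path_take_Suc(1)[OF p(2), of "k - 1"] k card_D calculation by simp
    moreover have "p ! (k - 1) \<notin> set (take (k - 1) p)" "q ! (k - 1) \<notin> set (take (k - 1) q)"
      using path_take_Suc(2)[OF p(1), of "k - 1"] path_take_Suc(2)[OF p(2), of "k - 1"] k card_D by auto
    ultimately show ?thesis using \<open>take (k - 1) p = take (k - 1) q\<close> by (metis insert_iff)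
  qed
  moreover have "r = take (k - 1) r @ [r ! (k - 1)] @ drop k r" if "r \<in> paths m D" for r
    using id_take_nth_drop[of "k - 1" r] path_length[OF that] card_D k by simp
  ultimately show False using ne p tail by metis
qed

text \<open>\<open>h1\<close> and \<open>h2\<close> preserve the block \<open>E\<close> of the tail.
  \<open>s k\<close> does not, but both of its indices are confined to \<open>E\<close> by its
  neighbours, and there it is diagonal. Cyclic exchange then brings \<open>h1\<close> behind
  \<open>h2\<close>.\<close>

lemma R_cross_trace:
  assumes k: "1 \<le> k" "k < n" and p1: "p1 \<in> paths m D" and h: "h1 \<in> alg k" "h2 \<in> alg k"
  shows "(\<Sum>p | p \<in> paths m D \<and> drop k p = drop k p1. R D (h1 * s k * h2) p p)
    = (\<Sum>p | p \<in> paths m D \<and> drop k p = drop k p1.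
         R D (h2 * h1) p p / (node_content Q (p ! k) - node_content Q (p ! (k - 1))))"
proof -
  define E where "E = {p. p \<in> paths m D \<and> drop k p = drop k p1}"
  have EP: "E \<subseteq> paths m D" "finite E" using finite_paths[of m D] by (auto simp: E_def)
  have z: "R D h p q = 0" if "h \<in> alg k" "p \<in> paths m D" "q \<in> paths m D" "p \<in> E \<longleftrightarrow> q \<notin> E" for h p q
  proof (rule ccontr)
    assume "R D h p q \<noteq> 0"
    then have "drop k p = drop k q" using R_alg_tail[OF that(2,3,1)] k by simp
    then show False using that by (auto simp: E_def)
  qed
  have rest: "(\<Sum>r\<in>paths m D. R D h p r * f r) = (\<Sum>r\<in>E. R D h p r * f r)" if "h \<in> alg k" "p \<in> E" for h p f
    by (rule sum.mono_neutral_right) (use finite_paths EP z that in auto)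
  have rest2: "(\<Sum>r\<in>paths m D. f r * R D h r p) = (\<Sum>r\<in>E. f r * R D h r p)" if "h \<in> alg k" "p \<in> E" for h p f
    by (rule sum.mono_neutral_right) (use finite_paths EP z that in auto)
  have P: "p \<in> paths m D" if "p \<in> E" for p using that EP by auto
  have tr: "R D (h1 * s k * h2) p p = (\<Sum>q\<in>E. \<Sum>q'\<in>E. R D h1 p q * R D (s k) q q' * R D h2 q' p)" if p: "p \<in> E" for p
  proof -
    have "R D (h1 * s k * h2) p p = (\<Sum>q\<in>paths m D. R D h1 p q * R D (s k * h2) q p)"
      unfolding mult.assoc using R_mult[OF D P[OF p] P[OF p]] .
    also have "\<dots> = (\<Sum>q\<in>E. R D h1 p q * R D (s k * h2) q p)" by (rule rest[OF h(1) p])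
    also have "\<dots> = (\<Sum>q\<in>E. R D h1 p q * (\<Sum>q'\<in>E. R D (s k) q q' * R D h2 q' p))"
      using R_mult[OF D P P[OF p]] rest2[OF h(2) p] by (intro sum.cong) auto
    finally show ?thesis by (simp add: sum_distrib_left mult.assoc)
  qed
  have "(\<Sum>p\<in>E. R D (h1 * s k * h2) p p) = (\<Sum>p\<in>E. \<Sum>q\<in>E. \<Sum>q'\<in>E. R D h1 p q * R D (s k) q q' * R D h2 q' p)"
    by (rule sum.cong) (auto simp: tr)
  also have "\<dots> = (\<Sum>q\<in>E. \<Sum>p\<in>E. \<Sum>q'\<in>E. R D h1 p q * R D (s k) q q' * R D h2 q' p)" by (rule sum.swap)
  also have "\<dots> = (\<Sum>q\<in>E. \<Sum>q'\<in>E. \<Sum>p\<in>E. R D h1 p q * R D (s k) q q' * R D h2 q' p)"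
    by (intro sum.cong refl sum.swap)
  also have "\<dots> = (\<Sum>q\<in>E. \<Sum>q'\<in>E. R D (s k) q q' * R D (h2 * h1) q' q)"
  proof (intro sum.cong refl)
    fix q q' assume q: "q \<in> E" "q' \<in> E"
    have "R D (h2 * h1) q' q = (\<Sum>p\<in>E. R D h2 q' p * R D h1 p q)"
      using R_mult[OF D P[OF q(2)] P[OF q(1)]] rest[OF h(2) q(2)] by simp
    then show "(\<Sum>p\<in>E. R D h1 p q * R D (s k) q q' * R D h2 q' p) = R D (s k) q q' * R D (h2 * h1) q' q"
      by (simp add: sum_distrib_left mult_ac)
  qed
  also have "\<dots> = (\<Sum>q\<in>E. \<Sum>q'\<in>E. if q' = q then R D (s k) q q * R D (h2 * h1) q q else 0)"
  proof (intro sum.cong refl)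
    fix q q' assume q: "q \<in> E" "q' \<in> E"
    show "R D (s k) q q' * R D (h2 * h1) q' q = (if q' = q then R D (s k) q q * R D (h2 * h1) q q else 0)"
      using R_gen_offdiag[OF k P[OF q(1)] P[OF q(2)]] q by (auto simp: E_def)
  qed
  also have "\<dots> = (\<Sum>q\<in>E. R D (s k) q q * R D (h2 * h1) q q)" using EP by simp
  also have "\<dots> = (\<Sum>q\<in>E. R D (h2 * h1) q q / (node_content Q (q ! k) - node_content Q (q ! (k - 1))))"
  proof (intro sum.cong refl)
    fix q assume q: "q \<in> E"
    have "R D (s k) q q * (node_content Q (q ! k) - node_content Q (q ! (k - 1))) = 1" by (rule R_gen_diag[OF k P[OF q]])
    then show "R D (s k) q q * R D (h2 * h1) q q = R D (h2 * h1) q q / (node_content Q (q ! k) - node_content Q (q ! (k - 1)))"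
      by (metis divide_inverse inverse_unique mult.commute)
  qed
  finally show ?thesis by (simp add: E_def)
qed

end

text \<open>The sums of the diagonal entries of \<open>h \<in> A\<^sub>k\<close> over the paths with fixed tail from step \<open>k\<close> on and
  fixed \<open>k\<close>-th node depend only on that node and on the diagram reached after \<open>k\<close> steps.\<close>

definition partial_characters :: "nat \<Rightarrow> 'a \<Rightarrow> (node set \<Rightarrow> node \<Rightarrow> 'k) \<Rightarrow> bool" where
  "partial_characters k h \<chi> \<longleftrightarrow> (\<forall>D\<in>diagrams m n. \<forall>p0\<in>paths m D. \<forall>r\<in>removable m (set (take k p0)).
     (\<Sum>p | p \<in> paths m D \<and> drop k p = drop k p0 \<and> p ! (k - 1) = r. R D h p p) = \<chi> (set (take k p0)) r)"

lemmas partial_charactersD = partial_characters_def[THEN iffD1, rule_format]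

text \<open>The claim at level \<open>k\<close> for one element; it is additive, which fits the
  induction over \<open>bimod\<close>. The partial characters are existentially quantified, since
  only their dependence on diagram and node matters.\<close>

definition schur_at :: "nat \<Rightarrow> 'a \<Rightarrow> bool" where
  "schur_at k h \<longleftrightarrow> (\<exists>\<chi>. partial_characters k h \<chi>
     \<and> tau (h * top k) = (\<Sum>\<nu>\<in>diagrams m k. (\<Sum>r\<in>removable m \<nu>. \<chi> \<nu> r) / diagram_schur Q m \<nu>))"

section \<open>Induction along the chain of subalgebras\<close>

lemma schur_at_zero: "schur_at k 0"
  unfolding schur_at_def partial_characters_def by (rule exI[of _ "\<lambda>_ _. 0"]) (auto simp: R_zero tau_zero intro!: sum.neutral)

lemma schur_at_add:
  assumes "schur_at k a" "schur_at k b"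
  shows "schur_at k (a + b)"
proof -
  obtain \<chi> where \<chi>: "partial_characters k a \<chi>"
     "tau (a * top k) = (\<Sum>\<nu>\<in>diagrams m k. (\<Sum>r\<in>removable m \<nu>. \<chi> \<nu> r) / diagram_schur Q m \<nu>)"
    using assms(1) unfolding schur_at_def by blast
  obtain \<psi> where \<psi>: "partial_characters k b \<psi>"
     "tau (b * top k) = (\<Sum>\<nu>\<in>diagrams m k. (\<Sum>r\<in>removable m \<nu>. \<psi> \<nu> r) / diagram_schur Q m \<nu>)"
    using assms(2) unfolding schur_at_def by blast
  show ?thesis
    unfolding schur_at_def partial_characters_def
  proof (intro exI[of _ "\<lambda>\<nu> r. \<chi> \<nu> r + \<psi> \<nu> r"] conjI ballI)
    fix D p0 r assume h: "D \<in> diagrams m n" "p0 \<in> paths m D" "r \<in> removable m (set (take k p0))"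
    show "(\<Sum>p | p \<in> paths m D \<and> drop k p = drop k p0 \<and> p ! (k - 1) = r. R D (a + b) p p)
        = \<chi> (set (take k p0)) r + \<psi> (set (take k p0)) r"
      unfolding partial_charactersD[OF \<chi>(1) h, symmetric] partial_charactersD[OF \<psi>(1) h, symmetric] sum.distrib[symmetric]
      by (rule sum.cong) (auto simp: R_add[OF h(1)])
  next
    show "tau ((a + b) * top k) = (\<Sum>\<nu>\<in>diagrams m k. (\<Sum>r\<in>removable m \<nu>. \<chi> \<nu> r + \<psi> \<nu> r) / diagram_schur Q m \<nu>)"
      by (simp add: distrib_right tau_add \<chi>(2) \<psi>(2) sum.distrib add_divide_distrib)
  qed
qed

text \<open>Level 1 is done directly, since the empty path has no last node by which to split. The
  trace value is \<open>sum_addable_content_power\<close> at the empty diagram, whose hook product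
  is 1.\<close>

lemma schur_at_power_base:
  assumes a: "a < m"
  shows "schur_at 1 (of_k c * x 1 ^ a)"
  unfolding schur_at_def partial_characters_def
proof (intro exI[of _ "\<lambda>\<nu> r. c * node_content Q r ^ a"] conjI ballI)
  fix D p0 r assume D: "D \<in> diagrams m n" and p0: "p0 \<in> paths m D" and r: "r \<in> removable m (set (take 1 p0))"
  have len: "length p = n" if "p \<in> paths m D" for p using path_length[OF that] card_D[OF D] by simp
  have split: "p = p ! 0 # drop 1 p" if "p \<in> paths m D" for p
    using len[OF that] n_pos by (cases p) auto
  have "r = p0 ! 0" using r split[OF p0] len[OF p0] n_pos by (cases p0) (auto simp: removable_def)
  then have "{p. p \<in> paths m D \<and> drop 1 p = drop 1 p0 \<and> p ! (1 - 1) = r} = {p0}"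
    using split p0 by (auto, metis)
  then show "(\<Sum>p | p \<in> paths m D \<and> drop 1 p = drop 1 p0 \<and> p ! (1 - 1) = r. R D (of_k c * x 1 ^ a) p p)
      = c * node_content Q r ^ a"
    using R_scale[OF D p0 p0, of c "x 1 ^ a"] R_jm_power[OF D p0 p0, of 0 1 a] R_one[OF D p0 p0] n_pos \<open>r = p0 ! 0\<close>
    by simp
next
  have "tau (of_k c * x 1 ^ a * top 1) = (if a = m - 1 then c else 0)"
  proof -
    have "tau (jm_monomial s [a] * 1 * top 1) = (if a = m - 1 then 1 else 0)"
      using tau_monomial[of "[a]" 1 1] a n_pos by (auto simp: sym_part_one)
    moreover have "jm_monomial s [a] = x 1 ^ a" by (simp add: jm_monomial_def)
    ultimately show ?thesis by (simp add: mult.assoc tau_scale)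
  qed
  also have "\<dots> = (\<Sum>\<nu>\<in>diagrams m 0. \<Sum>y\<in>addable m \<nu>. c * node_content Q y ^ a / diagram_schur Q m (insert y \<nu>))"
  proof -
    have d: "diagram m {}" by (simp add: diagram_def)
    then have "diagrams m 0 = {{}}" by (auto simp: diagrams_def dest: diagram_finite)
    then show ?thesis
      using sep.sum_addable_content_power[OF d _ a] n_pos
      by (simp add: sum_distrib_left[symmetric] times_divide_eq_right[symmetric] diagram_schur_def[of Q m "{}"]
          del: times_divide_eq_right)
  qed
  also have "\<dots> = (\<Sum>\<mu>\<in>diagrams m (Suc 0). \<Sum>y\<in>removable m \<mu>. c * node_content Q y ^ a / diagram_schur Q m (insert y (\<mu> - {y})))"
    by (rule sum_removable_eq_sum_addable[symmetric])
  also have "\<dots> = (\<Sum>\<nu>\<in>diagrams m 1. (\<Sum>r\<in>removable m \<nu>. c * node_content Q r ^ a) / diagram_schur Q m \<nu>)"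
    unfolding One_nat_def sum_divide_distrib by (intro sum.cong refl) (auto simp: removable_def insert_absorb)
  finally show "tau (of_k c * x 1 ^ a * top 1)
      = (\<Sum>\<nu>\<in>diagrams m 1. (\<Sum>r\<in>removable m \<nu>. c * node_content Q r ^ a) / diagram_schur Q m \<nu>)" .
qed

lemma sum_next_diagrams:
  "(\<Sum>\<mu>\<in>diagrams m (Suc k). (\<Sum>y\<in>removable m \<mu>. \<Sum>r\<in>removable m (\<mu> - {y}). \<chi> (\<mu> - {y}) r * w r y) / diagram_schur Q m \<mu>)
    = (\<Sum>\<nu>\<in>diagrams m k. \<Sum>r\<in>removable m \<nu>. \<chi> \<nu> r * (\<Sum>y\<in>addable m \<nu>. w r y / diagram_schur Q m (insert y \<nu>)))"
proof -
  have "(\<Sum>\<mu>\<in>diagrams m (Suc k). (\<Sum>y\<in>removable m \<mu>. \<Sum>r\<in>removable m (\<mu> - {y}). \<chi> (\<mu> - {y}) r * w r y) / diagram_schur Q m \<mu>)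
      = (\<Sum>\<mu>\<in>diagrams m (Suc k). \<Sum>y\<in>removable m \<mu>.
          (\<Sum>r\<in>removable m (\<mu> - {y}). \<chi> (\<mu> - {y}) r * w r y) / diagram_schur Q m (insert y (\<mu> - {y})))"
    unfolding sum_divide_distrib[of _ "removable m _"] by (intro sum.cong refl) (auto simp: removable_def insert_absorb)
  also have "\<dots> = (\<Sum>\<nu>\<in>diagrams m k. \<Sum>y\<in>addable m \<nu>. (\<Sum>r\<in>removable m \<nu>. \<chi> \<nu> r * w r y) / diagram_schur Q m (insert y \<nu>))"
    by (rule sum_removable_eq_sum_addable)
  also have "\<dots> = (\<Sum>\<nu>\<in>diagrams m k. \<Sum>y\<in>addable m \<nu>. \<Sum>r\<in>removable m \<nu>. \<chi> \<nu> r * (w r y / diagram_schur Q m (insert y \<nu>)))"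
    by (simp add: sum_divide_distrib)
  also have "\<dots> = (\<Sum>\<nu>\<in>diagrams m k. \<Sum>r\<in>removable m \<nu>. \<Sum>y\<in>addable m \<nu>. \<chi> \<nu> r * (w r y / diagram_schur Q m (insert y \<nu>)))"
    by (intro sum.cong refl sum.swap)
  finally show ?thesis by (simp add: sum_distrib_left)
qed

text \<open>The inductive step for both kinds of summands. \<open>w r y\<close> is the factor that
  passes from \<open>h\<close> to \<open>g\<close> on paths whose nodes \<open>k\<close> and
  \<open>k + 1\<close> are \<open>r\<close> and \<open>y\<close>: a power of a content, or an
  inverse difference of contents.\<close>

lemma schur_at_step:
  assumes k: "1 \<le> k" "k < n" and good: "schur_at k h"
    and entries: "\<And>D p1. D \<in> diagrams m n \<Longrightarrow> p1 \<in> paths m D \<Longrightarrow>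
      (\<Sum>p | p \<in> paths m D \<and> drop k p = drop k p1. R D g p p)
        = (\<Sum>p | p \<in> paths m D \<and> drop k p = drop k p1. R D h p p * w (p ! (k - 1)) (p ! k))"
    and trace: "\<And>\<chi>. tau (h * top k) = (\<Sum>\<nu>\<in>diagrams m k. (\<Sum>r\<in>removable m \<nu>. \<chi> \<nu> r) / diagram_schur Q m \<nu>) \<Longrightarrow>
      tau (g * top (Suc k)) = (\<Sum>\<nu>\<in>diagrams m k. \<Sum>r\<in>removable m \<nu>.
         \<chi> \<nu> r * (\<Sum>y\<in>addable m \<nu>. w r y / diagram_schur Q m (insert y \<nu>)))"
  shows "schur_at (Suc k) g"
proof -
  obtain \<chi> where \<chi>: "partial_characters k h \<chi>"
     "tau (h * top k) = (\<Sum>\<nu>\<in>diagrams m k. (\<Sum>r\<in>removable m \<nu>. \<chi> \<nu> r) / diagram_schur Q m \<nu>)"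
    using good unfolding schur_at_def by blast
  show ?thesis
    unfolding schur_at_def partial_characters_def
  proof (intro exI[of _ "\<lambda>\<mu> y. \<Sum>r\<in>removable m (\<mu> - {y}). \<chi> (\<mu> - {y}) r * w r y"] conjI ballI)
    fix D p0 y assume D: "D \<in> diagrams m n" and p0: "p0 \<in> paths m D" and y: "y \<in> removable m (set (take (Suc k) p0))"
    have kD: "k < card D" using card_D[OF D] k by simp
    obtain p1 where p1: "p1 \<in> paths m D" "set (take k p1) = set (take (Suc k) p0) - {y}" "p1 ! k = y"
      "{p \<in> paths m D. drop (Suc k) p = drop (Suc k) p0 \<and> p ! k = y} = {p \<in> paths m D. drop k p = drop k p1}"
      using path_fiber[OF p0 kD y] by blast
    have pk: "p ! k = y" if "p \<in> paths m D" "drop k p = drop k p1" for p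
      using p1(4) that by blast
    have "(\<Sum>p | p \<in> paths m D \<and> drop (Suc k) p = drop (Suc k) p0 \<and> p ! (Suc k - 1) = y. R D g p p)
        = (\<Sum>p | p \<in> paths m D \<and> drop k p = drop k p1. R D g p p)"
      using p1(4) by (intro sum.cong) auto
    also have "\<dots> = (\<Sum>p | p \<in> paths m D \<and> drop k p = drop k p1. R D h p p * w (p ! (k - 1)) (p ! k))"
      by (rule entries[OF D p1(1)])
    also have "\<dots> = (\<Sum>r\<in>removable m (set (take k p1)).
        \<Sum>p | p \<in> paths m D \<and> drop k p = drop k p1 \<and> p ! (k - 1) = r. R D h p p * w (p ! (k - 1)) (p ! k))"
      by (rule sum_paths_by_last[OF p1(1) k(1)]) (use kD in simp)
    also have "\<dots> = (\<Sum>r\<in>removable m (set (take k p1)). \<chi> (set (take k p1)) r * w r y)"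
    proof (rule sum.cong[OF refl])
      fix r assume r: "r \<in> removable m (set (take k p1))"
      show "(\<Sum>p | p \<in> paths m D \<and> drop k p = drop k p1 \<and> p ! (k - 1) = r. R D h p p * w (p ! (k - 1)) (p ! k))
          = \<chi> (set (take k p1)) r * w r y"
        unfolding partial_charactersD[OF \<chi>(1) D p1(1) r, symmetric] sum_distrib_right by (rule sum.cong) (auto simp: pk)
    qed
    finally show "(\<Sum>p | p \<in> paths m D \<and> drop (Suc k) p = drop (Suc k) p0 \<and> p ! (Suc k - 1) = y. R D g p p)
        = (\<Sum>r\<in>removable m (set (take (Suc k) p0) - {y}). \<chi> (set (take (Suc k) p0) - {y}) r * w r y)"
      unfolding p1(2) .
  next
    show "tau (g * top (Suc k)) = (\<Sum>\<mu>\<in>diagrams m (Suc k).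
        (\<Sum>y\<in>removable m \<mu>. \<Sum>r\<in>removable m (\<mu> - {y}). \<chi> (\<mu> - {y}) r * w r y) / diagram_schur Q m \<mu>)"
      unfolding sum_next_diagrams by (rule trace[OF \<chi>(2)])
  qed
qed

lemma schur_at_power:
  assumes k: "1 \<le> k" "k < n" and h: "h \<in> alg k" "schur_at k h" and a: "a < m"
  shows "schur_at (Suc k) (h * x (Suc k) ^ a)"
proof (rule schur_at_step[OF k h(2), where w = "\<lambda>r y. node_content Q y ^ a"])
  fix D p1 assume D: "D \<in> diagrams m n" and p1: "p1 \<in> paths m D"
  show "(\<Sum>p | p \<in> paths m D \<and> drop k p = drop k p1. R D (h * x (Suc k) ^ a) p p)
      = (\<Sum>p | p \<in> paths m D \<and> drop k p = drop k p1. R D h p p * node_content Q (p ! k) ^ a)"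
    by (rule sum.cong) (use R_jm_power[OF D _ _ k(2)] in auto)
next
  fix \<chi> :: "node set \<Rightarrow> node \<Rightarrow> 'k"
  assume \<chi>: "tau (h * top k) = (\<Sum>\<nu>\<in>diagrams m k. (\<Sum>r\<in>removable m \<nu>. \<chi> \<nu> r) / diagram_schur Q m \<nu>)"
  have "(\<Sum>\<nu>\<in>diagrams m k. \<Sum>r\<in>removable m \<nu>. \<chi> \<nu> r * (\<Sum>y\<in>addable m \<nu>. node_content Q y ^ a / diagram_schur Q m (insert y \<nu>)))
      = (\<Sum>\<nu>\<in>diagrams m k. \<Sum>r\<in>removable m \<nu>. \<chi> \<nu> r * ((if a = m - 1 then 1 else 0) / diagram_schur Q m \<nu>))"
    by (intro sum.cong refl) (use sep.sum_addable_content_power[OF _ _ a] k in \<open>auto simp: diagrams_def\<close>)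
  also have "\<dots> = (if a = m - 1 then 1 else 0) * tau (h * top k)"
    unfolding \<chi> by (simp add: sum_divide_distrib)
  also have "\<dots> = tau (h * x (Suc k) ^ a * top (Suc k))"
  proof (cases "a = m - 1")
    case True
    then show ?thesis by (simp add: top_Suc[OF k(2)] mult.assoc)
  next
    case False
    then show ?thesis using tau_power_low[OF h(1) k(2), of a] a by simp
  qed
  finally show "tau (h * x (Suc k) ^ a * top (Suc k)) = (\<Sum>\<nu>\<in>diagrams m k. \<Sum>r\<in>removable m \<nu>.
      \<chi> \<nu> r * (\<Sum>y\<in>addable m \<nu>. node_content Q y ^ a / diagram_schur Q m (insert y \<nu>)))" by simp
qed

lemma schur_at_cross:
  assumes k: "1 \<le> k" "k < n" and h: "h1 \<in> alg k" "h2 \<in> alg k" and good: "schur_at k (h2 * h1)"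
  shows "schur_at (Suc k) (h1 * s k * h2)"
proof (rule schur_at_step[OF k good, where w = "\<lambda>r y. 1 / (node_content Q y - node_content Q r)"])
  fix D p1 assume "D \<in> diagrams m n" "p1 \<in> paths m D"
  then show "(\<Sum>p | p \<in> paths m D \<and> drop k p = drop k p1. R D (h1 * s k * h2) p p)
      = (\<Sum>p | p \<in> paths m D \<and> drop k p = drop k p1.
          R D (h2 * h1) p p * (1 / (node_content Q (p ! k) - node_content Q (p ! (k - 1)))))"
    using R_cross_trace[OF _ k _ h] by simp
next
  fix \<chi> :: "node set \<Rightarrow> node \<Rightarrow> 'k"
  have "(\<Sum>\<nu>\<in>diagrams m k. \<Sum>r\<in>removable m \<nu>. \<chi> \<nu> r * (\<Sum>y\<in>addable m \<nu>.
      1 / (node_content Q y - node_content Q r) / diagram_schur Q m (insert y \<nu>))) = 0"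
  proof (intro sum.neutral ballI)
    fix \<nu> r assume "\<nu> \<in> diagrams m k" and r: "r \<in> removable m \<nu>"
    then have "diagram m \<nu>" "card \<nu> < n" using k by (auto simp: diagrams_def)
    from sep.sum_addable_content_inverse[OF this r]
    show "\<chi> \<nu> r * (\<Sum>y\<in>addable m \<nu>. 1 / (node_content Q y - node_content Q r) / diagram_schur Q m (insert y \<nu>)) = 0"
      by simp
  qed
  then show "tau (h1 * s k * h2 * top (Suc k)) = (\<Sum>\<nu>\<in>diagrams m k. \<Sum>r\<in>removable m \<nu>. \<chi> \<nu> r * (\<Sum>y\<in>addable m \<nu>.
      1 / (node_content Q y - node_content Q r) / diagram_schur Q m (insert y \<nu>)))"
    using tau_cross[OF k h] by simp
qed

lemma schur_at_alg:
  assumes "1 \<le> k" "k \<le> n" "h \<in> alg k"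
  shows "schur_at k h"
  using assms
proof (induction k arbitrary: h rule: nat_induct_at_least)
  case base
  then have "h \<in> bim 0 m False" using alg_span_base by auto
  then show ?case
  proof induction
    case (power z h a)
    then obtain c where "h = of_k c" using alg_0_scalar by blast
    then show ?case using power schur_at_power_base[of a c] by (simp add: schur_at_add)
  qed (simp_all add: schur_at_zero)
next
  case (Suc k)
  have "h \<in> bim k m (1 \<le> k)" using alg_span[of k] Suc.prems by auto
  then show ?case
  proof induction
    case (power z h a)
    then show ?case using Suc by (intro schur_at_add schur_at_power) auto
  next
    case (cross z h1 h2)
    then show ?case using Suc by (intro schur_at_add schur_at_cross) (auto intro: gen_alg.mult)
  qed (rule schur_at_zero)
qed

theorem trace_form_eq_characters:
  assumes "h \<in> alg n"
  shows "tau h = (\<Sum>D\<in>diagrams m n. (\<Sum>p\<in>paths m D. R D h p p) / diagram_schur Q m D)"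
proof -
  obtain \<chi> where \<chi>: "partial_characters n h \<chi>"
     "tau (h * top n) = (\<Sum>\<nu>\<in>diagrams m n. (\<Sum>r\<in>removable m \<nu>. \<chi> \<nu> r) / diagram_schur Q m \<nu>)"
    using schur_at_alg[OF n_pos order.refl assms] unfolding schur_at_def by blast
  have "(\<Sum>p\<in>paths m D. R D h p p) = (\<Sum>r\<in>removable m D. \<chi> D r)" if D: "D \<in> diagrams m n" for D
  proof -
    obtain p0 where p0: "p0 \<in> paths m D" using paths_nonempty D by (auto simp: diagrams_def)
    have len: "length p = n" if "p \<in> paths m D" for p using path_length[OF that] card_D[OF D] by simp
    have tk: "set (take n p0) = D" using len[OF p0] p0 by (simp add: paths_def)
    have "(\<Sum>p\<in>paths m D. R D h p p) = (\<Sum>p | p \<in> paths m D \<and> drop n p = drop n p0. R D h p p)"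
      by (rule sum.cong) (use len p0 in auto)
    also have "\<dots> = (\<Sum>r\<in>removable m (set (take n p0)).
        \<Sum>p | p \<in> paths m D \<and> drop n p = drop n p0 \<and> p ! (n - 1) = r. R D h p p)"
      by (rule sum_paths_by_last[OF p0 n_pos]) (simp add: card_D[OF D])
    also have "\<dots> = (\<Sum>r\<in>removable m D. \<chi> D r)"
      by (rule sum.cong) (use partial_charactersD[OF \<chi>(1) D p0] tk in auto)
    finally show ?thesis .
  qed
  then show ?thesis using \<chi>(2) by (simp add: top_n)
qed

text \<open>As contents separate paths, also across shapes, every other path differs from
  \<open>p0\<close> in the content at some index. The product of the corresponding linear factors in
  the Jucys--Murphy elements kills all other basis vectors.\<close>

lemma separating_element:
  assumes D0: "D0 \<in> diagrams m n" and p0: "p0 \<in> paths m D0"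
  obtains F e where "e \<noteq> 0" "\<And>D p. D \<in> diagrams m n \<Longrightarrow> p \<in> paths m D \<Longrightarrow> R D F p p = (if p = p0 then e else 0)"
proof -
  define Z where "Z = (\<Union>D\<in>diagrams m n. paths m D) - {p0}"
  have "finite Z" unfolding Z_def using finite_diagrams finite_paths by auto
  then obtain qs where qs: "set qs = Z" using finite_list by blast
  have "\<exists>k<n. node_content Q (p0 ! k) \<noteq> node_content Q (q ! k)" if q: "q \<in> Z" for q
  proof (rule ccontr)
    assume "\<not> ?thesis"
    moreover obtain D where D: "D \<in> diagrams m n" "q \<in> paths m D" using q by (auto simp: Z_def)
    ultimately have "take n p0 = take n q"
      using sep.path_take_unique[OF _ p0 D(2)] card_D[OF D0] card_D[OF D(1)] by auto
    then have "p0 = q" using path_length[OF p0] path_length[OF D(2)] card_D[OF D0] card_D[OF D(1)] by simp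
    then show False using q by (simp add: Z_def)
  qed
  then obtain \<kappa> where \<kappa>: "\<And>q. q \<in> Z \<Longrightarrow> \<kappa> q < n \<and> node_content Q (p0 ! \<kappa> q) \<noteq> node_content Q (q ! \<kappa> q)"
    by metis
  define F where "F qs = prod_list (map (\<lambda>q. x (Suc (\<kappa> q)) + of_k (- node_content Q (q ! \<kappa> q))) qs)" for qs
  have RF: "R D (F qs) p p = prod_list (map (\<lambda>q. node_content Q (p ! \<kappa> q) - node_content Q (q ! \<kappa> q)) qs)"
    if D: "D \<in> diagrams m n" and p: "p \<in> paths m D" and "set qs \<subseteq> Z" for D p qs
    using that(3)
  proof (induction qs rule: rev_induct)
    case Nil
    then show ?case using R_one[OF D p p] by (simp add: F_def)
  next
    case (snoc q qs)
    define c where "c = node_content Q (q ! \<kappa> q)"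
    have k: "\<kappa> q < n" using \<kappa> snoc.prems by auto
    have "F (qs @ [q]) = F qs * x (Suc (\<kappa> q)) + of_k (- c) * F qs"
      unfolding of_k_central by (simp add: F_def c_def distrib_left)
    then have "R D (F (qs @ [q])) p p = R D (F qs) p p * node_content Q (p ! \<kappa> q) + (- c) * R D (F qs) p p"
      using R_add[OF D p p] R_scale[OF D p p] R_jm_right[OF D p p k] by simp
    then show ?case using snoc by (simp add: c_def algebra_simps)
  qed
  show thesis
  proof
    show "prod_list (map (\<lambda>q. node_content Q (p0 ! \<kappa> q) - node_content Q (q ! \<kappa> q)) qs) \<noteq> 0"
      using \<kappa> qs by (auto simp: prod_list_zero_iff)
    fix D p assume D: "D \<in> diagrams m n" and p: "p \<in> paths m D"
    show "R D (F qs) p p = (if p = p0 then prod_list (map (\<lambda>q. node_content Q (p0 ! \<kappa> q) - node_content Q (q ! \<kappa> q)) qs) else 0)"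
    proof (cases "p = p0")
      case True
      then show ?thesis using RF[OF D p] qs by simp
    next
      case False
      then have "p \<in> set qs" using qs D p by (auto simp: Z_def)
      then have "prod_list (map (\<lambda>q. node_content Q (p ! \<kappa> q) - node_content Q (q ! \<kappa> q)) qs) = 0"
        by (auto simp: prod_list_zero_iff image_iff)
      then show ?thesis using RF[OF D p] qs False by simp
    qed
  qed
qed

lemma characters_independent:
  assumes "\<And>h. (\<Sum>D\<in>diagrams m n. (\<Sum>p\<in>paths m D. R D h p p) * c D) = 0" and D0: "D0 \<in> diagrams m n"
  shows "c D0 = 0"
proof -
  obtain p0 where p0: "p0 \<in> paths m D0" using paths_nonempty D0 by (auto simp: diagrams_def)
  obtain F e where e: "e \<noteq> 0"
    and F: "\<And>D p. D \<in> diagrams m n \<Longrightarrow> p \<in> paths m D \<Longrightarrow> R D F p p = (if p = p0 then e else 0)"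
    by (rule separating_element[OF D0 p0]) (rule that)
  have "(\<Sum>p\<in>paths m D. R D F p p) = (if D = D0 then e else 0)" if D: "D \<in> diagrams m n" for D
  proof -
    have "(\<Sum>p\<in>paths m D. R D F p p) = (\<Sum>p\<in>paths m D. if p = p0 then e else 0)"
      by (rule sum.cong) (use F[OF D] in auto)
    also have "\<dots> = (if p0 \<in> paths m D then e else 0)" using finite_paths by simp
    also have "p0 \<in> paths m D \<longleftrightarrow> D = D0" using p0 by (auto simp: paths_def)
    finally show ?thesis .
  qed
  then have "(\<Sum>D\<in>diagrams m n. (\<Sum>p\<in>paths m D. R D F p p) * c D) = (\<Sum>D\<in>diagrams m n. if D = D0 then e * c D0 else 0)"
    by (intro sum.cong) auto
  then have "e * c D0 = 0" using assms(1)[of F] D0 finite_diagrams by simp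
  then show ?thesis using e by simp
qed

lemma alg_sum: "(\<And>i. i \<in> I \<Longrightarrow> f i \<in> alg k) \<Longrightarrow> sum f I \<in> alg k"
  by (induction I rule: infinite_finite_induct) (auto intro: alg_zero gen_alg.add)

lemma basis_elt_alg:
  assumes "b \<in> basis_index s m n"
  shows "basis_elt s n b \<in> alg n"
proof -
  have "basis_elt s n b = jm_monomial s (fst b) * snd b"
    using assms by (auto simp: basis_elt_def jm_monomial_def basis_index_def)
  moreover have "length (fst b) = n" "snd b \<in> sym_part s n" using assms by (auto simp: basis_index_def)
  ultimately show ?thesis using jm_monomial_alg[of "fst b" n] sym_part_alg by (auto intro: gen_alg.mult)
qed

end

section \<open>From matrix representations to entries indexed by paths\<close>

lemma mtrace_mult_commute:
  fixes A B :: "'k::field mat"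
  assumes "A \<in> carrier_mat d d" "B \<in> carrier_mat d d"
  shows "mtrace (A * B) = mtrace (B * A)"
proof -
  have *: "mtrace (A * B) = (\<Sum>i<d. \<Sum>j<d. A $$ (i,j) * B $$ (j,i))"
    if "A \<in> carrier_mat d d" "B \<in> carrier_mat d d" for A B :: "'k mat"
    using that by (auto simp: mtrace_def scalar_prod_def atLeast0LessThan intro!: sum.cong)
  show ?thesis unfolding *[OF assms] *[OF assms(2,1)] by (subst sum.swap) (simp add: mult.commute)
qed

text \<open>The conditions of \<open>hecke_reps\<close> for a single shape, together with the trace,
  packaged as a predicate so that \<open>R\<close> can be chosen for all shapes at once.\<close>

definition path_entries :: "('k::field \<Rightarrow> 'a::ring_1) \<Rightarrow> (nat \<Rightarrow> 'k) \<Rightarrow> nat \<Rightarrow> (nat \<Rightarrow> 'a) \<Rightarrow> node list set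
    \<Rightarrow> ('a \<Rightarrow> 'k mat) \<Rightarrow> ('a \<Rightarrow> node list \<Rightarrow> node list \<Rightarrow> 'k) \<Rightarrow> bool" where
  "path_entries of_k Q n s P rho R \<longleftrightarrow> (\<forall>a b. \<forall>p\<in>P. \<forall>q\<in>P. R (a + b) p q = R a p q + R b p q)
    \<and> (\<forall>c a. \<forall>p\<in>P. \<forall>q\<in>P. R (of_k c * a) p q = c * R a p q)
    \<and> (\<forall>a b. \<forall>p\<in>P. \<forall>q\<in>P. R (a * b) p q = (\<Sum>r\<in>P. R a p r * R b r q))
    \<and> (\<forall>p\<in>P. \<forall>q\<in>P. R 1 p q = (if p = q then 1 else 0))
    \<and> (\<forall>k<n. \<forall>p\<in>P. \<forall>q\<in>P. R (jm s (Suc k)) p q = (if p = q then node_content Q (p ! k) else 0))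
    \<and> (\<forall>h. mtrace (rho h) = (\<Sum>p\<in>P. R h p p))"

text \<open>Conjugation into the eigenbasis keeps products and trace and makes the Jucys--Murphy
  elements diagonal; the rows and columns are then relabelled from numbers via tableaux to
  paths.\<close>

lemma specht_rep_entries:
  fixes rho :: "'a::ring_1 \<Rightarrow> 'k::field mat"
  assumes \<mu>: "\<mu> \<in> multipartitions m n" and rep: "is_specht_rep of_k Q n s \<mu> rho"
  defines "P \<equiv> paths m (mnodes \<mu>)"
  shows "\<exists>R. path_entries of_k Q n s P rho R"
proof -
  define d where "d = card (std_tableaux \<mu> n)"
  obtain enum B Bi where rho: "is_rep of_k d rho" and enum: "bij_betw enum {..<d} (std_tableaux \<mu> n)"
    and B: "B \<in> carrier_mat d d" "Bi \<in> carrier_mat d d" "B * Bi = 1\<^sub>m d" "Bi * B = 1\<^sub>m d"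
    and jmB: "\<And>k. k \<in> {1..n} \<Longrightarrow> Bi * rho (jm s k) * B
              = mat d d (\<lambda>(a,b). if a = b then tab_content Q \<mu> (enum a) k else 0)"
    using rep unfolding is_specht_rep_def Let_def d_def by blast
  have rc: "rho a \<in> carrier_mat d d" for a using rho by (simp add: is_rep_def)
  define M where "M a = Bi * rho a * B" for a
  have M: "M a \<in> carrier_mat d d" for a unfolding M_def using B rc by auto
  have M_add: "M (a + b) = M a + M b" for a b
  proof -
    have "rho (a + b) = rho a + rho b" using rho by (simp add: is_rep_def)
    then show ?thesis unfolding M_def using B rc[of a] rc[of b]
      by (simp add: mult_add_distrib_mat[of _ d d] add_mult_distrib_mat[of _ d d])
  qed
  have M_scale: "M (of_k c * a) = c \<cdot>\<^sub>m M a" for c a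
  proof -
    have "rho (of_k c * a) = c \<cdot>\<^sub>m rho a" using rho unfolding is_rep_def by blast
    then show ?thesis unfolding M_def using B rc[of a]
      by (simp add: mult_smult_distrib[of _ d d _ d] mult_smult_assoc_mat[of _ d d _ d])
  qed
  have M_mult: "M (a * b) = M a * M b" for a b
  proof -
    have r: "rho (a * b) = rho a * rho b" using rho by (simp add: is_rep_def)
    have "M a * M b = Bi * rho a * (B * (Bi * rho b * B))"
      unfolding M_def using B rc[of a] rc[of b] by (intro assoc_mult_mat[of _ d d _ d _ d]) auto
    also have "B * (Bi * rho b * B) = B * (Bi * rho b) * B"
      using B rc[of b] by (intro assoc_mult_mat[symmetric, of _ d d _ d _ d]) auto
    also have "B * (Bi * rho b) = B * Bi * rho b"
      using B rc[of b] by (intro assoc_mult_mat[symmetric, of _ d d _ d _ d]) auto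
    also have "B * Bi * rho b * B = rho b * B" unfolding B(3) using rc[of b] B by simp
    also have "Bi * rho a * (rho b * B) = M (a * b)"
      unfolding M_def r using B rc[of a] rc[of b] by (simp add: assoc_mult_mat[of _ d d _ d _ d])
    finally show ?thesis by simp
  qed
  have M_one: "M 1 = 1\<^sub>m d"
  proof -
    have "rho 1 = 1\<^sub>m d" using rho by (simp add: is_rep_def)
    then show ?thesis unfolding M_def using B by simp
  qed
  have M_trace: "mtrace (rho a) = mtrace (M a)" for a
  proof -
    have "mtrace (M a) = mtrace (Bi * (rho a * B))" unfolding M_def using B rc[of a] by (simp add: assoc_mult_mat[of _ d d _ d _ d])
    also have "\<dots> = mtrace (rho a * B * Bi)" using B rc[of a] by (intro mtrace_mult_commute[of _ d]) auto
    also have "rho a * B * Bi = rho a * (B * Bi)"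
      using B rc[of a] by (intro assoc_mult_mat[of _ d d _ d _ d]) auto
    finally show ?thesis unfolding B(3) using rc[of a] by simp
  qed
  define \<pi> where "\<pi> = tableau_path \<mu> n \<circ> enum"
  have \<pi>: "bij_betw \<pi> {..<d} P"
    unfolding \<pi>_def P_def by (rule bij_betw_trans[OF enum bij_tableau_path[OF \<mu>]])
  define ix where "ix = inv_into {..<d} \<pi>"
  have ix: "bij_betw ix P {..<d}" unfolding ix_def by (rule bij_betw_inv_into[OF \<pi>])
  have ixd: "ix p < d" "\<pi> (ix p) = p" if "p \<in> P" for p
    using that bij_betw_apply[OF ix] bij_betw_inv_into_right[OF \<pi>] by (auto simp: ix_def)
  have ixeq: "ix p = ix q \<longleftrightarrow> p = q" if "p \<in> P" "q \<in> P" for p q using ixd(2) that by metis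
  have reindex: "(\<Sum>r\<in>P. f (ix r)) = (\<Sum>i<d. f i)" for f :: "nat \<Rightarrow> 'k"
    by (rule sum.reindex_bij_betw[OF ix])
  define R where "R a p q = M a $$ (ix p, ix q)" for a p q
  have "R (a * b) p q = (\<Sum>r\<in>P. R a p r * R b r q)" if pq: "p \<in> P" "q \<in> P" for a b p q
  proof -
    have "R (a * b) p q = (\<Sum>i<d. M a $$ (ix p, i) * M b $$ (i, ix q))"
      unfolding R_def M_mult using M[of a] M[of b] ixd[OF pq(1)] ixd[OF pq(2)]
      by (simp add: scalar_prod_def atLeast0LessThan)
    also have "\<dots> = (\<Sum>r\<in>P. R a p r * R b r q)"
      unfolding R_def using reindex[of "\<lambda>i. M a $$ (ix p, i) * M b $$ (i, ix q)"] by simp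
    finally show ?thesis .
  qed
  moreover have "R (jm s (Suc k)) p q = (if p = q then node_content Q (p ! k) else 0)"
    if pq: "p \<in> P" "q \<in> P" and k: "k < n" for p q k
  proof -
    have "R (jm s (Suc k)) p q = (if ix p = ix q then tab_content Q \<mu> (enum (ix p)) (Suc k) else 0)"
      unfolding R_def M_def using jmB[of "Suc k"] k ixd[OF pq(1)] ixd[OF pq(2)] by simp
    moreover have "tab_content Q \<mu> (enum (ix p)) (Suc k) = node_content Q (p ! k)"
      using tab_content_path[of "Suc k" n Q \<mu> "enum (ix p)"] k ixd(2)[OF pq(1)] by (simp add: \<pi>_def)
    ultimately show ?thesis using ixeq[OF pq] by auto
  qed
  moreover have "mtrace (rho h) = (\<Sum>p\<in>P. R h p p)" for h
    unfolding M_trace R_def reindex[of "\<lambda>i. M h $$ (i,i)"] using M[of h] by (simp add: mtrace_def)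
  moreover have "R (a + b) p q = R a p q + R b p q" "R (of_k c * a) p q = c * R a p q"
      "R 1 p q = (if p = q then 1 else 0)" if pq: "p \<in> P" "q \<in> P" for a b c p q
    unfolding R_def M_add M_scale M_one using M[of a] M[of b] ixd[OF pq(1)] ixd[OF pq(2)] ixeq[OF pq] by auto
  ultimately show ?thesis unfolding path_entries_def by (intro exI[of _ R]) simp
qed

lemma schur_formulas_eq: "schur_formula1 Q m \<mu> = schur_formula2 Q m \<mu>"
  unfolding schur_formula1_def schur_formula2_def hook_def
proof (intro prod.cong refl, clarify)
  fix t i j assume t: "t \<in> {1..m}"
  show "(\<Prod>u\<in>{1..m}. of_int (ghook (\<mu> ! (t - 1)) (\<mu> ! (u - 1)) i j) + Q t - Q u)
      = of_int (ghook (\<mu> ! (t - 1)) (\<mu> ! (t - 1)) i j) *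
        (\<Prod>u\<in>{1..m} - {t}. of_int (ghook (\<mu> ! (t - 1)) (\<mu> ! (u - 1)) i j) + Q t - Q u)"
    by (subst prod.remove[OF _ t]) simp_all
qed

theorem theorem4p2:
  fixes of_k :: "'k::field \<Rightarrow> 'a::ring_1"
    and Q :: "nat \<Rightarrow> 'k" and m n :: nat
    and s :: "nat \<Rightarrow> 'a" and tau :: "'a \<Rightarrow> 'k"
    and rho :: "nat list list \<Rightarrow> 'a \<Rightarrow> 'k mat"
    and lam :: "nat list list"
  assumes "1 \<le> m" and "1 \<le> n"
    and "separated Q m n"
    and "is_dc_hecke of_k Q m n s"
    and "is_trace_form of_k m n s tau"
    and "\<forall>mu\<in>multipartitions m n. is_specht_rep of_k Q n s mu (rho mu)"
    and "lam \<in> multipartitions m n"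
  shows "schur_elements tau (\<lambda>mu h. mtrace (rho mu h)) (multipartitions m n) lam
           = schur_formula1 Q m lam
       \<and> schur_formula1 Q m lam = schur_formula2 Q m lam"
proof -
  define I where "I = multipartitions m n"
  have "\<exists>R. path_entries of_k Q n s (paths m D) (rho (diagram_parts m D)) R" if D: "D \<in> diagrams m n" for D
  proof -
    have \<mu>: "diagram_parts m D \<in> multipartitions m n" by (rule diagram_parts_multipartition[OF D])
    have e: "mnodes (diagram_parts m D) = D" using mnodes_diagram_parts D by (simp add: diagrams_def)
    show ?thesis
      using specht_rep_entries[OF \<mu>, of of_k Q s "rho (diagram_parts m D)"] assms(6) \<mu>
      unfolding e by blast
  qed
  then obtain R where R: "\<And>D. D \<in> diagrams m n \<Longrightarrow> path_entries of_k Q n s (paths m D) (rho (diagram_parts m D)) (R D)"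
    by metis
  interpret hecke_reps of_k Q m n s tau R
  proof unfold_locales
    show "is_k_algebra of_k" "hecke_relations of_k Q m n s" "card (sym_part s n) = fact n"
      using assms(4) unfolding is_dc_hecke_def by blast+
  next
    fix D p q assume D: "D \<in> diagrams m n" and p: "p \<in> paths m D" and q: "q \<in> paths m D"
    note E = R[OF D, unfolded path_entries_def]
    show "R D (a + b) p q = R D a p q + R D b p q" "R D (of_k c * a) p q = c * R D a p q"
      "R D (a * b) p q = (\<Sum>r\<in>paths m D. R D a p r * R D b r q)" "R D 1 p q = (if p = q then 1 else 0)"
      for a b c using E p q by blast+
    show "R D (jm s (Suc k)) p q = (if p = q then node_content Q (p ! k) else 0)" if "k < n" for k
      using E p q that by blast
  qed (use assms in auto)
  \<comment> \<open>The basis elements of \<open>is_dc_hecke\<close> lie in \<open>alg n\<close>, so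
    the character formula covers the whole algebra.\<close>
  have alg: "h \<in> alg n" for h
  proof -
    obtain c where "h = (\<Sum>b\<in>basis_index s m n. of_k (c b) * basis_elt s n b)"
      using assms(4) unfolding is_dc_hecke_def by blast
    then show ?thesis by (auto intro!: alg_sum gen_alg.mult gen_alg.scalar basis_elt_alg)
  qed
  have chi: "mtrace (rho \<mu> h) = (\<Sum>p\<in>paths m (mnodes \<mu>). R (mnodes \<mu>) h p p)" if "\<mu> \<in> I" for \<mu> h
    using R[of "mnodes \<mu>"] bij_betw_apply[OF bij_mnodes, of \<mu> m n] diagram_parts_mnodes[of \<mu> m n] that
    by (simp add: path_entries_def I_def)
  have sum_I: "(\<Sum>\<mu>\<in>I. f (mnodes \<mu>)) = (\<Sum>D\<in>diagrams m n. f D)" for f :: "node set \<Rightarrow> 'k"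
    unfolding I_def by (rule sum.reindex_bij_betw[OF bij_mnodes])
  \<comment> \<open>The value 0 outside \<open>I\<close> is prescribed in
    \<open>schur_elements\<close>, to make the description unique.\<close>
  define S0 where "S0 \<mu> = (if \<mu> \<in> I then schur_formula1 Q m \<mu> else 0)" for \<mu>
  have S0: "tau h = (\<Sum>\<mu>\<in>I. mtrace (rho \<mu> h) / S0 \<mu>)" for h
  proof -
    have "tau h = (\<Sum>\<mu>\<in>I. (\<Sum>p\<in>paths m (mnodes \<mu>). R (mnodes \<mu>) h p p) / diagram_schur Q m (mnodes \<mu>))"
      unfolding trace_form_eq_characters[OF alg]
      by (rule sum_I[symmetric, of "\<lambda>D. (\<Sum>p\<in>paths m D. R D h p p) / diagram_schur Q m D"])
    also have "\<dots> = (\<Sum>\<mu>\<in>I. mtrace (rho \<mu> h) / S0 \<mu>)"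
      by (rule sum.cong) (auto simp: chi S0_def schur_formula1_eq[of _ m n] I_def)
    finally show ?thesis .
  qed
  have unique: "S = S0" if S: "\<forall>\<mu>. \<mu> \<notin> I \<longrightarrow> S \<mu> = 0" "\<forall>h. tau h = (\<Sum>\<mu>\<in>I. mtrace (rho \<mu> h) / S \<mu>)" for S
  proof
    fix \<mu>
    show "S \<mu> = S0 \<mu>"
    proof (cases "\<mu> \<in> I")
      case True
      \<comment> \<open>It suffices to compare inverses: with the convention 1/0 = 0 inversion is
        injective, so a candidate \<open>S\<close> that takes the value 0 on \<open>I\<close> is
        covered too.\<close>
      define c where "c D = 1 / S (diagram_parts m D) - 1 / S0 (diagram_parts m D)" for D
      have parts: "diagram_parts m (mnodes \<nu>) = \<nu>" if "\<nu> \<in> I" for \<nu>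
        using that diagram_parts_mnodes by (simp add: I_def)
      have "(\<Sum>D\<in>diagrams m n. (\<Sum>p\<in>paths m D. R D h p p) * c D) = 0" for h
      proof -
        have "(\<Sum>D\<in>diagrams m n. (\<Sum>p\<in>paths m D. R D h p p) * c D)
            = (\<Sum>\<nu>\<in>I. (\<Sum>p\<in>paths m (mnodes \<nu>). R (mnodes \<nu>) h p p) * c (mnodes \<nu>))"
          by (rule sum_I[symmetric])
        also have "\<dots> = (\<Sum>\<nu>\<in>I. mtrace (rho \<nu> h) / S \<nu> - mtrace (rho \<nu> h) / S0 \<nu>)"
          by (rule sum.cong) (auto simp: chi c_def parts algebra_simps)
        also have "\<dots> = tau h - tau h" unfolding sum_subtractf using S(2) S0 by metis
        finally show ?thesis by simp
      qed
      then have "c (mnodes \<mu>) = 0"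
        using characters_independent bij_betw_apply[OF bij_mnodes] True unfolding I_def by blast
      then show ?thesis using parts[OF True] by (simp add: c_def)
    next
      case False
      then show ?thesis using S(1) by (simp add: S0_def)
    qed
  qed
  have "schur_elements tau (\<lambda>mu h. mtrace (rho mu h)) I = S0"
    unfolding schur_elements_def
  proof (rule the_equality)
    show "(\<forall>\<mu>. \<mu> \<notin> I \<longrightarrow> S0 \<mu> = 0) \<and> (\<forall>h. tau h = (\<Sum>\<mu>\<in>I. mtrace (rho \<mu> h) / S0 \<mu>))"
      using S0 by (simp add: S0_def)
  qed (use unique in blast)
  then show ?thesis using assms(7) schur_formulas_eq by (simp add: I_def S0_def)
qed

end
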